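(* Let $\lambda_1,\lambda_2>0$ and let $\mu>\lambda_1+\lambda_2$. Let $A$ and $S$ be independent Poisson processes on $\mathbb{R}$ of rates $\lambda_1$ and $\lambda_1+\lambda_2$ respectively, let $D=D(A,S)$ and $U=S-D$ be the departure and unused service processes of the queue with arrivals $A$ and services $S$, and let $F_{2,\lambda_1,\lambda_2}$ be the distribution of the two-type process $(D,U)$, in which first-class customers occur at the points of $D$ and second-class customers at the points of $U$. Then $F_{2,\lambda_1,\lambda_2}$ is a fixed point for a $./M/1$ queue with service rate $\mu$: if $\underline{A}$ is a two-type arrival process with distribution $F_{2,\lambda_1,\lambda_2}$ and $S_\mu$ is an independent Poisson process on $\mathbb{R}$ of rate $\mu$, then the two-type departure process $D(\underline{A},S_\mu)$ has distribution $F_{2,\lambda_1,\lambda_2}$.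
   Context: **Continuous-time queue.** Processes are random locally finite point configurations on $\mathbb{R}$, identified with their counting measures. Given an arrival process $A$ and a simple service process $S$, an arrival increases the queue length by 1; at each point of $S$ one customer departs if the queue is non-empty, and otherwise that point is an unused service. The queue is run from time $-\infty$: the departure process $D(A,S)$ consists of those points $t$ of $S$ such that $\sup_{s\le t}\{A([s,t])-S([s,t))\}\ge1$ (arrivals at a given time precede the service at that time), and the unused service process is $U=S-D(A,S)$. **Two-type queue.** Given a two-type arrival process $\underline{A}=(A^{=1},A^{=2})$ (first-class customers have priority over second-class customers), the two-type departure process $D(\underline{A},S)=(D^{=1},D^{=2})$ is defined by $D^{=1}=D(A^{=1},S)$ and $D^{=1}+D^{=2}=D(A^{=1}+A^{=2},S)$. *)

theory Defs
  imports "HOL-Probability.Probability"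
begin

text \<open>
  A point configuration on the real line is given by its multiplicity function: \<open>n t\<close> is the
  number of points at \<open>t\<close>, that is, the mass at \<open>t\<close> of the counting measure. Sums and
  differences of counting measures are then pointwise.
\<close>
type_synonym config = "real \<Rightarrow> nat"

definition locally_finite :: "config \<Rightarrow> bool" where
  "locally_finite n \<longleftrightarrow> (\<forall>a b. finite {t \<in> {a..b}. n t \<noteq> 0})"

text \<open>The mass that the counting measure assigns to \<open>B\<close>; only meaningful for bounded \<open>B\<close>.\<close>
definition num_points :: "config \<Rightarrow> real set \<Rightarrow> nat" where
  "num_points n B = (\<Sum>t\<in>{t \<in> B. n t \<noteq> 0}. n t)"

text \<open>
  The locally finite configurations with the sigma-algebra generated by the counts of
  points in bounded Borel sets.
\<close>
definition config_space :: "config measure" where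
  "config_space = sigma {n. locally_finite n}
     {{n. locally_finite n \<and> num_points n B = k} |B k. B \<in> sets borel \<and> bounded B}"

text \<open>
  Independence of two random variables. The library's \<^const>\<open>prob_space.indep_var\<close> forces
  both variables to have the same value type; where it applies, the two notions agree.
\<close>
definition indep_rvs ::
    "'w measure \<Rightarrow> 'x measure \<Rightarrow> ('w \<Rightarrow> 'x) \<Rightarrow> 'y measure \<Rightarrow> ('w \<Rightarrow> 'y) \<Rightarrow> bool" where
  "indep_rvs M MX X MY Y \<longleftrightarrow> X \<in> M \<rightarrow>\<^sub>M MX \<and> Y \<in> M \<rightarrow>\<^sub>M MY \<and>
     prob_space.indep_set M {X -` B \<inter> space M |B. B \<in> sets MX} {Y -` B \<inter> space M |B. B \<in> sets MY}"

lemma indep_rvs_iff_indep_var: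
  assumes "prob_space M"
  shows "indep_rvs M MX X MY Y \<longleftrightarrow> prob_space.indep_var M MX X MY Y"
proof -
  interpret prob_space M by fact
  have *: "sigma_sets (space M) {Z -` B \<inter> space M |B. B \<in> sets MZ} = {Z -` B \<inter> space M |B. B \<in> sets MZ}"
    if "Z \<in> M \<rightarrow>\<^sub>M MZ" for Z :: "'a \<Rightarrow> 'b" and MZ
  proof -
    have "Z \<in> space M \<rightarrow> space MZ"
      using that by (auto dest: measurable_space)
    then show ?thesis
      by (rule trans[OF sets_vimage_algebra[symmetric] sets_vimage_algebra2])
  qed
  show ?thesis
    unfolding indep_rvs_def indep_var_eq using * by auto
qed

text \<open>
  The Poisson weights are written out because \<^const>\<open>poisson_pmf\<close> requires a positive parameter,
  while \<open>B\<close> may be a null set; with \<open>0 ^ 0 = 1\<close> the formula gives the unit mass at \<open>0\<close> then.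
\<close>
definition poisson_process :: "'w measure \<Rightarrow> real \<Rightarrow> ('w \<Rightarrow> config) \<Rightarrow> bool" where
  "poisson_process M r X \<longleftrightarrow>
     X \<in> M \<rightarrow>\<^sub>M config_space \<and>
     (\<forall>B k. B \<in> sets borel \<longrightarrow> bounded B \<longrightarrow>
        measure M {\<omega> \<in> space M. num_points (X \<omega>) B = k} =
          (r * measure lborel B) ^ k / fact k * exp (- (r * measure lborel B))) \<and>
     (\<forall>(I :: nat set) B. finite I \<longrightarrow> (\<forall>i\<in>I. B i \<in> sets borel \<and> bounded (B i)) \<longrightarrow>
        disjoint_family_on B I \<longrightarrow>
        prob_space.indep_vars M (\<lambda>_. count_space UNIV) (\<lambda>i \<omega>. num_points (X \<omega>) (B i)) I)"

text \<open>
  The supremum is taken in the extended reals, since it may be infinite. The service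
  configuration is meant to be simple; if it is not, a multiple point of \<open>S\<close> counts as a
  single service (for Poisson services this is a null event).
\<close>
definition departures :: "config \<Rightarrow> config \<Rightarrow> config" where
  "departures A S = (\<lambda>t.
     if S t \<noteq> 0 \<and>
        (SUP s\<in>{..t}. ereal (real (num_points A {s..t}) - real (num_points S {s..<t}))) \<ge> 1
     then 1 else 0)"

definition unused_services :: "config \<Rightarrow> config \<Rightarrow> config" where
  "unused_services A S = (\<lambda>t. S t - departures A S t)"

text \<open>
  The pair \<open>(D1, D2)\<close> with \<open>D1 = departures A1 S\<close> and \<open>D1 + D2 = departures (A1 + A2) S\<close>.
\<close>
definition two_type_departures :: "config \<times> config \<Rightarrow> config \<Rightarrow> config \<times> config" where
  "two_type_departures A S =
     (departures (fst A) S,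
      \<lambda>t. departures (\<lambda>u. fst A u + snd A u) S t - departures (fst A) S t)"

text \<open>The subtractions on \<^typ>\<open>nat\<close> above do not truncate:\<close>

lemma departures_le: "departures A S t \<le> S t"
  by (simp add: departures_def)

lemma num_points_mono:
  assumes "\<And>t. A t \<le> A' t" and "locally_finite A'"
  shows "num_points A {s..t} \<le> num_points A' {s..t}"
proof -
  have fin: "finite {u \<in> {s..t}. A' u \<noteq> 0}"
    using assms(2) by (simp add: locally_finite_def)
  have sub: "{u \<in> {s..t}. A u \<noteq> 0} \<subseteq> {u \<in> {s..t}. A' u \<noteq> 0}"
    using assms(1) by (auto intro: less_le_trans)
  have "num_points A {s..t} \<le> (\<Sum>u\<in>{u \<in> {s..t}. A u \<noteq> 0}. A' u)"
    unfolding num_points_def by (rule sum_mono) (rule assms(1))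
  also have "\<dots> \<le> num_points A' {s..t}"
    unfolding num_points_def by (rule sum_mono2[OF fin sub]) simp
  finally show ?thesis .
qed

lemma departures_mono:
  assumes "\<And>t. A t \<le> A' t" and "locally_finite A'"
  shows "departures A S t \<le> departures A' S t"
proof -
  have "(SUP s\<in>{..t}. ereal (real (num_points A {s..t}) - real (num_points S {s..<t})))
      \<le> (SUP s\<in>{..t}. ereal (real (num_points A' {s..t}) - real (num_points S {s..<t})))"
    using num_points_mono[OF assms] by (intro SUP_mono') simp
  then show ?thesis
    unfolding departures_def by (auto intro: order_trans)
qed

lemma two_type_departures_sum:
  assumes "locally_finite A1" and "locally_finite A2"
  shows "fst (two_type_departures (A1, A2) S) t + snd (two_type_departures (A1, A2) S) t
    = departures (\<lambda>u. A1 u + A2 u) S t"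
proof -
  have "locally_finite (\<lambda>u. A1 u + A2 u)"
    unfolding locally_finite_def
  proof (intro allI)
    fix a b :: real
    have "finite ({t \<in> {a..b}. A1 t \<noteq> 0} \<union> {t \<in> {a..b}. A2 t \<noteq> 0})"
      using assms by (simp add: locally_finite_def)
    then show "finite {t \<in> {a..b}. A1 t + A2 t \<noteq> 0}"
      by (rule rev_finite_subset) auto
  qed
  then have "departures A1 S t \<le> departures (\<lambda>u. A1 u + A2 u) S t"
    by (intro departures_mono) auto
  then show ?thesis
    by (simp add: two_type_departures_def)
qed

end

theory Submission
  imports Defs "HOL-Real_Asymp.Real_Asymp"
begin

text \<open>
  Let \<open>A\<close>, \<open>S\<close>, \<open>T\<close> be independent Poisson processes of rates \<open>lam\<^sub>1\<close>, \<open>lam\<^sub>1 + lam\<^sub>2\<close>, \<open>\<mu>\<close>, and put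
  \<open>T' = D(S,T)\<close> and \<open>S' = S + U(S,T)\<close>. Pathwise, the queues can be interchanged:
  \<open>D(D(A,S),T) = D(D(A,S'),T')\<close>. In terms of cumulative counts both sides are variational formulas
  that only involve \<open>A\<close> and a last-passage quantity of the pair of services, and that
  quantity is invariant under \<open>(S,T) \<mapsto> (S',T')\<close>. By Burke's theorem \<open>(T',S')\<close> has the law of \<open>(S,T)\<close>,
  and \<open>D(A,S')\<close> is again Poisson of rate \<open>lam\<^sub>1\<close>, independent of \<open>T'\<close>. So the output
  \<open>(D(D(A,S),T), D(S,T))\<close> of the two-type queue has the law of \<open>(D(A,S), S)\<close>.

  Burke's theorem is obtained by discretization. On a grid so fine that no cell of a large window
  contains two points, the queue is a Markov chain with geometric stationary law, and detailed
  balance makes one step \<open>(queue, input) \<mapsto> (queue, output)\<close> a measure preserving involution. As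
  the grid is refined and the starting time recedes, the chain started in equilibrium merges with
  the queue run from time \<open>-\<infinity>\<close>, because the drift is negative.
\<close>

section \<open>Point configurations\<close>

text \<open>The difficulty in Burke's theorem is that a queue run from -infinity has no initial
  state to condition on. The discrete chain supplies one. In a cell the probabilities of a lone
  arrival and of a lone service have the ratio \<alpha>/\<beta> whatever the mesh, so the same
  geometric law is exactly stationary on every grid. It enters only as a mixture over fixed starting
  values \<open>q\<close>, and for each \<open>q\<close> the chain is compared with the true queue
  path by path. Windows may grow while the mesh shrinks because a cell is crowded with a probability
  quadratic in the mesh: the expected number of crowded cells on grid \<open>n\<close> is of order
  \<open>n / 2 ^ n\<close>, which is summable. The interchange is proved for cumulative counts,
  where departures become a running minimum. The price is that all queues involved must be finite,
  hence the conditions \<open>minorized\<close> and \<open>bounded_queue\<close>. The two-type queue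
  fits in because \<open>D + U = S\<close>: its total arrivals are exactly \<open>S\<close>, so its
  total output is \<open>D(S,T)\<close>.\<close>

lemma finite_points:
  assumes "locally_finite n" and "bounded B"
  shows "finite {t \<in> B. n t \<noteq> 0}"
proof -
  obtain a where "B \<subseteq> {-a..a}"
    using assms(2) unfolding bounded_iff by (force simp: abs_le_iff)
  moreover have "finite {t \<in> {-a..a}. n t \<noteq> 0}"
    using assms(1) by (simp add: locally_finite_def)
  ultimately show ?thesis
    by (elim finite_subset[rotated]) auto
qed

lemma num_points_cong:
  assumes "\<And>t. n t \<noteq> 0 \<Longrightarrow> t \<in> B \<longleftrightarrow> t \<in> C"
  shows "num_points n B = num_points n C"
  unfolding num_points_def using assms by (intro sum.cong) auto

lemma num_points_empty [simp]: "num_points n {} = 0"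
  by (simp add: num_points_def)

lemma num_points_eq_0: "(\<And>t. t \<in> B \<Longrightarrow> n t = 0) \<Longrightarrow> num_points n B = 0"
  unfolding num_points_def by (intro sum.neutral) auto

lemma num_points_singleton [simp]: "num_points n {t} = n t"
proof -
  have "{u \<in> {t}. n u \<noteq> 0} = (if n t = 0 then {} else {t})"
    by auto
  then show ?thesis
    unfolding num_points_def by simp
qed

lemma num_points_superset:
  assumes "finite F" and "{t \<in> B. n t \<noteq> 0} \<subseteq> F"
  shows "num_points n B = (\<Sum>t\<in>F. if t \<in> B then n t else 0)"
proof -
  have "(\<Sum>t\<in>F. if t \<in> B then n t else 0) = (\<Sum>t\<in>{t \<in> B. n t \<noteq> 0}. if t \<in> B then n t else 0)"
    using assms by (intro sum.mono_neutral_right) auto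
  also have "\<dots> = num_points n B"
    unfolding num_points_def by (intro sum.cong) auto
  finally show ?thesis ..
qed

lemma num_points_Un:
  assumes "locally_finite n" and "bounded B" and "bounded C" and "B \<inter> C = {}"
  shows "num_points n (B \<union> C) = num_points n B + num_points n C"
proof -
  let ?F = "{t \<in> B \<union> C. n t \<noteq> 0}"
  have F: "finite ?F"
    using assms by (intro finite_points) auto
  have "num_points n (B \<union> C) = (\<Sum>t\<in>?F. if t \<in> B \<union> C then n t else 0)"
    by (intro num_points_superset F) auto
  also have "\<dots> = (\<Sum>t\<in>?F. (if t \<in> B then n t else 0) + (if t \<in> C then n t else 0))"
    using assms(4) by (intro sum.cong) auto
  also have "\<dots> = num_points n B + num_points n C"
    unfolding sum.distrib
    by (intro arg_cong2[where f = "(+)"] num_points_superset[OF F, symmetric]) auto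
  finally show ?thesis .
qed

lemma num_points_Ioc:
  assumes "locally_finite n" and "s \<le> t" and "t \<le> u"
  shows "num_points n {s<..u} = num_points n {s<..t} + num_points n {t<..u}"
proof -
  have "{s<..u} = {s<..t} \<union> {t<..u}"
    using assms by auto
  then show ?thesis
    using assms by (simp add: num_points_Un)
qed

lemma locally_finite_le:
  assumes "locally_finite n" and "\<And>t. m t \<le> n t"
  shows "locally_finite m"
  unfolding locally_finite_def
proof (intro allI)
  fix a b
  have "finite {t \<in> {a..b}. n t \<noteq> 0}"
    using assms(1) by (simp add: locally_finite_def)
  moreover have "n t \<noteq> 0" if "m t \<noteq> 0" for t
    using assms(2)[of t] that by simp
  ultimately show "finite {t \<in> {a..b}. m t \<noteq> 0}"
    by (elim finite_subset[rotated]) auto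
qed

lemma locally_finite_add:
  assumes "locally_finite m" and "locally_finite n"
  shows "locally_finite (\<lambda>t. m t + n t)"
  unfolding locally_finite_def
proof (intro allI)
  fix a b
  have "finite ({t \<in> {a..b}. m t \<noteq> 0} \<union> {t \<in> {a..b}. n t \<noteq> 0})"
    using assms by (simp add: locally_finite_def)
  then show "finite {t \<in> {a..b}. m t + n t \<noteq> 0}"
    by (elim finite_subset[rotated]) auto
qed

lemma num_points_add:
  assumes "locally_finite m" and "locally_finite n" and "bounded B"
  shows "num_points (\<lambda>t. m t + n t) B = num_points m B + num_points n B"
proof -
  let ?F = "{t \<in> B. m t \<noteq> 0} \<union> {t \<in> B. n t \<noteq> 0}"
  have F: "finite ?F"
    using assms by (intro finite_UnI finite_points)
  have "num_points (\<lambda>t. m t + n t) B = (\<Sum>t\<in>?F. if t \<in> B then m t + n t else 0)"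
    by (intro num_points_superset F) auto
  also have "\<dots> = (\<Sum>t\<in>?F. (if t \<in> B then m t else 0) + (if t \<in> B then n t else 0))"
    by (intro sum.cong) auto
  also have "\<dots> = num_points m B + num_points n B"
    unfolding sum.distrib
    by (intro arg_cong2[where f = "(+)"] num_points_superset[OF F, symmetric]) auto
  finally show ?thesis .
qed

lemma le_num_points:
  assumes "locally_finite n" and "bounded B" and "t \<in> B"
  shows "n t \<le> num_points n B"
proof -
  have "num_points n B = num_points n ({t} \<union> (B - {t}))"
    using assms(3) by (intro num_points_cong) auto
  also have "\<dots> = n t + num_points n (B - {t})"
    using assms by (subst num_points_Un) (auto intro: bounded_subset)
  finally show ?thesis
    by simp
qed

text \<open>Gaps are how local finiteness is used: inside one, endpoints can be moved, closed ends
  traded for open ones, and real times for rational or grid times.\<close>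

lemma gap_right:
  assumes "locally_finite n" and "s < u"
  obtains r where "s < r" "r < u" "\<And>t. s < t \<Longrightarrow> t \<le> r \<Longrightarrow> n t = 0"
proof -
  let ?F = "{t \<in> {s<..u}. n t \<noteq> 0}"
  have F: "finite (insert u ?F)"
    using assms by (intro finite.insertI finite_points) auto
  define v where "v = Min (insert u ?F)"
  have "v \<in> insert u ?F"
    unfolding v_def using F by (intro Min_in) auto
  then have v: "s < v" "v \<le> u"
    using assms(2) by auto
  show ?thesis
  proof (rule that[of "(s + v) / 2"])
    fix t assume t: "s < t" "t \<le> (s + v) / 2"
    have "(s + v) / 2 < v"
      using v by simp
    with t have "t < v"
      by simp
    have "t \<notin> ?F"
    proof
      assume "t \<in> ?F"
      then have "v \<le> t"
        unfolding v_def using F by (intro Min_le) auto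
      then show False
        using \<open>t < v\<close> by simp
    qed
    then show "n t = 0"
      using t(1) v(2) \<open>t < v\<close> by auto
  qed (use v in \<open>auto simp: field_simps\<close>)
qed

lemma gap_left:
  assumes "locally_finite n"
  obtains r where "r < u" "\<And>t. r < t \<Longrightarrow> t < u \<Longrightarrow> n t = 0"
proof -
  let ?F = "{t \<in> {u-1..<u}. n t \<noteq> 0}"
  have F: "finite (insert (u - 1) ?F)"
    using assms by (intro finite.insertI finite_points) auto
  define v where "v = Max (insert (u - 1) ?F)"
  have "v \<in> insert (u - 1) ?F"
    unfolding v_def using F by (intro Max_in) auto
  then have v: "v < u" "u - 1 \<le> v"
    by auto
  show ?thesis
  proof (rule that[OF v(1)])
    fix t assume t: "v < t" "t < u"
    have "t \<notin> ?F"
    proof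
      assume "t \<in> ?F"
      then have "t \<le> v"
        unfolding v_def using F by (intro Max_ge) auto
      then show False
        using \<open>v < t\<close> by simp
    qed
    then show "n t = 0"
      using t v by auto
  qed
qed

text \<open>An interval \<open>{r<..t}\<close> that starts in the gap to the left of
  \<open>t\<close> sees \<open>t\<close> alone, so its count is the multiplicity there.\<close>

lemma config_eqI:
  assumes "locally_finite m" and "locally_finite n"
    and "\<And>s t. s < t \<Longrightarrow> num_points m {s<..t} = num_points n {s<..t}"
  shows "m = n"
proof
  fix t
  obtain r where r: "r < t" "\<And>u. r < u \<Longrightarrow> u < t \<Longrightarrow> m u + n u = 0"
    using gap_left[OF locally_finite_add[OF assms(1,2)]] by blast
  have "num_points m {r<..t} = num_points m {t}" "num_points n {r<..t} = num_points n {t}"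
    using r by (intro num_points_cong; force)+
  then show "m t = n t"
    using assms(3)[OF r(1)] by simp
qed

section \<open>Measurability through grid cells\<close>

lemma space_config_space [simp]: "space config_space = {n. locally_finite n}"
  unfolding config_space_def by (intro space_measure_of) auto

lemma sets_config_space: "sets config_space = sigma_sets {n. locally_finite n}
     {{n. locally_finite n \<and> num_points n B = k} |B k. B \<in> sets borel \<and> bounded B}"
  unfolding config_space_def by (intro sets_measure_of) auto

lemma measurable_num_points [measurable]:
  assumes "B \<in> sets borel" and "bounded B"
  shows "(\<lambda>n. num_points n B) \<in> config_space \<rightarrow>\<^sub>M count_space UNIV"
proof -
  have "(\<lambda>n. num_points n B) -` {k} \<inter> space config_space \<in> sets config_space" for k
  proof -
    have "{n. locally_finite n \<and> num_points n B = k} \<in> sets config_space"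
      unfolding sets_config_space using assms by (intro sigma_sets.Basic) auto
    moreover have "(\<lambda>n. num_points n B) -` {k} \<inter> space config_space
        = {n. locally_finite n \<and> num_points n B = k}"
      by auto
    ultimately show ?thesis
      by simp
  qed
  then show ?thesis
    by (auto simp: measurable_count_space_eq2_countable)
qed

text \<open>A limit theorem for discrete values: a level set of the limit is the lower limit of the
  level sets of the approximations.\<close>

lemma measurable_eventually_eq:
  fixes f :: "nat \<Rightarrow> 'a \<Rightarrow> nat"
  assumes "\<And>n. f n \<in> M \<rightarrow>\<^sub>M count_space UNIV"
    and "\<And>x. x \<in> space M \<Longrightarrow> \<forall>\<^sub>F n in sequentially. f n x = g x"
  shows "g \<in> M \<rightarrow>\<^sub>M count_space UNIV"
proof -
  have [measurable]: "f n \<in> M \<rightarrow>\<^sub>M count_space UNIV" for n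
    by fact
  have "g -` {k} \<inter> space M \<in> sets M" for k
  proof -
    have "g x = k \<longleftrightarrow> (\<exists>N. \<forall>n\<ge>N. f n x = k)" if x: "x \<in> space M" for x
    proof -
      obtain N where N: "\<And>n. n \<ge> N \<Longrightarrow> f n x = g x"
        using assms(2)[OF x] by (auto simp: eventually_sequentially)
      show ?thesis
        by (metis N max.cobounded1 max.cobounded2)
    qed
    then have "g -` {k} \<inter> space M = {x \<in> space M. \<exists>N. \<forall>n\<ge>N. f n x = k}"
      by auto
    also have "\<dots> \<in> sets M"
      by measurable
    finally show ?thesis .
  qed
  then show ?thesis
    by (auto simp: measurable_count_space_eq2_countable)
qed

text \<open>Level \<open>n\<close> is the grid of mesh \<open>2 ^ - n\<close> on the window from \<open>-n\<close> to \<open>n\<close>, so the windows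
  exhaust the line while the grids get finer.\<close>

definition pt :: "nat \<Rightarrow> nat \<Rightarrow> real" where
  "pt n j = real j / 2 ^ n - real n"

definition cell :: "nat \<Rightarrow> nat \<Rightarrow> real set" where
  "cell n j = {pt n j<..pt n (Suc j)}"

definition ncells :: "nat \<Rightarrow> nat" where
  "ncells n = 2 * n * 2 ^ n"

lemma pt_mono: "i \<le> j \<Longrightarrow> pt n i \<le> pt n j"
  by (simp add: pt_def divide_right_mono)

lemma pt_less: "i < j \<Longrightarrow> pt n i < pt n j"
  by (simp add: pt_def divide_strict_right_mono)

lemma pt_Suc: "pt n (Suc j) = pt n j + 1 / 2 ^ n"
  by (simp add: pt_def add_divide_distrib)

lemma pt_ncells: "pt n (ncells n) = real n"
  by (simp add: pt_def ncells_def)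

lemma pt_0: "pt n 0 = - real n"
  by (simp add: pt_def)

lemma cell_sets [measurable, simp]: "cell n j \<in> sets borel"
  and cell_bounded [simp]: "bounded (cell n j)"
  by (auto simp: cell_def)

lemma num_points_grid:
  assumes "locally_finite x" and "i \<le> j"
  shows "num_points x {pt n i<..pt n j} = (\<Sum>k\<in>{i..<j}. num_points x (cell n k))"
  using assms(2)
proof (induction j rule: dec_induct)
  case (step j)
  then show ?case
    using assms(1) num_points_Ioc[of x "pt n i" "pt n j" "pt n (Suc j)"]
    by (simp add: pt_mono cell_def)
qed simp

text \<open>The \<open>+ 1\<close> puts the grid point strictly to the right of \<open>a\<close>,
  even if \<open>a\<close> lies on the grid. Approximation from the right suits
  \<open>{a<..b}\<close>: the piece lost or gained at an end lies in the gap after that end once the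
  mesh is fine.\<close>

definition grid_index :: "nat \<Rightarrow> real \<Rightarrow> nat" where
  "grid_index n a = nat (\<lfloor>(a + real n) * 2 ^ n\<rfloor> + 1)"

lemma grid_index:
  assumes "\<bar>a\<bar> \<le> real n"
  shows "a < pt n (grid_index n a)" "pt n (grid_index n a) \<le> a + 1 / 2 ^ n"
proof -
  have *: "real (grid_index n a) = real_of_int \<lfloor>(a + real n) * 2 ^ n\<rfloor> + 1"
    using assms by (simp add: grid_index_def)
  have "(a + real n) * 2 ^ n < real (grid_index n a)" "real (grid_index n a) \<le> (a + real n) * 2 ^ n + 1"
    unfolding * by linarith+
  then have "a + real n < real (grid_index n a) / 2 ^ n"
    "real (grid_index n a) / 2 ^ n \<le> (a + real n) + 1 / 2 ^ n"
    by (simp_all add: field_simps del: of_nat_add)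
  then show "a < pt n (grid_index n a)" "pt n (grid_index n a) \<le> a + 1 / 2 ^ n"
    by (simp_all add: pt_def)
qed

lemma grid_index_mono: "a \<le> b \<Longrightarrow> grid_index n a \<le> grid_index n b"
  unfolding grid_index_def by (intro nat_mono add_right_mono floor_mono mult_right_mono) auto

lemma grid_index_le: 
  assumes "a < real n"
  shows "grid_index n a \<le> ncells n"
proof -
  have "(a + real n) * 2 ^ n < 2 * real n * 2 ^ n"
    using assms by simp
  then have "\<lfloor>(a + real n) * 2 ^ n\<rfloor> < int (ncells n)"
    unfolding ncells_def by (simp add: floor_less_iff)
  then show ?thesis
    by (simp add: grid_index_def)
qed

lemma eventually_pt_grid_index:
  assumes "locally_finite x"
  shows "\<forall>\<^sub>F n in sequentially. num_points x {a<..pt n (grid_index n a)} = 0"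
proof -
  obtain r where r: "a < r" "\<And>t. a < t \<Longrightarrow> t \<le> r \<Longrightarrow> x t = 0"
    using gap_right[OF assms, of a "a + 1"] by auto
  have "(\<lambda>n. 1 / 2 ^ n :: real) \<longlonglongrightarrow> 0"
    by real_asymp
  then have "\<forall>\<^sub>F n in sequentially. 1 / 2 ^ n < r - a"
    using r(1) by (intro order_tendstoD) auto
  moreover have "\<forall>\<^sub>F n in sequentially. \<bar>a\<bar> \<le> real n"
    by real_asymp
  ultimately show ?thesis
  proof eventually_elim
    case (elim n)
    then have "pt n (grid_index n a) \<le> r"
      using grid_index(2)[of a n] by linarith
    then show ?case
      using r(2) by (intro num_points_eq_0) auto
  qed
qed

text \<open>Cells suffice: the count of \<open>{a<..b}\<close> is eventually a sum of cell counts,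
  and half-open intervals form an intersection-stable generator of the Borel sets, from which a
  Dynkin argument reaches every bounded Borel set.\<close>

lemma measurable_config_spaceI:
  assumes lf: "\<And>\<omega>. \<omega> \<in> space M \<Longrightarrow> locally_finite (X \<omega>)"
    and cells: "\<And>n j. j < ncells n \<Longrightarrow> (\<lambda>\<omega>. num_points (X \<omega>) (cell n j)) \<in> M \<rightarrow>\<^sub>M count_space UNIV"
  shows "X \<in> M \<rightarrow>\<^sub>M config_space"
proof -
  have Ioc: "(\<lambda>\<omega>. num_points (X \<omega>) {a<..b}) \<in> M \<rightarrow>\<^sub>M count_space UNIV" if "a < b" for a b
  proof (rule measurable_eventually_eq)
    let ?f = "\<lambda>n \<omega>. if \<bar>a\<bar> < real n \<and> \<bar>b\<bar> < real n
      then \<Sum>k\<in>{grid_index n a..<grid_index n b}. num_points (X \<omega>) (cell n k) else 0"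
    show "?f n \<in> M \<rightarrow>\<^sub>M count_space UNIV" for n
    proof (cases "\<bar>a\<bar> < real n \<and> \<bar>b\<bar> < real n")
      case True
      then have "grid_index n b \<le> ncells n"
        by (intro grid_index_le) auto
      then have "(\<lambda>\<omega>. num_points (X \<omega>) (cell n k)) \<in> M \<rightarrow>\<^sub>M count_space UNIV"
        if "k \<in> {grid_index n a..<grid_index n b}" for k
        using that by (intro cells) auto
      then have "(\<lambda>\<omega>. \<Sum>k\<in>{grid_index n a..<grid_index n b}. num_points (X \<omega>) (cell n k))
          \<in> M \<rightarrow>\<^sub>M count_space UNIV"
        by (intro measurable_sum_nat) auto
      then show ?thesis
        using True by simp
    next
      case False
      then have "?f n = (\<lambda>\<omega>. 0)"
        by auto
      then show ?thesis
        by simp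
    qed
    fix \<omega> assume \<omega>: "\<omega> \<in> space M"
    have "\<forall>\<^sub>F n in sequentially. \<bar>a\<bar> < real n \<and> \<bar>b\<bar> < real n"
      by (intro eventually_conj; real_asymp)
    moreover have "(\<lambda>n. 1 / 2 ^ n :: real) \<longlonglongrightarrow> 0"
      by real_asymp
    then have "\<forall>\<^sub>F n in sequentially. 1 / 2 ^ n < b - a"
      using \<open>a < b\<close> by (intro order_tendstoD) auto
    ultimately show "\<forall>\<^sub>F n in sequentially. ?f n \<omega> = num_points (X \<omega>) {a<..b}"
      using eventually_pt_grid_index[OF lf[OF \<omega>], of a] eventually_pt_grid_index[OF lf[OF \<omega>], of b]
    proof eventually_elim
      case (elim n)
      define u v where "u = pt n (grid_index n a)" and "v = pt n (grid_index n b)"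
      have uv: "a < u" "u < b" "b < v"
        using grid_index[of a n] grid_index[of b n] elim unfolding u_def v_def by auto
      have "?f n \<omega> = num_points (X \<omega>) {u<..v}"
        using elim num_points_grid[OF lf[OF \<omega>] grid_index_mono[of a b n]] \<open>a < b\<close>
        by (simp add: u_def v_def)
      also have "\<dots> = num_points (X \<omega>) {a<..b}"
        using elim uv num_points_Ioc[OF lf[OF \<omega>], of a u v] num_points_Ioc[OF lf[OF \<omega>], of a b v]
        by (simp add: u_def[symmetric] v_def[symmetric])
      finally show ?case .
    qed
  qed
  \<comment> \<open>Complements and countable unions leave the bounded sets, where counts lose their
    meaning. Cutting with a fixed window keeps all counts finite, and complements become
    differences.\<close>
  have window: "(\<lambda>\<omega>. num_points (X \<omega>) (B \<inter> {-K<..K})) \<in> M \<rightarrow>\<^sub>M count_space UNIV"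
    if "B \<in> sets borel" for B and K :: real
  proof -
    let ?G = "range (\<lambda>(a, b). {a<..b}) :: real set set"
    have "Int_stable ?G"
      by (auto simp: Int_stable_def)
    moreover have "?G \<subseteq> Pow UNIV"
      by simp
    moreover have "B \<in> sigma_sets UNIV ?G"
      using that unfolding borel_sigma_sets_Ioc by (simp add: sets_measure_of)
    ultimately show ?thesis
    proof (induction B rule: sigma_sets_induct_disjoint)
      case (basic B)
      then obtain a b where "B = {a<..b}"
        by auto
      then have "B \<inter> {-K<..K} = {max a (-K)<..min b K}"
        by auto
      then show ?case
        using Ioc by (cases "max a (-K) < min b K") (auto simp: not_less)
    next
      case (compl B)
      have "(\<lambda>\<omega>. num_points (X \<omega>) {-K<..K}) \<in> M \<rightarrow>\<^sub>M count_space UNIV"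
        using Ioc by (cases "-K < K") auto
      with compl.IH have "(\<lambda>\<omega>. num_points (X \<omega>) {-K<..K} - num_points (X \<omega>) (B \<inter> {-K<..K}))
          \<in> M \<rightarrow>\<^sub>M count_space UNIV"
        by measurable
      moreover have "num_points (X \<omega>) {-K<..K} - num_points (X \<omega>) (B \<inter> {-K<..K}) =
          num_points (X \<omega>) ((UNIV - B) \<inter> {-K<..K})" if "\<omega> \<in> space M" for \<omega>
      proof -
        have "(B \<inter> {-K<..K}) \<union> ((UNIV - B) \<inter> {-K<..K}) = {-K<..K}"
          by auto
        moreover have "num_points (X \<omega>) ((B \<inter> {-K<..K}) \<union> ((UNIV - B) \<inter> {-K<..K})) =
           num_points (X \<omega>) (B \<inter> {-K<..K}) + num_points (X \<omega>) ((UNIV - B) \<inter> {-K<..K})"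
          by (intro num_points_Un lf[OF that] bounded_Int) auto
        ultimately have "num_points (X \<omega>) {-K<..K} = 
           num_points (X \<omega>) (B \<inter> {-K<..K}) + num_points (X \<omega>) ((UNIV - B) \<inter> {-K<..K})"
          by (simp only:)
        then show ?thesis
          by simp
      qed
      ultimately show ?case
        by (simp cong: measurable_cong)
    next
      case (union B)
      show ?case
      proof (rule measurable_eventually_eq)
        show "(\<lambda>\<omega>. \<Sum>i<n. num_points (X \<omega>) (B i \<inter> {-K<..K})) \<in> M \<rightarrow>\<^sub>M count_space UNIV" for n
          using union.IH by (intro measurable_sum_nat) auto
        fix \<omega> assume \<omega>: "\<omega> \<in> space M"
        let ?P = "{t \<in> (\<Union>i. B i) \<inter> {-K<..K}. X \<omega> t \<noteq> 0}"
        have "finite ?P"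
          using lf[OF \<omega>] by (intro finite_points) (auto intro: bounded_subset)
        moreover have "\<forall>t\<in>?P. \<exists>i. t \<in> B i"
          by auto
        \<comment> \<open>The window holds finitely many points, so finitely many of the disjoint
          sets catch them all and the partial sums become constant.\<close>
        ultimately obtain N where N: "\<And>t. t \<in> ?P \<Longrightarrow> \<exists>i<N. t \<in> B i"
        proof -
          obtain f where f: "\<And>t. t \<in> ?P \<Longrightarrow> t \<in> B (f t)"
            using \<open>\<forall>t\<in>?P. \<exists>i. t \<in> B i\<close> by metis
          show ?thesis
          proof (rule that)
            fix t assume "t \<in> ?P"
            then show "\<exists>i<Suc (Max (f ` ?P)). t \<in> B i"
              using f[of t] Max_ge[OF finite_imageI[OF \<open>finite ?P\<close>], of "f t" f]
              by (intro exI[of _ "f t"] conjI) (simp_all only: less_Suc_eq_le imageI)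
          qed
        qed
        have sum: "(\<Sum>i<n. num_points (X \<omega>) (B i \<inter> {-K<..K})) =
            num_points (X \<omega>) ((\<Union>i<n. B i) \<inter> {-K<..K})" for n
        proof (induction n)
          case (Suc n)
          have "(\<Union>i<Suc n. B i) \<inter> {-K<..K} = ((\<Union>i<n. B i) \<inter> {-K<..K}) \<union> (B n \<inter> {-K<..K})"
            by (auto simp: less_Suc_eq)
          moreover have "((\<Union>i<n. B i) \<inter> {-K<..K}) \<inter> (B n \<inter> {-K<..K}) = {}"
          proof -
            have "B i \<inter> B n = {}" if "i < n" for i
              using union.hyps(1) that by (intro disjoint_family_onD[of B UNIV]) auto
            then show ?thesis
              by blast
          qed
          moreover have "num_points (X \<omega>) (((\<Union>i<n. B i) \<inter> {-K<..K}) \<union> (B n \<inter> {-K<..K})) =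
              num_points (X \<omega>) ((\<Union>i<n. B i) \<inter> {-K<..K}) + num_points (X \<omega>) (B n \<inter> {-K<..K})"
            using calculation(2) by (intro num_points_Un lf[OF \<omega>] bounded_Int) auto
          ultimately show ?case
            using Suc by (simp only: sum.lessThan_Suc)
        qed simp
        show "\<forall>\<^sub>F n in sequentially. (\<Sum>i<n. num_points (X \<omega>) (B i \<inter> {-K<..K})) =
            num_points (X \<omega>) ((\<Union>i. B i) \<inter> {-K<..K})"
        proof (rule eventually_sequentiallyI)
          fix n assume "N \<le> n"
          then show "(\<Sum>i<n. num_points (X \<omega>) (B i \<inter> {-K<..K})) =
              num_points (X \<omega>) ((\<Union>i. B i) \<inter> {-K<..K})"
            unfolding sum
          proof (intro num_points_cong)
            fix t assume "X \<omega> t \<noteq> 0"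
            then show "t \<in> (\<Union>i<n. B i) \<inter> {-K<..K} \<longleftrightarrow> t \<in> (\<Union>i. B i) \<inter> {-K<..K}"
              using N[of t] \<open>N \<le> n\<close> by (blast intro: less_le_trans)
          qed
        qed
      qed
    qed simp
  qed
  show ?thesis
    unfolding config_space_def
  proof (rule measurable_measure_of)
    fix y assume "y \<in> {{n. locally_finite n \<and> num_points n B = k} |B k. B \<in> sets borel \<and> bounded B}"
    then obtain B k where y: "y = {n. locally_finite n \<and> num_points n B = k}"
      and B: "B \<in> sets borel" "bounded B"
      by auto
    obtain K where K: "B \<subseteq> {-K<..K}"
    proof -
      obtain a where "\<And>x. x \<in> B \<Longrightarrow> \<bar>x\<bar> \<le> a"
        using B(2) unfolding bounded_iff by auto
      then have "B \<subseteq> {-(a + 1)<..a + 1}"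
        by (force simp: abs_le_iff)
      then show ?thesis
        by (rule that)
    qed
    have "(\<lambda>\<omega>. num_points (X \<omega>) B) \<in> M \<rightarrow>\<^sub>M count_space UNIV"
      using window[OF B(1), of K] K by (simp add: Int_absorb2)
    then have "(\<lambda>\<omega>. num_points (X \<omega>) B) -` {k} \<inter> space M \<in> sets M"
      by (rule measurable_sets) simp
    moreover have "X -` y \<inter> space M = (\<lambda>\<omega>. num_points (X \<omega>) B) -` {k} \<inter> space M"
      unfolding y using lf by auto
    ultimately show "X -` y \<inter> space M \<in> sets M"
      by simp
  qed (use lf in auto)
qed

section \<open>Departures\<close>

text \<open>The terms of the supremum are integers: if none reaches 1, all are at most 0, and so is
  the supremum. An infinite supremum is covered as well.\<close>

lemma departures_conv:
  "departures A S t = of_bool (S t \<noteq> 0 \<and> (\<exists>s\<le>t. num_points S {s..<t} < num_points A {s..t}))"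
proof -
  let ?f = "\<lambda>s. ereal (real (num_points A {s..t}) - real (num_points S {s..<t}))"
  have "(SUP s\<in>{..t}. ?f s) \<ge> 1 \<longleftrightarrow> (\<exists>s\<le>t. num_points S {s..<t} < num_points A {s..t})"
  proof
    assume *: "(SUP s\<in>{..t}. ?f s) \<ge> 1"
    show "\<exists>s\<le>t. num_points S {s..<t} < num_points A {s..t}"
    proof (rule ccontr)
      assume "\<not> ?thesis"
      then have "(SUP s\<in>{..t}. ?f s) \<le> 0"
        by (intro SUP_least) (auto simp: not_less)
      with * have "(1 :: ereal) \<le> 0"
        by (rule order_trans)
      then show False
        by simp
    qed
  next
    assume "\<exists>s\<le>t. num_points S {s..<t} < num_points A {s..t}"
    then obtain s where "s \<le> t" "num_points S {s..<t} < num_points A {s..t}"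
      by auto
    then have "1 \<le> ?f s"
      by (simp add: one_ereal_def)
    then show "(SUP s\<in>{..t}. ?f s) \<ge> 1"
      using \<open>s \<le> t\<close> by (intro SUP_upper2[of s]) auto
  qed
  then show ?thesis
    unfolding departures_def by (simp add: of_bool_def)
qed

text \<open>Closed starting times \<open>s\<close> are traded for half-open intervals, the ones that
  cumulative counts measure. A start after \<open>u\<close> moves back to \<open>u\<close>, since
  nothing happens strictly between \<open>u\<close> and \<open>x\<close>; a start up to
  \<open>u\<close> moves into the gap on its left. Conversely, \<open>r\<close> moves into the gap
  on its right.\<close>

lemma departures_iff:
  assumes lf: "locally_finite A" "locally_finite S"
    and "u < x" and gap: "\<And>t. u < t \<Longrightarrow> t < x \<Longrightarrow> A t = 0 \<and> S t = 0"
  shows "departures A S x =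
    of_bool (S x \<noteq> 0 \<and> (\<exists>r\<le>u. num_points S {r<..u} < num_points A {r<..x}))"
proof -
  have AS: "locally_finite (\<lambda>t. A t + S t)"
    by (rule locally_finite_add[OF lf])
  have "(\<exists>s\<le>x. num_points S {s..<x} < num_points A {s..x}) \<longleftrightarrow>
    (\<exists>r\<le>u. num_points S {r<..u} < num_points A {r<..x})"
  proof
    assume "\<exists>s\<le>x. num_points S {s..<x} < num_points A {s..x}"
    then obtain s where s: "s \<le> x" "num_points S {s..<x} < num_points A {s..x}"
      by auto
    show "\<exists>r\<le>u. num_points S {r<..u} < num_points A {r<..x}"
    proof (cases "u < s")
      case True
      have "num_points A {s..x} = num_points A {u<..x}"
      proof (rule num_points_cong)
        fix t assume "A t \<noteq> 0"
        then show "t \<in> {s..x} \<longleftrightarrow> t \<in> {u<..x}"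
          using gap[of t] True s(1) by (cases t x rule: linorder_cases) auto
      qed
      then show ?thesis
        using s(2) by (intro exI[of _ u]) auto
    next
      case False
      obtain r where r: "r < s" "\<And>t. r < t \<Longrightarrow> t < s \<Longrightarrow> A t + S t = 0"
        using gap_left[OF AS] by blast
      have "num_points A {s..x} = num_points A {r<..x}"
      proof (rule num_points_cong)
        fix t assume "A t \<noteq> 0"
        then show "t \<in> {s..x} \<longleftrightarrow> t \<in> {r<..x}"
          using r(1) r(2)[of t] by (cases t s rule: linorder_cases) auto
      qed
      moreover have "num_points S {s..<x} = num_points S {r<..u}"
      proof (rule num_points_cong)
        fix t assume "S t \<noteq> 0"
        then show "t \<in> {s..<x} \<longleftrightarrow> t \<in> {r<..u}"
          using r(1) r(2)[of t] gap[of t] \<open>u < x\<close> False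
          by (cases "t < s"; cases "t < x"; cases "t \<le> u") auto
      qed
      ultimately show ?thesis
        using s r(1) False by (intro exI[of _ r]) auto
    qed
  next
    assume "\<exists>r\<le>u. num_points S {r<..u} < num_points A {r<..x}"
    then obtain r where r: "r \<le> u" "num_points S {r<..u} < num_points A {r<..x}"
      by auto
    then have "r < x"
      using \<open>u < x\<close> by simp
    then obtain s where s: "r < s" "s < x" "\<And>t. r < t \<Longrightarrow> t \<le> s \<Longrightarrow> A t + S t = 0"
      using gap_right[OF AS] by blast
    have "num_points A {s..x} = num_points A {r<..x}"
    proof (rule num_points_cong)
      fix t assume "A t \<noteq> 0"
      then show "t \<in> {s..x} \<longleftrightarrow> t \<in> {r<..x}"
        using s(1) s(3)[of t] by (cases t s rule: linorder_cases) auto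
    qed
    moreover have "num_points S {s..<x} = num_points S {r<..u}"
    proof (rule num_points_cong)
      fix t assume "S t \<noteq> 0"
      then show "t \<in> {s..<x} \<longleftrightarrow> t \<in> {r<..u}"
        using s(1) s(3)[of t] gap[of t] \<open>u < x\<close>
        by (cases "t < s"; cases "t < x"; cases "t \<le> u") auto
    qed
    ultimately show "\<exists>s\<le>x. num_points S {s..<x} < num_points A {s..x}"
      using r(2) s(2) by (intro exI[of _ s]) auto
  qed
  then show ?thesis
    unfolding departures_conv by simp
qed

text \<open>All arrivals and services of the cell sit at one time, where arrivals come first: hence
  arrivals count up to \<open>v\<close> but services only up to \<open>u\<close>. The result is the
  discrete-time rule for one slot and involves nothing but interval counts.\<close>

lemma departures_cell:
  assumes lf: "locally_finite A" "locally_finite S"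
    and single: "\<And>t t'. t \<in> {u<..v} \<Longrightarrow> t' \<in> {u<..v} \<Longrightarrow>
      A t + S t \<noteq> 0 \<Longrightarrow> A t' + S t' \<noteq> 0 \<Longrightarrow> t = t'"
  shows "num_points (departures A S) {u<..v} = of_bool (num_points S {u<..v} \<noteq> 0 \<and>
    (\<exists>r\<le>u. num_points S {r<..u} < num_points A {r<..v}))"
proof (cases "\<exists>x\<in>{u<..v}. S x \<noteq> 0")
  case False
  then have "num_points S {u<..v} = 0"
    by (intro num_points_eq_0) auto
  moreover have "num_points (departures A S) {u<..v} = 0"
    using False by (intro num_points_eq_0) (auto simp: departures_conv)
  ultimately show ?thesis
    by simp
next
  case True
  then obtain x where x: "x \<in> {u<..v}" "S x \<noteq> 0"
    by auto
  have eq: "t = x" if "t \<in> {u<..v}" "A t + S t \<noteq> 0" for t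
    using single[OF that(1) x(1) that(2)] x(2) by simp
  have 0: "A t = 0 \<and> S t = 0" if "u < t" "t \<le> v" "t \<noteq> x" for t
    using eq[of t] that by (cases "A t + S t = 0") auto
  have "num_points (departures A S) {u<..v} = num_points (departures A S) {x}"
  proof (rule num_points_cong)
    fix t assume "departures A S t \<noteq> 0"
    then have "S t \<noteq> 0"
      by (simp add: departures_conv)
    then show "t \<in> {u<..v} \<longleftrightarrow> t \<in> {x}"
      using 0[of t] x(1) by (cases "t = x") auto
  qed
  moreover have "num_points S {u<..v} = num_points S {x}"
  proof (rule num_points_cong)
    fix t assume "S t \<noteq> 0"
    then show "t \<in> {u<..v} \<longleftrightarrow> t \<in> {x}"
      using 0[of t] x(1) by (cases "t = x") auto
  qed
  moreover have "num_points A {r<..v} = num_points A {r<..x}" if "r \<le> u" for r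
  proof (rule num_points_cong)
    fix t assume "A t \<noteq> 0"
    then show "t \<in> {r<..v} \<longleftrightarrow> t \<in> {r<..x}"
      using 0[of t] x(1) that by (cases t x rule: linorder_cases) auto
  qed
  moreover have "departures A S x =
      of_bool (S x \<noteq> 0 \<and> (\<exists>r\<le>u. num_points S {r<..u} < num_points A {r<..x}))"
    using 0 x(1) by (intro departures_iff lf) auto
  ultimately show ?thesis
    using x(2) by (auto simp: of_bool_def)
qed

section \<open>Refinement of grids and measurability of the departure map\<close>

lemma separated_points:
  assumes "locally_finite x"
  obtains d where "d > 0"
    "\<And>t t'. t \<in> {a..b} \<Longrightarrow> t' \<in> {a..b} \<Longrightarrow> x t \<noteq> 0 \<Longrightarrow> x t' \<noteq> 0 \<Longrightarrow> \<bar>t - t'\<bar> < d \<Longrightarrow> t = t'"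
proof -
  let ?F = "{t \<in> {a..b}. x t \<noteq> 0}"
  \<comment> \<open>The element 1 keeps the set nonempty when there are fewer than two points;
    removing 0 discards the pairs of equal points.\<close>
  define D where "D = insert 1 ((\<lambda>(t, t'). \<bar>t - t'\<bar>) ` (?F \<times> ?F) - {0})"
  have "finite ?F"
    using assms by (intro finite_points) auto
  then have D: "finite D"
    unfolding D_def by blast
  show ?thesis
  proof (rule that[of "Min D"])
    have "\<And>d. d \<in> D \<Longrightarrow> d > 0"
      unfolding D_def by auto
    moreover have "Min D \<in> D"
      by (rule Min_in[OF D]) (simp add: D_def)
    ultimately show "Min D > 0"
      by blast
  next
    fix t t' assume *: "t \<in> {a..b}" "t' \<in> {a..b}" "x t \<noteq> 0" "x t' \<noteq> 0" "\<bar>t - t'\<bar> < Min D"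
    show "t = t'"
    proof (rule ccontr)
      assume "t \<noteq> t'"
      with * have "\<bar>t - t'\<bar> \<in> D"
        unfolding D_def by (intro insertI2 DiffI image_eqI[of _ _ "(t, t')"]) auto
      then have "Min D \<le> \<bar>t - t'\<bar>"
        by (rule Min_le[OF D])
      with *(5) show False
        by simp
    qed
  qed
qed

text \<open>The grid of level \<open>m\<close> begins at \<open>-m\<close>, that is
  \<open>m - n\<close> time units before that of level \<open>n\<close>; these units take up the
  \<open>(m - n) * 2 ^ m\<close> cells of the second summand.\<close>

definition refine :: "nat \<Rightarrow> nat \<Rightarrow> nat \<Rightarrow> nat" where
  "refine n m j = j * 2 ^ (m - n) + (m - n) * 2 ^ m"

lemma pt_refine: "n \<le> m \<Longrightarrow> pt m (refine n m j) = pt n j"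
proof -
  assume "n \<le> m"
  then obtain k where "m = n + k"
    by (auto simp: le_iff_add)
  then show ?thesis
    by (simp add: pt_def refine_def field_simps power_add)
qed

lemma refine_mono: "i \<le> j \<Longrightarrow> refine n m i \<le> refine n m j"
  by (simp add: refine_def)

lemma num_points_refine:
  assumes "locally_finite x" and "n \<le> m"
  shows "num_points x (cell n j) = (\<Sum>i\<in>{refine n m j..<refine n m (Suc j)}. num_points x (cell m i))"
  using num_points_grid[OF assms(1) refine_mono[of j "Suc j" n m], of m] assms(2)
  by (simp add: pt_refine cell_def)

lemma refine_ncells_le:
  assumes "n \<le> m" and "j \<le> ncells n"
  shows "refine n m j \<le> ncells m"
proof -
  obtain k where k: "m = n + k"
    using assms(1) by (auto simp: le_iff_add)
  have "refine n m j \<le> ncells n * 2 ^ k + k * 2 ^ m"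
    using assms(2) by (simp add: refine_def k)
  also have "\<dots> \<le> ncells m"
    by (simp add: ncells_def k power_add algebra_simps)
  finally show ?thesis .
qed

text \<open>Makes the existential countable, so that the event is measurable. A start
  \<open>r < u\<close> moves to a rational in the gap on its right; the start \<open>u\<close>
  itself will be a grid point, hence rational.\<close>

lemma exists_rat_start:
  assumes "locally_finite A" "locally_finite S" "u \<in> \<rat>" "u < v"
  shows "(\<exists>r\<le>u. num_points S {r<..u} < num_points A {r<..v}) \<longleftrightarrow>
    (\<exists>r\<in>\<rat>. r \<le> u \<and> num_points S {r<..u} < num_points A {r<..v})"
proof
  assume "\<exists>r\<le>u. num_points S {r<..u} < num_points A {r<..v}"
  then obtain r where r: "r \<le> u" "num_points S {r<..u} < num_points A {r<..v}"
    by auto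
  show "\<exists>r\<in>\<rat>. r \<le> u \<and> num_points S {r<..u} < num_points A {r<..v}"
  proof (cases "r = u")
    case True
    then show ?thesis
      using r assms(3) by blast
  next
    case False
    with r(1) have "r < u"
      by simp
    then obtain s where s: "r < s" "s < u" "\<And>t. r < t \<Longrightarrow> t \<le> s \<Longrightarrow> A t + S t = 0"
      using gap_right[OF locally_finite_add[OF assms(1,2)]] by blast
    obtain q where q: "q \<in> \<rat>" "r < q" "q < s"
      using Rats_dense_in_real[OF s(1)] by auto
    have 0: "A t = 0 \<and> S t = 0" if "r < t" "t \<le> q" for t
      using s(3)[of t] that q by auto
    have "num_points A {r<..v} = num_points A {q<..v}"
    proof (rule num_points_cong)
      fix t assume "A t \<noteq> 0"
      then show "t \<in> {r<..v} \<longleftrightarrow> t \<in> {q<..v}"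
        using 0[of t] q(2) by (cases t q rule: linorder_cases) auto
    qed
    moreover have "num_points S {r<..u} = num_points S {q<..u}"
    proof (rule num_points_cong)
      fix t assume "S t \<noteq> 0"
      then show "t \<in> {r<..u} \<longleftrightarrow> t \<in> {q<..u}"
        using 0[of t] q(2) by (cases t q rule: linorder_cases) auto
    qed
    ultimately show ?thesis
      using r(2) q s(2) by (intro bexI[of _ q]) auto
  qed
qed auto

lemma locally_finite_departures: "locally_finite S \<Longrightarrow> locally_finite (departures A S)"
  by (rule locally_finite_le[OF _ departures_le])

lemma pt_Rats: "pt n j \<in> \<rat>"
  by (simp add: pt_def)

lemma pred_less_nat:
  fixes f g :: "'a \<Rightarrow> nat"
  assumes "f \<in> M \<rightarrow>\<^sub>M count_space UNIV" "g \<in> M \<rightarrow>\<^sub>M count_space UNIV"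
  shows "Measurable.pred M (\<lambda>x. f x < g x)"
proof -
  have "Measurable.pred M (\<lambda>x. \<exists>k. f x = k \<and> (\<exists>l. g x = l \<and> k < l))"
    by (intro pred_intros_countable pred_intros_logic pred_count_space_const1 assms) auto
  then show ?thesis
    by simp
qed

text \<open>Once the mesh is below the spacing of the points in the given cell,
  \<open>departures_cell\<close> applies to every finer cell inside it. The count is thus the
  eventual value of sums of measurable terms.\<close>

lemma measurable_departures [measurable]:
  assumes A: "A \<in> M \<rightarrow>\<^sub>M config_space" and S: "S \<in> M \<rightarrow>\<^sub>M config_space"
  shows "(\<lambda>\<omega>. departures (A \<omega>) (S \<omega>)) \<in> M \<rightarrow>\<^sub>M config_space"
proof (rule measurable_config_spaceI)
  have lf: "locally_finite (A \<omega>)" "locally_finite (S \<omega>)" if "\<omega> \<in> space M" for \<omega>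
    using measurable_space[OF A that] measurable_space[OF S that] by auto
  show "locally_finite (departures (A \<omega>) (S \<omega>))" if "\<omega> \<in> space M" for \<omega>
    by (rule locally_finite_departures[OF lf(2)[OF that]])
  fix n j
  define g :: "nat \<Rightarrow> nat \<Rightarrow> 'a \<Rightarrow> nat" where
    "g = (\<lambda>m i \<omega>. of_bool (num_points (S \<omega>) (cell m i) \<noteq> 0 \<and> (\<exists>q. real_of_rat q \<le> pt m i \<and>
    num_points (S \<omega>) {of_rat q<..pt m i} < num_points (A \<omega>) {of_rat q<..pt m (Suc i)})))"
  show "(\<lambda>\<omega>. num_points (departures (A \<omega>) (S \<omega>)) (cell n j)) \<in> M \<rightarrow>\<^sub>M count_space UNIV"
  proof (rule measurable_eventually_eq)
    have count: "(\<lambda>\<omega>. num_points (A \<omega>) {a<..b}) \<in> M \<rightarrow>\<^sub>M count_space UNIV"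
      "(\<lambda>\<omega>. num_points (S \<omega>) {a<..b}) \<in> M \<rightarrow>\<^sub>M count_space UNIV" for a b
      using A S by (auto intro!: measurable_compose[OF _ measurable_num_points])
    have [measurable]: "g m i \<in> M \<rightarrow>\<^sub>M count_space UNIV" for m i
    proof -
      have "Measurable.pred M (\<lambda>\<omega>. num_points (S \<omega>) (cell m i) \<noteq> 0 \<and> (\<exists>q. real_of_rat q \<le> pt m i \<and>
          num_points (S \<omega>) {of_rat q<..pt m i} < num_points (A \<omega>) {of_rat q<..pt m (Suc i)}))"
        unfolding cell_def
        by (intro pred_intros_logic pred_intros_countable pred_less_nat count
            pred_count_space_const1 measurable_const) auto
      then show ?thesis
        unfolding g_def of_bool_def by (intro measurable_If) (auto simp: pred_def)
    qed
    show "(\<lambda>\<omega>. \<Sum>i\<in>{refine n (n + k) j..<refine n (n + k) (Suc j)}. g (n + k) i \<omega>) \<in> M \<rightarrow>\<^sub>M count_space UNIV" for k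
      by (intro measurable_sum_nat) auto
    fix \<omega> assume \<omega>: "\<omega> \<in> space M"
    obtain d where d: "d > 0" "\<And>t t'. t \<in> {pt n j..pt n (Suc j)} \<Longrightarrow> t' \<in> {pt n j..pt n (Suc j)} \<Longrightarrow>
        A \<omega> t + S \<omega> t \<noteq> 0 \<Longrightarrow> A \<omega> t' + S \<omega> t' \<noteq> 0 \<Longrightarrow> \<bar>t - t'\<bar> < d \<Longrightarrow> t = t'"
      using separated_points[OF locally_finite_add[OF lf[OF \<omega>]]] by metis
    have "(\<lambda>k. 1 / 2 ^ (n + k) :: real) \<longlonglongrightarrow> 0"
      by real_asymp
    then have "\<forall>\<^sub>F k in sequentially. 1 / 2 ^ (n + k) < d"
      using d(1) by (intro order_tendstoD) auto
    then show "\<forall>\<^sub>F k in sequentially. (\<Sum>i\<in>{refine n (n + k) j..<refine n (n + k) (Suc j)}. g (n + k) i \<omega>) =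
        num_points (departures (A \<omega>) (S \<omega>)) (cell n j)"
    proof eventually_elim
      case (elim k)
      let ?m = "n + k"
      have "num_points (departures (A \<omega>) (S \<omega>)) (cell n j) =
          (\<Sum>i\<in>{refine n ?m j..<refine n ?m (Suc j)}. num_points (departures (A \<omega>) (S \<omega>)) (cell ?m i))"
        by (intro num_points_refine locally_finite_departures lf \<omega>) auto
      also have "\<dots> = (\<Sum>i\<in>{refine n ?m j..<refine n ?m (Suc j)}. g ?m i \<omega>)"
      proof (rule sum.cong[OF refl])
        fix i assume i: "i \<in> {refine n ?m j..<refine n ?m (Suc j)}"
        have ends: "pt n j \<le> pt ?m i" "pt ?m (Suc i) \<le> pt n (Suc j)"
          using i pt_mono[of "refine n ?m j" i ?m] pt_mono[of "Suc i" "refine n ?m (Suc j)" ?m]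
          by (auto simp: pt_refine)
        have "num_points (departures (A \<omega>) (S \<omega>)) (cell ?m i) =
            of_bool (num_points (S \<omega>) (cell ?m i) \<noteq> 0 \<and> (\<exists>r\<le>pt ?m i.
              num_points (S \<omega>) {r<..pt ?m i} < num_points (A \<omega>) {r<..pt ?m (Suc i)}))"
          unfolding cell_def
        proof (rule departures_cell[OF lf[OF \<omega>]])
          fix t t' assume *: "t \<in> {pt ?m i<..pt ?m (Suc i)}" "t' \<in> {pt ?m i<..pt ?m (Suc i)}"
            "A \<omega> t + S \<omega> t \<noteq> 0" "A \<omega> t' + S \<omega> t' \<noteq> 0"
          then have "\<bar>t - t'\<bar> < d"
            using elim by (auto simp: pt_Suc)
          then show "t = t'"
            using * ends by (intro d(2)) auto
        qed
        then show "num_points (departures (A \<omega>) (S \<omega>)) (cell ?m i) = g ?m i \<omega>"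
          unfolding g_def using exists_rat_start[OF lf[OF \<omega>] pt_Rats pt_less[of i "Suc i" ?m]]
            by (simp add: Rats_def)
      qed
      finally show ?case ..
    qed
  qed
qed

section \<open>Measurability of sums and differences of configurations\<close>

lemma measurable_config_add [measurable]:
  assumes X: "X \<in> M \<rightarrow>\<^sub>M config_space" and Y: "Y \<in> M \<rightarrow>\<^sub>M config_space"
  shows "(\<lambda>\<omega> t. X \<omega> t + Y \<omega> t) \<in> M \<rightarrow>\<^sub>M config_space"
proof (rule measurable_config_spaceI)
  have lf: "locally_finite (X \<omega>)" "locally_finite (Y \<omega>)" if "\<omega> \<in> space M" for \<omega>
    using measurable_space[OF X that] measurable_space[OF Y that] by auto
  then show "locally_finite (\<lambda>t. X \<omega> t + Y \<omega> t)" if "\<omega> \<in> space M" for \<omega>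
    using that by (intro locally_finite_add)
  fix n j
  have [measurable]: "(\<lambda>\<omega>. num_points (X \<omega>) (cell n j)) \<in> M \<rightarrow>\<^sub>M count_space UNIV"
    "(\<lambda>\<omega>. num_points (Y \<omega>) (cell n j)) \<in> M \<rightarrow>\<^sub>M count_space UNIV"
    using X Y by (auto intro!: measurable_compose[OF _ measurable_num_points])
  have "(\<lambda>\<omega>. num_points (X \<omega>) (cell n j) + num_points (Y \<omega>) (cell n j)) \<in> M \<rightarrow>\<^sub>M count_space UNIV"
    by measurable
  then show "(\<lambda>\<omega>. num_points (\<lambda>t. X \<omega> t + Y \<omega> t) (cell n j)) \<in> M \<rightarrow>\<^sub>M count_space UNIV"
    using lf by (simp add: num_points_add cong: measurable_cong)
qed

lemma measurable_config_diff:
  assumes X: "X \<in> M \<rightarrow>\<^sub>M config_space" and Y: "Y \<in> M \<rightarrow>\<^sub>M config_space"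
    and le: "\<And>\<omega> t. \<omega> \<in> space M \<Longrightarrow> Y \<omega> t \<le> X \<omega> t"
  shows "(\<lambda>\<omega> t. X \<omega> t - Y \<omega> t) \<in> M \<rightarrow>\<^sub>M config_space"
proof (rule measurable_config_spaceI)
  have lf: "locally_finite (X \<omega>)" "locally_finite (Y \<omega>)" if "\<omega> \<in> space M" for \<omega>
    using measurable_space[OF X that] measurable_space[OF Y that] by auto
  show lf': "locally_finite (\<lambda>t. X \<omega> t - Y \<omega> t)" if "\<omega> \<in> space M" for \<omega>
    by (rule locally_finite_le[OF lf(1)[OF that]]) simp
  fix n j
  have [measurable]: "(\<lambda>\<omega>. num_points (X \<omega>) (cell n j)) \<in> M \<rightarrow>\<^sub>M count_space UNIV"
    "(\<lambda>\<omega>. num_points (Y \<omega>) (cell n j)) \<in> M \<rightarrow>\<^sub>M count_space UNIV"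
    using X Y by (auto intro!: measurable_compose[OF _ measurable_num_points])
  have "(\<lambda>\<omega>. num_points (X \<omega>) (cell n j) - num_points (Y \<omega>) (cell n j)) \<in> M \<rightarrow>\<^sub>M count_space UNIV"
    by measurable
  moreover have "num_points (X \<omega>) (cell n j) - num_points (Y \<omega>) (cell n j) =
      num_points (\<lambda>t. X \<omega> t - Y \<omega> t) (cell n j)" if "\<omega> \<in> space M" for \<omega>
  proof -
    have "(\<lambda>t. (X \<omega> t - Y \<omega> t) + Y \<omega> t) = X \<omega>"
      using le[OF that] by (simp add: fun_eq_iff)
    then show ?thesis
      using num_points_add[OF lf'[OF that] lf(2)[OF that] cell_bounded[of n j]] by simp
  qed
  ultimately show "(\<lambda>\<omega>. num_points (\<lambda>t. X \<omega> t - Y \<omega> t) (cell n j)) \<in> M \<rightarrow>\<^sub>M count_space UNIV"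
    by (simp cong: measurable_cong)
qed

lemma measurable_unused_services [measurable]:
  assumes "A \<in> M \<rightarrow>\<^sub>M config_space" and "S \<in> M \<rightarrow>\<^sub>M config_space"
  shows "(\<lambda>\<omega>. unused_services (A \<omega>) (S \<omega>)) \<in> M \<rightarrow>\<^sub>M config_space"
  unfolding unused_services_def using assms
  by (intro measurable_config_diff) (auto simp: departures_le)

section \<open>Running minima and the departure operator\<close>

definition runmin :: "(real \<Rightarrow> int) \<Rightarrow> real \<Rightarrow> int" where
  "runmin z x = (INF r\<in>{..x}. z r)"

text \<open>For \<open>z = a - s\<close> this says that the queue is finite at every time; without
  it the integer infimum in \<open>runmin\<close> has no meaning.\<close>

definition minorized :: "(real \<Rightarrow> int) \<Rightarrow> bool" where
  "minorized z \<longleftrightarrow> (\<forall>x. bdd_below (z ` {..x}))"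

lemma minorizedI: "(\<And>x. \<exists>c. \<forall>r\<le>x. c \<le> z r) \<Longrightarrow> minorized z"
  unfolding minorized_def bdd_below_def by (force simp: Ball_def)

lemma minorizedD: "minorized z \<Longrightarrow> \<exists>c. \<forall>r\<le>x. c \<le> z r"
  unfolding minorized_def bdd_below_def by (force simp: Ball_def)

lemma le_runmin_iff: "minorized z \<Longrightarrow> v \<le> runmin z x \<longleftrightarrow> (\<forall>r\<le>x. v \<le> z r)"
  unfolding runmin_def minorized_def by (subst le_cINF_iff) auto

lemma runmin_le: "minorized z \<Longrightarrow> r \<le> x \<Longrightarrow> runmin z x \<le> z r"
  using le_runmin_iff[of z "runmin z x" x] by simp

lemma runmin_antimono: "minorized z \<Longrightarrow> x \<le> y \<Longrightarrow> runmin z y \<le> runmin z x"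
  by (simp add: le_runmin_iff runmin_le)

lemma runmin_attained:
  assumes "minorized z"
  shows "\<exists>r\<le>x. runmin z x = z r"
proof (rule ccontr)
  assume "\<not> ?thesis"
  then have "\<forall>r\<le>x. runmin z x + 1 \<le> z r"
    using runmin_le[OF assms, of _ x] by (metis zless_imp_add1_zle order_le_imp_less_or_eq)
  then have "runmin z x + 1 \<le> runmin z x"
    unfolding le_runmin_iff[OF assms] .
  then show False
    by simp
qed

lemma runmin_step:
  assumes "minorized z" "u < v" "\<And>y. u < y \<Longrightarrow> y < v \<Longrightarrow> z y = z u"
  shows "runmin z v = min (runmin z u) (z v)"
proof (rule antisym)
  show "runmin z v \<le> min (runmin z u) (z v)"
    using assms(1,2) by (simp add: runmin_antimono runmin_le)
  show "min (runmin z u) (z v) \<le> runmin z v"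
    unfolding le_runmin_iff[OF assms(1)]
  proof (intro allI impI)
    fix r assume "r \<le> v"
    then consider "r \<le> u" | "u < r" "r < v" | "r = v"
      by linarith
    then show "min (runmin z u) (z v) \<le> z r"
      using runmin_le[OF assms(1), of r u] runmin_le[OF assms(1), of u u] assms(3)[of r]
      by cases auto
  qed
qed

text \<open>If \<open>a\<close> and \<open>s\<close> are the cumulative counts of arrivals and services, then
  \<open>dep a s\<close> is the cumulative count of departures, and \<open>a x - dep a s x\<close> is the queue
  length at time \<open>x\<close>.\<close>

definition dep :: "(real \<Rightarrow> int) \<Rightarrow> (real \<Rightarrow> int) \<Rightarrow> real \<Rightarrow> int" where
  "dep a s x = runmin (\<lambda>r. a r - s r) x + s x"

text \<open>The two sides below are the infima of \<open>a r - s r + t x + F u\<close> over \<open>r \<le> u \<le> x\<close>, where \<open>F\<close> is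
  \<open>z = s - t\<close> on the left and \<open>z - 2 I\<close> plus \<open>I r + I x\<close> on the right, \<open>I\<close> being the running
  minimum of \<open>z\<close>. The two choices have the same infimum over \<open>u\<close>, as in Pitman's theorem.\<close>

lemma dep_interchange:
  fixes a s t :: "real \<Rightarrow> int"
  defines "z \<equiv> (\<lambda>r. s r - t r)" and "t' \<equiv> dep s t"
  defines "s' \<equiv> (\<lambda>r. s r + t r - t' r)"
  assumes as: "minorized (\<lambda>r. a r - s r)" and st: "minorized z"
    and dt: "minorized (\<lambda>r. dep a s r - t r)"
    and skip_free: "\<And>r x. r \<le> x \<Longrightarrow> runmin z x < runmin z r \<Longrightarrow>
      \<exists>u. r \<le> u \<and> u \<le> x \<and> z u = runmin z r \<and> runmin z u = runmin z r"
  shows "dep (dep a s) t = dep (dep a s') t'" and "minorized (\<lambda>r. dep a s' r - t' r)"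
proof -
  define I where "I = runmin z"
  have t': "t' r = I r + t r" and s': "s' r = s r - I r" for r
    by (simp_all add: t'_def s'_def dep_def I_def z_def)
  have I_le: "I x \<le> z r" "I x \<le> I r" if "r \<le> x" for r x
    using that st by (simp_all add: I_def runmin_le runmin_antimono)
  have as': "minorized (\<lambda>r. a r - s' r)"
  proof (rule minorizedI)
    fix x
    obtain c where "\<forall>r\<le>x. c \<le> a r - s r"
      using minorizedD[OF as] by blast
    then have "\<forall>r\<le>x. c + I x \<le> a r - s' r"
      using I_le(2)[of _ x] by (force simp: s')
    then show "\<exists>c. \<forall>r\<le>x. c \<le> a r - s' r" ..
  qed
  have le_left: "v \<le> dep (dep a s) t x \<longleftrightarrow> (\<forall>r u. r \<le> u \<longrightarrow> u \<le> x \<longrightarrow> v \<le> a r - s r + t x + z u)"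
    for v x
  proof -
    have "v \<le> dep (dep a s) t x \<longleftrightarrow> (\<forall>u\<le>x. v - t x - z u \<le> runmin (\<lambda>r. a r - s r) u)"
      unfolding dep_def[of "dep a s"] using le_runmin_iff[OF dt, of "v - t x" x]
      by (auto simp: dep_def z_def algebra_simps)
    also have "\<dots> \<longleftrightarrow> (\<forall>r u. r \<le> u \<longrightarrow> u \<le> x \<longrightarrow> v \<le> a r - s r + t x + z u)"
      unfolding le_runmin_iff[OF as] by (auto simp: algebra_simps)
    finally show ?thesis .
  qed
  \<comment> \<open>Every right-hand term dominates a left-hand one. If \<open>I\<close> is constant
    from \<open>r\<close> to \<open>x\<close>, its contributions cancel. Otherwise the minimum
    \<open>I x\<close> is reached at some \<open>u'\<close> after \<open>r\<close>, and
    \<open>I x\<close> is a lower bound for the right-hand term because \<open>I u\<close> is at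
    most \<open>z u\<close> and at most \<open>I r\<close>.\<close>
  have K2: "\<exists>u'. r \<le> u' \<and> u' \<le> x \<and> z u' \<le> I r + I x + z u - 2 * I u" if "r \<le> u" "u \<le> x" for r u x
  proof (cases "I x = I r")
    case True
    then have "I u = I r"
      using I_le(2)[OF that(1)] I_le(2)[OF that(2)] by simp
    then show ?thesis
      using that True by (intro exI[of _ u]) simp
  next
    case False
    obtain u' where u': "u' \<le> x" "I x = z u'"
      using runmin_attained[OF st] unfolding I_def by blast
    have "r \<le> u'"
      using I_le(1)[of u' r] I_le(2)[of r x] False u' that by (cases "r \<le> u'") auto
    then show ?thesis
      using u' I_le(1)[of u u] I_le(2)[OF that(1)] by (intro exI[of _ u']) simp
  qed
  \<comment> \<open>Conversely, if the minimum falls after \<open>r\<close>, choose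
    \<open>u'\<close> where \<open>z\<close> and \<open>I\<close> both equal \<open>I r\<close>. It
    exists because the path cannot jump over its old minimum, and there the right-hand term equals
    \<open>I x\<close>, which is at most \<open>z u\<close>.\<close>
  have K1: "\<exists>u'. r \<le> u' \<and> u' \<le> x \<and> I r + I x + z u' - 2 * I u' \<le> z u" if "r \<le> u" "u \<le> x" for r u x
  proof (cases "I x = I r")
    case True
    then have "I u = I r"
      using I_le(2)[OF that(1)] I_le(2)[OF that(2)] by simp
    then show ?thesis
      using that True by (intro exI[of _ u]) simp
  next
    case False
    moreover have "r \<le> x"
      using that by simp
    ultimately have "I x < I r"
      using I_le(2)[of r x] by simp
    with \<open>r \<le> x\<close> obtain u' where "r \<le> u'" "u' \<le> x" "z u' = I r" "I u' = I r"
      using skip_free[of r x] unfolding I_def by auto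
    then show ?thesis
      using I_le(1)[OF that(2)] by (intro exI[of _ u']) simp
  qed
  have le_runmin': "v \<le> dep a s' u - t' u + t' x \<longleftrightarrow>
      (\<forall>r\<le>u. v \<le> a r - s r + t x + (I r + I x + z u - 2 * I u))" for v u x
    using le_runmin_iff[OF as', of "v - s' u + t' u - t' x" u]
    by (auto simp: dep_def s' t' z_def algebra_simps)
  \<comment> \<open>Finiteness of the last queue falls out of the comparison: by \<open>K2\<close>
    every right-hand term is at least some left-hand term, and those are bounded below by the
    left-hand value at \<open>x\<close>.\<close>
  show dt': "minorized (\<lambda>r. dep a s' r - t' r)"
  proof (rule minorizedI)
    fix x
    define c where "c = dep (dep a s) t x"
    have "c \<le> dep a s' u - t' u + t' x" if "u \<le> x" for u
      unfolding le_runmin'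
    proof (intro allI impI)
      fix r assume "r \<le> u"
      then obtain u' where "r \<le> u'" "u' \<le> x" "z u' \<le> I r + I x + z u - 2 * I u"
        using K2 \<open>u \<le> x\<close> by blast
      moreover have "c \<le> a r - s r + t x + z u'"
        using le_left[of c x] calculation by (simp add: c_def)
      ultimately show "c \<le> a r - s r + t x + (I r + I x + z u - 2 * I u)"
        by simp
    qed
    then have "\<forall>u\<le>x. c - t' x \<le> dep a s' u - t' u"
      by (force simp: algebra_simps)
    then show "\<exists>c. \<forall>u\<le>x. c \<le> dep a s' u - t' u" ..
  qed
  have le_right: "v \<le> dep (dep a s') t' x \<longleftrightarrow>
      (\<forall>r u. r \<le> u \<longrightarrow> u \<le> x \<longrightarrow> v \<le> a r - s r + t x + (I r + I x + z u - 2 * I u))" for v x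
  proof -
    have "v \<le> dep (dep a s') t' x \<longleftrightarrow> (\<forall>u\<le>x. v \<le> dep a s' u - t' u + t' x)"
      unfolding dep_def[of "dep a s'"] using le_runmin_iff[OF dt', of "v - t' x" x]
      by (auto simp: algebra_simps)
    then show ?thesis
      unfolding le_runmin' by blast
  qed
  have "v \<le> dep (dep a s) t x \<longleftrightarrow> v \<le> dep (dep a s') t' x" for v x
    unfolding le_left le_right
  proof (intro iffI allI impI)
    fix r u assume *: "\<forall>r u. r \<le> u \<longrightarrow> u \<le> x \<longrightarrow> v \<le> a r - s r + t x + z u" "r \<le> u" "u \<le> x"
    then obtain u' where "r \<le> u'" "u' \<le> x" "z u' \<le> I r + I x + z u - 2 * I u"
      using K2 by blast
    then show "v \<le> a r - s r + t x + (I r + I x + z u - 2 * I u)"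
      using *(1)[rule_format, of r u'] by simp
  next
    fix r u assume *: "\<forall>r u. r \<le> u \<longrightarrow> u \<le> x \<longrightarrow>
      v \<le> a r - s r + t x + (I r + I x + z u - 2 * I u)" "r \<le> u" "u \<le> x"
    then obtain u' where "r \<le> u'" "u' \<le> x" "I r + I x + z u' - 2 * I u' \<le> z u"
      using K1 by blast
    then show "v \<le> a r - s r + t x + z u"
      using *(1)[rule_format, of r u'] by simp
  qed
  then show "dep (dep a s) t = dep (dep a s') t'"
    by (intro ext) (meson order_antisym order_refl)
qed

section \<open>Cumulative counts\<close>

text \<open>On the whole line there is no first point to start counting from. A cumulative count is
  fixed only up to an additive constant, so only its increments are specified.\<close>

definition counted_by :: "config \<Rightarrow> (real \<Rightarrow> int) \<Rightarrow> bool" where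
  "counted_by X f \<longleftrightarrow> (\<forall>s t. s \<le> t \<longrightarrow> int (num_points X {s<..t}) = f t - f s)"

lemma counted_byD: "counted_by X f \<Longrightarrow> s \<le> t \<Longrightarrow> int (num_points X {s<..t}) = f t - f s"
  by (simp add: counted_by_def)

lemma counted_by_exists:
  assumes "locally_finite X"
  shows "\<exists>f. counted_by X f"
proof
  let ?n = "\<lambda>s t. int (num_points X {s<..t})"
  have add: "?n s u = ?n s t + ?n t u" if "s \<le> t" "t \<le> u" for s t u
    using num_points_Ioc[OF assms that] by simp
  show "counted_by X (\<lambda>t. if 0 \<le> t then ?n 0 t else - ?n t 0)"
    unfolding counted_by_def
  proof (intro allI impI)
    fix s t :: real assume "s \<le> t"
    then consider "0 \<le> s" | "s < 0" "0 \<le> t" | "t < 0"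
      by linarith
    then show "?n s t = (if 0 \<le> t then ?n 0 t else - ?n t 0) - (if 0 \<le> s then ?n 0 s else - ?n s 0)"
    proof cases
      case 1
      then have "0 \<le> t"
        using \<open>s \<le> t\<close> by simp
      then show ?thesis
        using add[OF 1 \<open>s \<le> t\<close>] 1 by simp
    next
      case 2
      then show ?thesis
        using add[of s 0 t] by simp
    next
      case 3
      then have "s < 0"
        using \<open>s \<le> t\<close> by simp
      then show ?thesis
        using add[of s t 0] 3 \<open>s \<le> t\<close> by simp
    qed
  qed
qed

lemma counted_by_cong: "counted_by X f \<Longrightarrow> counted_by Y f \<Longrightarrow> locally_finite X \<Longrightarrow> locally_finite Y \<Longrightarrow> X = Y"
  by (rule config_eqI) (metis less_imp_le of_nat_eq_iff counted_byD)+

lemma counted_by_gap: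
  assumes "counted_by X f" "u < v" "\<And>y. u < y \<Longrightarrow> y < v \<Longrightarrow> X y = 0"
  shows "f v = f u + int (X v)" "\<And>y. u < y \<Longrightarrow> y < v \<Longrightarrow> f y = f u"
proof -
  have "num_points X {u<..v} = num_points X {v}"
  proof (rule num_points_cong)
    fix t assume "X t \<noteq> 0"
    then show "t \<in> {u<..v} \<longleftrightarrow> t \<in> {v}"
      using assms(2) assms(3)[of t] by (cases t v rule: linorder_cases) auto
  qed
  then show "f v = f u + int (X v)"
    using counted_byD[OF assms(1), of u v] assms(2) by simp
  fix y assume "u < y" "y < v"
  moreover from this have "num_points X {u<..y} = 0"
    using assms(3) by (intro num_points_eq_0) auto
  ultimately show "f y = f u"
    using counted_byD[OF assms(1), of u y] by simp
qed

text \<open>Induction from point to point: a bounded interval is crossed in finitely many steps,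
  each with an empty interior, while the right end \<open>v\<close> may carry a point. The induction
  is on the number of points strictly between \<open>s\<close> and the current time.\<close>

lemma lf_induct [consumes 2, case_names base step]:
  assumes "locally_finite X" and "s \<le> t"
    and base: "P s"
    and step: "\<And>u v. s \<le> u \<Longrightarrow> u < v \<Longrightarrow> v \<le> t \<Longrightarrow> (\<And>y. u < y \<Longrightarrow> y < v \<Longrightarrow> X y = 0) \<Longrightarrow> P u \<Longrightarrow> P v"
  shows "P t"
proof -
  define pts where "pts v = {y \<in> {s<..<v}. X y \<noteq> 0}" for v
  have fin: "finite (pts v)" for v
    unfolding pts_def using assms(1) by (intro finite_points) auto
  have "s \<le> v \<Longrightarrow> v \<le> t \<Longrightarrow> P v" for v
  proof (induction "card (pts v)" arbitrary: v rule: less_induct)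
    case less
    show ?case
    proof (cases "s = v")
      case True
      then show ?thesis
        using base by simp
    next
      case False
      with less.prems have "s < v"
        by simp
      show ?thesis
      proof (cases "pts v = {}")
        case True
        then show ?thesis
          using step[of s v] base less.prems \<open>s < v\<close> by (auto simp: pts_def)
      next
        case False
        define m where "m = Max (pts v)"
        have m: "m \<in> pts v" "\<And>y. y \<in> pts v \<Longrightarrow> y \<le> m"
          using Max_in[OF fin False] Max_ge[OF fin] unfolding m_def by auto
        have "pts m \<subset> pts v"
          using m(1) by (auto simp: pts_def)
        then have "card (pts m) < card (pts v)"
          by (intro psubset_card_mono fin)
        moreover have sm: "s < m" "m < v"
          using m(1) by (auto simp: pts_def)
        ultimately have "P m"
          using less.hyps[of m] less.prems by simp
        moreover have "X y = 0" if "m < y" "y < v" for y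
          using m(2)[of y] that sm by (cases "X y = 0") (auto simp: pts_def)
        ultimately show ?thesis
          using step[of m v] sm less.prems by simp
      qed
    qed
  qed
  then show ?thesis
    using assms(2) by simp
qed

lemma counted_by_departures:
  assumes lf: "locally_finite A" "locally_finite S"
    and A: "counted_by A a" and S: "counted_by S s"
    and simple: "\<And>t. S t \<le> 1"
    and min: "minorized (\<lambda>r. a r - s r)"
  shows "counted_by (departures A S) (dep a s)"
  unfolding counted_by_def
proof (intro allI impI)
  fix p q :: real assume "p \<le> q"
  with locally_finite_add[OF lf] show "int (num_points (departures A S) {p<..q}) = dep a s q - dep a s p"
  proof (induction rule: lf_induct)
    case base
    show ?case
      by simp
  next
    case (step u v)
    have gap: "A y = 0" "S y = 0" if "u < y" "y < v" for y
      using step.hyps(4)[OF that] by auto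
    have "num_points (departures A S) {u<..v} = num_points (departures A S) {v}"
    proof (rule num_points_cong)
      fix t assume "departures A S t \<noteq> 0"
      then have "S t \<noteq> 0"
        by (simp add: departures_conv)
      then show "t \<in> {u<..v} \<longleftrightarrow> t \<in> {v}"
        using gap(2)[of t] step.hyps by (cases t v rule: linorder_cases) auto
    qed
    then have D: "int (num_points (departures A S) {p<..v}) = dep a s u - dep a s p + int (departures A S v)"
      using step num_points_Ioc[OF locally_finite_departures[OF lf(2)], of p u v A] by simp
    let ?m = "runmin (\<lambda>r. a r - s r)"
    have a: "a v = a u + int (A v)" and s: "s v = s u + int (S v)"
      using counted_by_gap[OF A step.hyps(2)] counted_by_gap[OF S step.hyps(2)] gap by auto
    have "?m v = min (?m u) (a v - s v)"
      using min step.hyps(2)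
    proof (rule runmin_step)
      fix y assume "u < y" "y < v"
      then show "a y - s y = a u - s u"
        using counted_by_gap(2)[OF A step.hyps(2)] counted_by_gap(2)[OF S step.hyps(2)] gap by auto
    qed
    moreover have "?m u \<le> a u - s u"
      by (rule runmin_le[OF min order_refl])
    \<comment> \<open>A service at \<open>v\<close> finds \<open>a v - s u - ?m u\<close> customers,
      arrivals at \<open>v\<close> included, and is used if this is positive.\<close>
    moreover have "(\<exists>r\<le>u. num_points S {r<..u} < num_points A {r<..v}) \<longleftrightarrow> ?m u < a v - s u"
    proof -
      have "num_points S {r<..u} < num_points A {r<..v} \<longleftrightarrow> a r - s r < a v - s u" if "r \<le> u" for r
        using counted_byD[OF A, of r v] counted_byD[OF S, of r u] that step.hyps(2) by linarith
      then have "(\<exists>r\<le>u. num_points S {r<..u} < num_points A {r<..v}) \<longleftrightarrow>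
          \<not> (\<forall>r\<le>u. a v - s u \<le> a r - s r)"
        by (auto simp: not_le)
      also have "\<dots> \<longleftrightarrow> ?m u < a v - s u"
        using le_runmin_iff[OF min, of "a v - s u" u] by auto
      finally show ?thesis .
    qed
    moreover have "departures A S v =
        of_bool (S v \<noteq> 0 \<and> (\<exists>r\<le>u. num_points S {r<..u} < num_points A {r<..v}))"
      using step.hyps(2) gap by (intro departures_iff lf) auto
    ultimately have "int (departures A S v) = dep a s v - dep a s u"
      using a s simple[of v] by (auto simp: dep_def min_def of_bool_def split: if_splits)
    then show ?case
      using D by simp
  qed
qed

text \<open>As \<open>T\<close> is simple, \<open>s - t\<close> falls by at most one at a time. When
  its running minimum drops for the first time after \<open>r\<close>, the path must stand at the
  old minimum just before.\<close>

lemma counted_by_skip_free: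
  assumes lf: "locally_finite S" "locally_finite T"
    and S: "counted_by S s" and T: "counted_by T t"
    and simple: "\<And>y. T y \<le> 1"
    and min: "minorized (\<lambda>r. s r - t r)"
    and "r \<le> x" and "runmin (\<lambda>r. s r - t r) x < runmin (\<lambda>r. s r - t r) r"
  shows "\<exists>u. r \<le> u \<and> u \<le> x \<and> s u - t u = runmin (\<lambda>r. s r - t r) r \<and>
    runmin (\<lambda>r. s r - t r) u = runmin (\<lambda>r. s r - t r) r"
proof -
  let ?z = "\<lambda>r. s r - t r"
  from locally_finite_add[OF lf] \<open>r \<le> x\<close>
  have "runmin ?z x < runmin ?z r \<longrightarrow>
    (\<exists>u. r \<le> u \<and> u \<le> x \<and> ?z u = runmin ?z r \<and> runmin ?z u = runmin ?z r)"
  proof (induction rule: lf_induct)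
    case base
    show ?case
      by simp
  next
    case (step u v)
    have gap: "S y = 0" "T y = 0" if "u < y" "y < v" for y
      using step.hyps(4)[OF that] by auto
    show ?case
    proof (intro impI, cases "runmin ?z u < runmin ?z r")
      case True
      then show "\<exists>u. r \<le> u \<and> u \<le> v \<and> ?z u = runmin ?z r \<and> runmin ?z u = runmin ?z r"
        using step by (meson less_imp_le order_trans)
    next
      case False
      assume v: "runmin ?z v < runmin ?z r"
      have u: "runmin ?z u = runmin ?z r"
        using False runmin_antimono[OF min step.hyps(1)] by simp
      have "runmin ?z v = min (runmin ?z u) (?z v)"
        using min step.hyps(2)
      proof (rule runmin_step)
        fix y assume "u < y" "y < v"
        then show "?z y = ?z u"
          using counted_by_gap(2)[OF S step.hyps(2)] counted_by_gap(2)[OF T step.hyps(2)] gap by auto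
      qed
      moreover have "?z v \<ge> ?z u - 1"
        using counted_by_gap(1)[OF S step.hyps(2)] counted_by_gap(1)[OF T step.hyps(2)] gap simple[of v] by auto
      moreover have "runmin ?z u \<le> ?z u"
        by (rule runmin_le[OF min order_refl])
      ultimately have "?z u = runmin ?z r"
        using u v by (auto simp: min_def split: if_splits)
      then show "\<exists>u. r \<le> u \<and> u \<le> v \<and> ?z u = runmin ?z r \<and> runmin ?z u = runmin ?z r"
        using u step.hyps by (intro exI[of _ u]) auto
    qed
  qed
  then show ?thesis
    using assms(8) by blast
qed

section \<open>Interchangeability of queues\<close>

text \<open>The queue length at \<open>x\<close> is the supremum over \<open>r\<close> of the net
  input since \<open>r\<close>; the condition is that the queue run from time -infinity is finite at
  every time.\<close>

definition bounded_queue :: "config \<Rightarrow> config \<Rightarrow> bool" where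
  "bounded_queue A S \<longleftrightarrow> (\<forall>x. \<exists>c. \<forall>r\<le>x. int (num_points A {r<..x}) - int (num_points S {r<..x}) \<le> c)"

lemma minorized_iff_bounded_queue:
  assumes "counted_by A a" and "counted_by S s"
  shows "minorized (\<lambda>r. a r - s r) \<longleftrightarrow> bounded_queue A S"
proof -
  have eq: "(\<forall>r\<le>x. int (num_points A {r<..x}) - int (num_points S {r<..x}) \<le> c) \<longleftrightarrow>
      (\<forall>r\<le>x. a x - s x - c \<le> a r - s r)" for x c
  proof -
    have "int (num_points A {r<..x}) - int (num_points S {r<..x}) \<le> c \<longleftrightarrow> a x - s x - c \<le> a r - s r"
      if "r \<le> x" for r
      using counted_byD[OF assms(1) that] counted_byD[OF assms(2) that] by linarith
    then show ?thesis
      by blast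
  qed
  show ?thesis
  proof
    assume *: "minorized (\<lambda>r. a r - s r)"
    show "bounded_queue A S"
      unfolding bounded_queue_def eq
    proof
      fix x
      obtain c where "\<forall>r\<le>x. c \<le> a r - s r"
        using minorizedD[OF *] by blast
      then show "\<exists>c. \<forall>r\<le>x. a x - s x - c \<le> a r - s r"
        by (intro exI[of _ "a x - s x - c"]) simp
    qed
  next
    assume "bounded_queue A S"
    then show "minorized (\<lambda>r. a r - s r)"
      unfolding bounded_queue_def eq by (intro minorizedI) blast
  qed
qed

text \<open>Run backwards in time, the departures act as arrivals and this process as the services;
  it is the second output in Burke's theorem.\<close>

definition dual_services :: "config \<Rightarrow> config \<Rightarrow> config" where
  "dual_services A S = (\<lambda>t. A t + unused_services A S t)"

lemma num_points_le:
  assumes "locally_finite Y" and "\<And>t. X t \<le> Y t" and "bounded B"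
  shows "num_points X B \<le> num_points Y B"
proof -
  have "num_points (\<lambda>t. X t + (Y t - X t)) B = num_points X B + num_points (\<lambda>t. Y t - X t) B"
    using assms by (intro num_points_add locally_finite_le[OF assms(1)]) auto
  moreover have "(\<lambda>t. X t + (Y t - X t)) = Y"
    using assms(2) by (simp add: fun_eq_iff)
  ultimately show ?thesis
    by simp
qed

lemma locally_finite_unused: "locally_finite S \<Longrightarrow> locally_finite (unused_services A S)"
  by (erule locally_finite_le) (simp add: unused_services_def)

lemma locally_finite_dual: 
  "locally_finite A \<Longrightarrow> locally_finite S \<Longrightarrow> locally_finite (dual_services A S)"
  unfolding dual_services_def by (intro locally_finite_add locally_finite_unused)

lemma num_points_dual:
  assumes "locally_finite A" and "locally_finite S" and "bounded B"
  shows "num_points (dual_services A S) B + num_points (departures A S) B =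
    num_points A B + num_points S B"
proof -
  have "(\<lambda>t. dual_services A S t + departures A S t) = (\<lambda>t. A t + S t)"
    using departures_le[of A S] by (simp add: fun_eq_iff dual_services_def unused_services_def trans_le_add2)
  then show ?thesis
    using num_points_add[OF locally_finite_dual[OF assms(1,2)] locally_finite_departures[OF assms(2)] assms(3), of A]
      num_points_add[OF assms] by simp
qed

lemma dual_services_simple:
  assumes "\<And>t. A t \<le> 1" and "\<And>t. S t \<le> 1"
  shows "dual_services A S t \<le> 1"
proof (cases "A t = 0 \<or> S t = 0")
  case True
  then show ?thesis
    using assms[of t] by (auto simp: dual_services_def unused_services_def)
next
  case False
  then have "num_points S {t..<t} < num_points A {t..t}"
    by simp
  then have "departures A S t = 1"
    using False unfolding departures_conv by auto
  then show ?thesis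
    using assms[of t] by (simp add: dual_services_def unused_services_def)
qed

text \<open>Two of the queues are finite by monotonicity: \<open>departures A S\<close> is dominated
  by \<open>S\<close>, and \<open>dual_services S T\<close> dominates \<open>S\<close>. For the
  queue of \<open>departures A (dual_services S T)\<close> at \<open>departures S T\<close>,
  finiteness comes from \<open>dep_interchange\<close> itself.\<close>

theorem departures_interchange:
  assumes lf: "locally_finite A" "locally_finite S" "locally_finite T"
    and simple: "\<And>t. S t \<le> 1" "\<And>t. T t \<le> 1"
    and queue: "bounded_queue A S" "bounded_queue S T"
  shows "departures (departures A S) T =
    departures (departures A (dual_services S T)) (departures S T)"
proof -
  obtain a s t where counted_by: "counted_by A a" "counted_by S s" "counted_by T t"
    using counted_by_exists lf by metis
  have as: "minorized (\<lambda>r. a r - s r)" and st: "minorized (\<lambda>r. s r - t r)"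
    using queue counted_by by (simp_all add: minorized_iff_bounded_queue)
  have D: "counted_by (departures A S) (dep a s)"
    by (intro counted_by_departures lf counted_by simple as)
  have T': "counted_by (departures S T) (dep s t)"
    by (intro counted_by_departures lf counted_by simple st)
  have S': "counted_by (dual_services S T) (\<lambda>r. s r + t r - dep s t r)"
    unfolding counted_by_def
  proof (intro allI impI)
    fix p q :: real assume "p \<le> q"
    then show "int (num_points (dual_services S T) {p<..q}) =
        (s q + t q - dep s t q) - (s p + t p - dep s t p)"
      using num_points_dual[OF lf(2,3), of "{p<..q}"] counted_byD[OF T', of p q]
        counted_byD[OF counted_by(2), of p q] counted_byD[OF counted_by(3), of p q] by simp
  qed
  have bq_le: "bounded_queue X T" if X: "\<And>t. X t \<le> S t" for X
    unfolding bounded_queue_def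
  proof
    fix x
    obtain c where "\<forall>r\<le>x. int (num_points S {r<..x}) - int (num_points T {r<..x}) \<le> c"
      using queue(2) unfolding bounded_queue_def by blast
    moreover have "num_points X {r<..x} \<le> num_points S {r<..x}" for r
      by (intro num_points_le lf X) auto
    ultimately have "\<forall>r\<le>x. int (num_points X {r<..x}) - int (num_points T {r<..x}) \<le> c"
      by (smt (verit) of_nat_mono)
    then show "\<exists>c. \<forall>r\<le>x. int (num_points X {r<..x}) - int (num_points T {r<..x}) \<le> c" ..
  qed
  have dt: "minorized (\<lambda>r. dep a s r - t r)"
    using minorized_iff_bounded_queue[OF D counted_by(3)] bq_le[of "departures A S"] departures_le by simp
  have "bounded_queue A (dual_services S T)"
    unfolding bounded_queue_def
  proof
    fix x
    obtain c where "\<forall>r\<le>x. int (num_points A {r<..x}) - int (num_points S {r<..x}) \<le> c"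
      using queue(1) unfolding bounded_queue_def by blast
    moreover have "num_points S {r<..x} \<le> num_points (dual_services S T) {r<..x}" for r
      by (intro num_points_le locally_finite_dual lf) (auto simp: dual_services_def)
    ultimately have "\<forall>r\<le>x. int (num_points A {r<..x}) - int (num_points (dual_services S T) {r<..x}) \<le> c"
      by (smt (verit) of_nat_mono)
    then show "\<exists>c. \<forall>r\<le>x. int (num_points A {r<..x}) - int (num_points (dual_services S T) {r<..x}) \<le> c" ..
  qed
  then have as': "minorized (\<lambda>r. a r - (s r + t r - dep s t r))"
    using minorized_iff_bounded_queue[OF counted_by(1) S'] by simp
  have D': "counted_by (departures A (dual_services S T)) (dep a (\<lambda>r. s r + t r - dep s t r))"
    by (intro counted_by_departures lf locally_finite_dual counted_by S' as' dual_services_simple simple)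
  note interchange = dep_interchange[of a s t, OF as st dt counted_by_skip_free[OF lf(2,3) counted_by(2,3) simple(2) st]]
  have "counted_by (departures (departures A S) T) (dep (dep a s) t)"
    by (intro counted_by_departures lf locally_finite_departures counted_by D simple dt)
  moreover have "counted_by (departures (departures A (dual_services S T)) (departures S T))
      (dep (dep a (\<lambda>r. s r + t r - dep s t r)) (dep s t))"
  proof (rule counted_by_departures[OF _ _ D' T'])
    show "locally_finite (departures A (dual_services S T))" "locally_finite (departures S T)"
      by (intro locally_finite_departures locally_finite_dual lf)+
    show "departures S T r \<le> 1" for r
      by (simp add: departures_conv)
    show "minorized (\<lambda>r. dep a (\<lambda>r. s r + t r - dep s t r) r - dep s t r)"
      by (rule interchange(2))
  qed
  then have "counted_by (departures (departures A (dual_services S T)) (departures S T)) (dep (dep a s) t)"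
    by (subst interchange(1))
  ultimately show ?thesis
    by (intro counted_by_cong locally_finite_departures lf)
qed

section \<open>Burke's theorem in discrete time\<close>

text \<open>Each time slot carries an arrival \<open>(1, 0)\<close>, a service \<open>(0, 1)\<close> or nothing. The output
  records departures and dual services in the same encoding.\<close>

definition qstep :: "nat \<times> nat \<times> nat \<Rightarrow> nat \<times> nat \<times> nat" where
  "qstep = (\<lambda>(q, m). if m = (1, 0) then (Suc q, (0, 1))
    else if m = (0, 1) \<and> q > 0 then (q - 1, (1, 0)) else (q, m))"

fun run :: "nat \<Rightarrow> (nat \<times> nat) list \<Rightarrow> nat \<times> (nat \<times> nat) list" where
  "run q [] = (q, [])"
| "run q (m # ms) = (case qstep (q, m) of (q', m') \<Rightarrow> case run q' ms of (q'', ms') \<Rightarrow> (q'', m' # ms'))"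

text \<open>An arrival leaves as a dual service and a used service as a departure, so feeding the
  output back moves the queue the opposite way: time reversal in a single step.\<close>

lemma qstep_involution: "qstep (qstep p) = p"
  by (auto simp: qstep_def split: prod.splits if_splits)

lemma inj_qstep: "inj qstep"
  by (metis injI qstep_involution)

lemma run_append:
  "run q (xs @ ys) = (fst (run (fst (run q xs)) ys), snd (run q xs) @ snd (run (fst (run q xs)) ys))"
  by (induction xs arbitrary: q) (auto simp: case_prod_beta)

lemma length_run [simp]: "length (snd (run q ms)) = length ms"
  by (induction ms arbitrary: q) (auto simp: case_prod_beta)

text \<open>For an involution, invariance means that \<open>y\<close> and \<open>qstep y\<close>
  have equal mass. The only nontrivial pairs are \<open>(q, (1, 0))\<close> and
  \<open>(Suc q, (0, 1))\<close>, where this is the detailed balance of a birth-death chain with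
  ratio \<rho>.\<close>

lemma qstep_pmf:
  fixes \<kappa> :: "(nat \<times> nat) pmf"
  assumes "0 < \<rho>" "\<rho> < 1" and balance: "pmf \<kappa> (1, 0) = \<rho> * pmf \<kappa> (0, 1)"
  shows "map_pmf qstep (pair_pmf (geometric_pmf (1 - \<rho>)) \<kappa>) = pair_pmf (geometric_pmf (1 - \<rho>)) \<kappa>"
proof (rule pmf_eqI)
  let ?M = "pair_pmf (geometric_pmf (1 - \<rho>)) \<kappa>"
  fix y :: "nat \<times> nat \<times> nat"
  have "pmf (map_pmf qstep ?M) y = pmf (map_pmf qstep ?M) (qstep (qstep y))"
    by (simp add: qstep_involution)
  also have "\<dots> = pmf ?M (qstep y)"
    by (rule pmf_map_inj'[OF inj_qstep])
  also have "\<dots> = pmf ?M y"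
  proof -
    obtain q m where y: "y = (q, m)"
      by (cases y)
    show ?thesis
      using assms unfolding y by (cases q) (auto simp: qstep_def pmf_pair)
  qed
  finally show "pmf (map_pmf qstep ?M) y = pmf ?M y" .
qed

text \<open>After one step the queue is again in equilibrium and independent of the output just
  produced, so the remaining slots start afresh. This is the independence of the present queue from
  the past output.\<close>

lemma run_pmf:
  assumes "map_pmf qstep (pair_pmf G \<kappa>) = pair_pmf G \<kappa>"
  shows "map_pmf (\<lambda>(q, ms). run q ms) (pair_pmf G (replicate_pmf N \<kappa>)) = pair_pmf G (replicate_pmf N \<kappa>)"
proof (induction N)
  case 0
  show ?case
    by (simp add: pair_pmf_def map_pmf_def bind_assoc_pmf bind_return_pmf)
next
  case (Suc N)
  let ?R = "replicate_pmf N \<kappa>"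
  have "map_pmf (\<lambda>(q, ms). run q ms) (pair_pmf G (replicate_pmf (Suc N) \<kappa>)) =
      bind_pmf (pair_pmf G \<kappa>) (\<lambda>p. bind_pmf ?R (\<lambda>ms. 
        return_pmf (case qstep p of (q', m') \<Rightarrow> case run q' ms of (q'', ms') \<Rightarrow> (q'', m' # ms'))))"
    by (simp add: pair_pmf_def map_pmf_def bind_assoc_pmf bind_return_pmf)
  also have "\<dots> = bind_pmf (map_pmf qstep (pair_pmf G \<kappa>)) (\<lambda>(q', m'). bind_pmf ?R (\<lambda>ms.
        return_pmf (case run q' ms of (q'', ms') \<Rightarrow> (q'', m' # ms'))))"
    by (simp add: bind_map_pmf case_prod_beta)
  also have "\<dots> = bind_pmf (pair_pmf G \<kappa>) (\<lambda>(q', m'). bind_pmf ?R (\<lambda>ms.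
        return_pmf (case run q' ms of (q'', ms') \<Rightarrow> (q'', m' # ms'))))"
    unfolding assms ..
  also have "\<dots> = bind_pmf \<kappa> (\<lambda>m'. bind_pmf G (\<lambda>q'. bind_pmf ?R (\<lambda>ms.
        return_pmf (case run q' ms of (q'', ms') \<Rightarrow> (q'', m' # ms')))))"
    unfolding pair_pmf_def by (simp add: bind_assoc_pmf bind_return_pmf) (rule bind_commute_pmf)
  also have "\<dots> = bind_pmf \<kappa> (\<lambda>m'. map_pmf (\<lambda>(q'', ms'). (q'', m' # ms'))
        (map_pmf (\<lambda>(q, ms). run q ms) (pair_pmf G ?R)))"
    by (simp add: pair_pmf_def map_pmf_def bind_assoc_pmf bind_return_pmf)
  also have "\<dots> = bind_pmf \<kappa> (\<lambda>m'. bind_pmf G (\<lambda>q. bind_pmf ?R (\<lambda>ms. return_pmf (q, m' # ms))))"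
    unfolding Suc.IH by (simp add: pair_pmf_def map_pmf_def bind_assoc_pmf bind_return_pmf)
  also have "\<dots> = bind_pmf G (\<lambda>q. bind_pmf \<kappa> (\<lambda>m'. bind_pmf ?R (\<lambda>ms. return_pmf (q, m' # ms))))"
    by (rule bind_commute_pmf)
  also have "\<dots> = pair_pmf G (replicate_pmf (Suc N) \<kappa>)"
    by (simp add: pair_pmf_def bind_assoc_pmf bind_return_pmf)
  finally show ?case .
qed

text \<open>The average over the initial queue stays outside, since the later limit is taken for
  each initial value \<open>q\<close> separately.\<close>

lemma expectation_run:
  assumes "map_pmf qstep (pair_pmf G \<kappa>) = pair_pmf G \<kappa>"
  shows "measure_pmf.expectation G
      (\<lambda>q. measure_pmf.prob (replicate_pmf N \<kappa>) {ms. snd (run q ms) \<in> E}) =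
    measure_pmf.prob (replicate_pmf N \<kappa>) E"
proof -
  let ?R = "replicate_pmf N \<kappa>"
  have R: "?R = bind_pmf G (\<lambda>q. map_pmf (\<lambda>ms. snd (run q ms)) ?R)"
  proof -
    have "?R = map_pmf snd (map_pmf (\<lambda>(q, ms). run q ms) (pair_pmf G ?R))"
      by (simp add: run_pmf[OF assms] map_snd_pair_pmf)
    also have "\<dots> = bind_pmf G (\<lambda>q. map_pmf (\<lambda>ms. snd (run q ms)) ?R)"
      by (simp add: pair_pmf_def map_pmf_def bind_assoc_pmf bind_return_pmf)
    finally show ?thesis .
  qed
  have "ennreal (measure_pmf.prob ?R E) = emeasure ?R E"
    by (simp add: measure_pmf.emeasure_eq_measure)
  also have "\<dots> = (\<integral>\<^sup>+q. emeasure (map_pmf (\<lambda>ms. snd (run q ms)) ?R) E \<partial>G)"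
    by (subst R) simp
  also have "\<dots> = (\<integral>\<^sup>+q. ennreal (measure_pmf.prob ?R {ms. snd (run q ms) \<in> E}) \<partial>G)"
    by (simp add: measure_pmf.emeasure_eq_measure vimage_def)
  also have "\<dots> = ennreal (measure_pmf.expectation G (\<lambda>q. measure_pmf.prob ?R {ms. snd (run q ms) \<in> E}))"
    by (intro nn_integral_eq_integral measure_pmf.integrable_const_bound[where B = 1]) auto
  finally show ?thesis
    by (simp add: integral_nonneg_AE)
qed

definition excess :: "(nat \<times> nat) list \<Rightarrow> int" where
  "excess ms = (\<Sum>(a, s)\<leftarrow>ms. int a - int s)"

text \<open>The queue started from \<open>q\<close> is the larger of the path that never idles and
  the queue started empty. Once the services have outweighed \<open>q\<close> and the arrivals, the
  starting value is forgotten, which gives the coupling below.\<close>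

lemma run_queue:
  assumes "\<forall>(a, s)\<in>set ms. a + s \<le> 1"
  shows "int (fst (run q ms)) = max (int q + excess ms) (int (fst (run 0 ms)))"
  using assms
proof (induction ms arbitrary: q)
  case Nil
  then show ?case
    by (simp add: excess_def)
next
  case (Cons m ms)
  obtain a s where m: "m = (a, s)"
    by (cases m)
  have as: "a + s \<le> 1"
    using Cons.prems m by simp
  have fst_run: "fst (run q (m # ms)) = fst (run (fst (qstep (q, m))) ms)" for q
    by (simp add: case_prod_beta)
  have IH: "int (fst (run q ms)) = max (int q + excess ms) (int (fst (run 0 ms)))" for q
    using Cons.prems by (intro Cons.IH) simp
  have "int (fst (qstep (q, m))) = max (int q + (int a - int s)) (int (fst (qstep (0, m))))"
    using as unfolding m by (cases a; cases s) (auto simp: qstep_def)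
  then show ?case
    unfolding fst_run IH[of "fst (qstep (q, m))"] IH[of "fst (qstep (0, m))"]
    by (simp add: excess_def m max_def)
qed

lemma run_coupling:
  assumes "\<forall>(a, s)\<in>set ms. a + s \<le> 1" and "int q + excess ms \<le> 0" and "int q' + excess ms \<le> 0"
  shows "fst (run q ms) = fst (run q' ms)"
  using run_queue[OF assms(1), of q] run_queue[OF assms(1), of q'] assms(2,3) by simp

section \<open>The queue on a grid\<close>

definition counts :: "nat \<Rightarrow> config \<times> config \<Rightarrow> (nat \<times> nat) list" where
  "counts n p = map (\<lambda>k. (num_points (fst p) (cell n k), num_points (snd p) (cell n k))) [0..<ncells n]"

text \<open>The fine cells before time \<open>-n\<close> are dropped: this is the stretch on which a
  chain started at \<open>-m\<close> may still differ from the stationary queue.\<close>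

definition coarse :: "nat \<Rightarrow> nat \<Rightarrow> (nat \<times> nat) list \<Rightarrow> (nat \<times> nat) list" where
  "coarse n m xs = map (\<lambda>j. (\<Sum>i\<in>{refine n m j..<refine n m (Suc j)}. fst (xs ! i),
    \<Sum>i\<in>{refine n m j..<refine n m (Suc j)}. snd (xs ! i))) [0..<ncells n]"

lemma coarse_cong:
  assumes "n \<le> m" and "\<And>k. refine n m 0 \<le> k \<Longrightarrow> k < ncells m \<Longrightarrow> xs ! k = ys ! k"
  shows "coarse n m xs = coarse n m ys"
proof -
  have "xs ! i = ys ! i" if "j < ncells n" "i \<in> {refine n m j..<refine n m (Suc j)}" for i j
    using that refine_mono[of 0 j n m] refine_ncells_le[OF assms(1), of "Suc j"] by (intro assms(2)) auto
  then show ?thesis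
    unfolding coarse_def by (intro map_cong) (auto intro!: sum.cong)
qed

lemma coarse_counts:
  assumes "n \<le> m" and "locally_finite x" and "locally_finite y"
  shows "coarse n m (counts m (x, y)) = counts n (x, y)"
proof -
  have "i < ncells m" if "j < ncells n" "i \<in> {refine n m j..<refine n m (Suc j)}" for i j
    using that refine_ncells_le[OF assms(1), of "Suc j"] by auto
  then show ?thesis
    unfolding coarse_def counts_def[of n] using assms
    by (intro map_cong refl) (auto simp: counts_def num_points_refine intro!: sum.cong)
qed

definition mark :: "nat \<times> nat \<Rightarrow> nat \<times> nat" where
  "mark m = (if fst m + snd m \<le> 1 then m else (0, 0))"

text \<open>Two bounds leave a single value for the queue after the cell: the running minimum never
  rises, and either it keeps its old value or it is attained inside the cell, in which case the
  final queue is at most the number of arrivals in the cell.\<close>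

lemma queue_cell:
  assumes lf: "locally_finite A" "locally_finite S"
    and counted_by: "counted_by A a" "counted_by S s"
    and simple: "\<And>t. S t \<le> 1"
    and min: "minorized (\<lambda>r. a r - s r)"
    and "u \<le> v" and cell: "num_points A {u<..v} + num_points S {u<..v} \<le> 1"
  shows "qstep (nat (a u - dep a s u), (num_points A {u<..v}, num_points S {u<..v})) =
    (nat (a v - dep a s v), (num_points (departures A S) {u<..v}, num_points (dual_services A S) {u<..v}))"
proof -
  define m where "m = runmin (\<lambda>r. a r - s r)"
  define q where "q x = a x - dep a s x" for x
  have q: "q x = a x - s x - m x" for x
    by (simp add: q_def dep_def m_def)
  have q_nonneg: "q x \<ge> 0" for x
    using runmin_le[OF min, of x x] by (simp add: q m_def)
  define \<alpha> \<sigma> \<delta> where "\<alpha> = num_points A {u<..v}" and "\<sigma> = num_points S {u<..v}"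
    and "\<delta> = num_points (departures A S) {u<..v}"
  have \<alpha>: "int \<alpha> = a v - a u" and \<sigma>: "int \<sigma> = s v - s u"
    using counted_byD[OF counted_by(1) \<open>u \<le> v\<close>] counted_byD[OF counted_by(2) \<open>u \<le> v\<close>] by (simp_all add: \<alpha>_def \<sigma>_def)
  have \<delta>: "int \<delta> = int \<alpha> + q u - q v"
    using counted_byD[OF counted_by_departures[OF lf counted_by simple min] \<open>u \<le> v\<close>] \<alpha> by (simp add: \<delta>_def q_def)
  have dual: "num_points (dual_services A S) {u<..v} = \<alpha> + \<sigma> - \<delta>"
    using num_points_dual[OF lf, of "{u<..v}"] by (simp add: \<alpha>_def \<sigma>_def \<delta>_def)
  have lower: "q u + int \<alpha> - int \<sigma> \<le> q v"
    using runmin_antimono[OF min \<open>u \<le> v\<close>] \<alpha> \<sigma> by (simp add: q m_def)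
  have upper: "q v \<le> max (q u + int \<alpha> - int \<sigma>) (int \<alpha>)"
  proof -
    obtain r where r: "r \<le> v" "m v = a r - s r"
      using runmin_attained[OF min] unfolding m_def by blast
    show ?thesis
    proof (cases "r \<le> u")
      case True
      then have "m u \<le> m v"
        using r runmin_le[OF min, of r u] by (simp add: m_def)
      then show ?thesis
        using \<alpha> \<sigma> by (simp add: q)
    next
      case False
      have "q v = (a v - a r) - (s v - s r)"
        using r by (simp add: q)
      also have "\<dots> \<le> int \<alpha>"
        using counted_byD[OF counted_by(1), of u r] counted_byD[OF counted_by(2), of r v] False r(1) \<alpha> by simp
      finally show ?thesis
        by simp
    qed
  qed
  have "\<alpha> + \<sigma> \<le> 1"
    using cell by (simp add: \<alpha>_def \<sigma>_def)
  then consider "\<alpha> = 0" "\<sigma> = 0" | "\<alpha> = 1" "\<sigma> = 0" | "\<alpha> = 0" "\<sigma> = 1"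
    by linarith
  then have "qstep (nat (q u), (\<alpha>, \<sigma>)) = (nat (q v), (\<delta>, \<alpha> + \<sigma> - \<delta>))"
  proof cases
    case 1
    then have "q v = q u" "\<delta> = 0"
      using lower upper q_nonneg[of u] \<delta> by auto
    then show ?thesis
      using 1 by (simp add: qstep_def)
  next
    case 2
    then have "q v = q u + 1" "\<delta> = 0"
      using lower upper q_nonneg[of u] \<delta> by auto
    then show ?thesis
      using 2 q_nonneg[of u] by (simp add: qstep_def nat_add_distrib)
  next
    case 3
    then have "q v = max (q u - 1) 0"
      using lower upper q_nonneg[of v] by auto
    then show ?thesis
      using 3 q_nonneg[of u] \<delta> by (cases "q u = 0") (auto simp: qstep_def nat_diff_distrib)
  qed
  then show ?thesis
    unfolding dual by (simp only: \<alpha>_def \<sigma>_def \<delta>_def q_def)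
qed

lemma run_cells:
  assumes lf: "locally_finite A" "locally_finite S"
    and counted_by: "counted_by A a" "counted_by S s"
    and simple: "\<And>t. S t \<le> 1"
    and min: "minorized (\<lambda>r. a r - s r)"
    and "i \<le> j" and cells: "\<And>k. k < j \<Longrightarrow> num_points A (cell n k) + num_points S (cell n k) \<le> 1"
  shows "run (nat (a (pt n i) - dep a s (pt n i)))
      (map (\<lambda>k. (num_points A (cell n k), num_points S (cell n k))) [i..<j]) =
    (nat (a (pt n j) - dep a s (pt n j)),
      map (\<lambda>k. (num_points (departures A S) (cell n k), num_points (dual_services A S) (cell n k))) [i..<j])"
  using \<open>i \<le> j\<close> cells
proof (induction j rule: dec_induct)
  case (step j)
  have "qstep (nat (a (pt n j) - dep a s (pt n j)), (num_points A (cell n j), num_points S (cell n j))) =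
    (nat (a (pt n (Suc j)) - dep a s (pt n (Suc j))),
      (num_points (departures A S) (cell n j), num_points (dual_services A S) (cell n j)))"
    unfolding cell_def using step.prems[of j]
    by (intro queue_cell lf counted_by simple min pt_mono) (simp_all add: cell_def)
  then show ?case
    using step by (simp add: run_append)
qed simp

lemma excess_grid:
  assumes "locally_finite A" and "locally_finite S" and "i \<le> j"
  shows "excess (map (\<lambda>k. (num_points A (cell n k), num_points S (cell n k))) [i..<j]) =
    int (num_points A {pt n i<..pt n j}) - int (num_points S {pt n i<..pt n j})"
  unfolding num_points_grid[OF assms(1,3)] num_points_grid[OF assms(2,3)]
  by (simp add: excess_def comp_def sum_list_distinct_conv_sum_set sum_subtractf)

text \<open>From the time \<open>-n\<close> on, the stationary queue has forgotten its state at time \<open>-m\<close>.\<close>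

lemma coupled_run:
  assumes lf: "locally_finite A" "locally_finite S"
    and simple: "\<And>t. S t \<le> 1" and queue: "bounded_queue A S"
    and "n \<le> m"
    and cells: "\<And>k. k < ncells m \<Longrightarrow> num_points A (cell m k) + num_points S (cell m k) \<le> 1"
    and drift: "\<And>r. r \<le> - real m \<Longrightarrow>
      int (num_points A {r<..- real n}) - int (num_points S {r<..- real n}) \<le> - int q"
  shows "coarse n m (snd (run q (map mark (counts m (A, S))))) =
    counts n (departures A S, dual_services A S)"
proof -
  obtain a s where counted_by: "counted_by A a" "counted_by S s"
    using counted_by_exists lf by metis
  have min: "minorized (\<lambda>r. a r - s r)"
    using minorized_iff_bounded_queue[OF counted_by] queue by simp
  define k where "k = refine n m 0"
  have k: "k \<le> ncells m" and pt_k: "pt m k = - real n"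
    unfolding k_def using refine_ncells_le[OF \<open>n \<le> m\<close>, of 0] \<open>n \<le> m\<close> by (auto simp: pt_refine pt_0)
  define f where "f j = (num_points A (cell m j), num_points S (cell m j))" for j
  define g where "g j = (num_points (departures A S) (cell m j), num_points (dual_services A S) (cell m j))" for j
  define q0 where "q0 i = nat (a (pt m i) - dep a s (pt m i))" for i
  have run_f: "run (q0 i) (map f [i..<j]) = (q0 j, map g [i..<j])" if "i \<le> j" "j \<le> ncells m" for i j
    using that cells unfolding q0_def f_def g_def
    by (intro run_cells lf counted_by simple min) auto
  have "map mark (counts m (A, S)) = map f [0..<ncells m]"
    unfolding counts_def f_def using cells by (simp add: mark_def)
  also have "\<dots> = map f [0..<k] @ map f [k..<ncells m]"
    using k by (metis le_add_diff_inverse map_append upt_add_eq_append zero_le)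
  finally have split: "map mark (counts m (A, S)) = map f [0..<k] @ map f [k..<ncells m]" .
  let ?d = "excess (map f [0..<k])"
  have d: "?d = int (num_points A {- real m<..- real n}) - int (num_points S {- real m<..- real n})"
    unfolding f_def using excess_grid[OF lf, of 0 k m] by (simp add: pt_k pt_0)
  have "fst (run q (map f [0..<k])) = fst (run (q0 0) (map f [0..<k]))"
  proof (rule run_coupling)
    show "\<forall>(a, s)\<in>set (map f [0..<k]). a + s \<le> 1"
      using cells k by (auto simp: f_def)
    show "int q + ?d \<le> 0"
      unfolding d using drift[of "- real m"] by simp
    \<comment> \<open>The stationary queue at \<open>-m\<close> is the net input since a minimizer
      \<open>r\<close>; adding the net input from \<open>-m\<close> to \<open>-n\<close> gives the
      net input over all of \<open>{r<..-n}\<close>. This is why the drift is required from every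
      \<open>r\<close> up to \<open>-m\<close>.\<close>
    obtain r where r: "r \<le> - real m" "runmin (\<lambda>r. a r - s r) (- real m) = a r - s r"
      using runmin_attained[OF min] by blast
    have "int (q0 0) = a (- real m) - s (- real m) - (a r - s r)"
      using runmin_le[OF min, of "- real m" "- real m"] r(2) by (simp add: q0_def pt_0 dep_def)
    also have "\<dots> = int (num_points A {r<..- real n}) - int (num_points S {r<..- real n}) - ?d"
      unfolding d using counted_byD[OF counted_by(1), of r "- real n"] counted_byD[OF counted_by(2), of r "- real n"]
        counted_byD[OF counted_by(1), of "- real m" "- real n"] counted_byD[OF counted_by(2), of "- real m" "- real n"] r(1) \<open>n \<le> m\<close>
      by simp
    finally show "int (q0 0) + ?d \<le> 0"
      using drift[OF r(1)] by simp
  qed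
  also have "\<dots> = q0 k"
    using run_f[of 0 k] k by simp
  finally have out: "snd (run q (map mark (counts m (A, S)))) = snd (run q (map f [0..<k])) @ map g [k..<ncells m]"
    unfolding split run_append using run_f[OF k order_refl] by simp
  have "coarse n m (snd (run q (map mark (counts m (A, S))))) =
      coarse n m (counts m (departures A S, dual_services A S))"
  proof (rule coarse_cong[OF \<open>n \<le> m\<close>])
    fix i assume "refine n m 0 \<le> i" "i < ncells m"
    then have "k \<le> i" "i < ncells m"
      by (simp_all add: k_def)
    then have "(snd (run q (map f [0..<k])) @ map g [k..<ncells m]) ! i = g i"
      by (simp add: nth_append)
    then show "snd (run q (map mark (counts m (A, S)))) ! i = counts m (departures A S, dual_services A S) ! i"
      unfolding out using \<open>i < ncells m\<close> by (simp add: counts_def g_def)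
  qed
  also have "\<dots> = counts n (departures A S, dual_services A S)"
    by (intro coarse_counts \<open>n \<le> m\<close> locally_finite_departures locally_finite_dual lf)
  finally show ?thesis .
qed

section \<open>Cell counts determine a law\<close>

abbreviation config_pair_space :: "(config \<times> config) measure" where
  "config_pair_space \<equiv> config_space \<Otimes>\<^sub>M config_space"

lemma length_counts [simp]: "length (counts n p) = ncells n"
  by (simp add: counts_def)

lemma counts_eq_iff:
  "counts n p = zs \<longleftrightarrow> length zs = ncells n \<and> (\<forall>k<ncells n. num_points (fst p) (cell n k) = fst (zs ! k) \<and>
    num_points (snd p) (cell n k) = snd (zs ! k))"
  by (auto simp: counts_def list_eq_iff_nth_eq prod_eq_iff)

lemma measurable_counts [measurable]: "counts n \<in> config_pair_space \<rightarrow>\<^sub>M count_space UNIV"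
proof -
  have "counts n -` {zs} \<inter> space config_pair_space \<in> sets config_pair_space" for zs
  proof -
    have [measurable]: "(\<lambda>p. num_points (fst p) (cell n k)) \<in> config_pair_space \<rightarrow>\<^sub>M count_space UNIV"
      "(\<lambda>p. num_points (snd p) (cell n k)) \<in> config_pair_space \<rightarrow>\<^sub>M count_space UNIV" for k
      by (auto intro!: measurable_compose[OF _ measurable_num_points])
    have "Measurable.pred config_pair_space (\<lambda>p. length zs = ncells n \<and> (\<forall>k\<in>{..<ncells n}.
        num_points (fst p) (cell n k) = fst (zs ! k) \<and> num_points (snd p) (cell n k) = snd (zs ! k)))"
      by (intro pred_intros_logic pred_intros_finite pred_count_space_const1) auto
    then show ?thesis
      by (simp add: pred_def counts_eq_iff vimage_def Int_def conj_commute Ball_def lessThan_def)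
  qed
  then show ?thesis
    by (auto simp: measurable_count_space_eq2_countable)
qed

lemma space_config_pair: "space config_pair_space = {p. locally_finite (fst p) \<and> locally_finite (snd p)}"
  by (auto simp: space_pair_measure)

text \<open>Events of two levels can both be read off the finer grid, so they are stable under
  intersection. They generate the sigma-algebra because cell counts already decide measurability
  into \<open>config_space\<close>.\<close>

lemma law_eqI:
  assumes P: "prob_space P" "sets P = sets config_pair_space"
    and Q: "prob_space Q" "sets Q = sets config_pair_space"
    and eq: "\<And>n E. measure P {p \<in> space P. counts n p \<in> E} = measure Q {p \<in> space Q. counts n p \<in> E}"
  shows "P = Q"
proof -
  let ?\<Omega> = "space config_pair_space"
  let ?E = "{{p \<in> ?\<Omega>. counts n p \<in> E} |n E. True}"
  have spaces: "space P = ?\<Omega>" "space Q = ?\<Omega>"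
    using P(2) Q(2) by (auto dest: sets_eq_imp_space_eq)
  have coarse: "coarse n m (counts m p) = counts n p" if "n \<le> m" "p \<in> ?\<Omega>" for n m p
    using coarse_counts[OF that(1), of "fst p" "snd p"] that(2) by (simp add: space_config_pair)
  have E_\<Omega>: "?E \<subseteq> Pow ?\<Omega>"
    by auto
  have stable: "Int_stable ?E"
  proof (rule Int_stableI)
    fix a b assume "a \<in> ?E" "b \<in> ?E"
    then obtain n E m E' where a: "a = {p \<in> ?\<Omega>. counts n p \<in> E}" and b: "b = {p \<in> ?\<Omega>. counts m p \<in> E'}"
      by auto
    define l where "l = max n m"
    have "a \<inter> b = {p \<in> ?\<Omega>. counts l p \<in> {xs. coarse n l xs \<in> E \<and> coarse m l xs \<in> E'}}"
      unfolding a b using coarse[of n l] coarse[of m l] by (auto simp: l_def)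
    then show "a \<inter> b \<in> ?E"
      by blast
  qed
  have cell_measurable: "(\<lambda>p. num_points (f p) (cell n j)) \<in> sigma ?\<Omega> ?E \<rightarrow>\<^sub>M count_space UNIV"
    if "j < ncells n" "f = fst \<or> f = snd" for f :: "config \<times> config \<Rightarrow> config" and n j
  proof -
    have "(\<lambda>p. num_points (f p) (cell n j)) -` {k} \<inter> ?\<Omega> \<in> sets (sigma ?\<Omega> ?E)" for k
    proof -
      have "(\<lambda>p. num_points (f p) (cell n j)) -` {k} \<inter> ?\<Omega> =
          {p \<in> ?\<Omega>. counts n p \<in> {xs. (if f = fst then fst (xs ! j) else snd (xs ! j)) = k}}"
        using that by (auto simp: counts_def)
      then have "(\<lambda>p. num_points (f p) (cell n j)) -` {k} \<inter> ?\<Omega> \<in> ?E"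
        by blast
      then show ?thesis
        using E_\<Omega> by (simp add: sets_measure_of)
    qed
    then show ?thesis
      using E_\<Omega> by (auto simp: measurable_count_space_eq2_countable space_measure_of)
  qed
  have "fst \<in> sigma ?\<Omega> ?E \<rightarrow>\<^sub>M config_space" "snd \<in> sigma ?\<Omega> ?E \<rightarrow>\<^sub>M config_space"
    using cell_measurable E_\<Omega>
    by (auto intro!: measurable_config_spaceI simp: space_measure_of space_config_pair)
  then have "(\<lambda>p. (fst p, snd p)) \<in> sigma ?\<Omega> ?E \<rightarrow>\<^sub>M config_pair_space"
    by (rule measurable_Pair)
  \<comment> \<open>Measurability of the identity yields the harder inclusion of the two
    sigma-algebras.\<close>
  then have id: "(\<lambda>p. p) \<in> sigma ?\<Omega> ?E \<rightarrow>\<^sub>M config_pair_space"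
    by simp
  have sets: "sets config_pair_space = sigma_sets ?\<Omega> ?E"
  proof
    show "sets config_pair_space \<subseteq> sigma_sets ?\<Omega> ?E"
    proof
      fix A assume A: "A \<in> sets config_pair_space"
      then have "(\<lambda>p. p) -` A \<inter> space (sigma ?\<Omega> ?E) \<in> sets (sigma ?\<Omega> ?E)"
        by (rule measurable_sets[OF id])
      moreover have "(\<lambda>p. p) -` A \<inter> space (sigma ?\<Omega> ?E) = A"
        using sets.sets_into_space[OF A] E_\<Omega> by (auto simp: space_measure_of)
      ultimately show "A \<in> sigma_sets ?\<Omega> ?E"
        using E_\<Omega> by (simp add: sets_measure_of)
    qed
    have "{p \<in> ?\<Omega>. counts n p \<in> E} \<in> sets config_pair_space" for n E
      using measurable_sets[OF measurable_counts[of n], of E] by (simp add: vimage_def Int_def conj_commute)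
    then show "sigma_sets ?\<Omega> ?E \<subseteq> sets config_pair_space"
      by (intro sets.sigma_sets_subset) auto
  qed
  interpret P: prob_space P by fact
  interpret Q: prob_space Q by fact
  show ?thesis
  proof (rule measure_eqI_generator_eq[OF stable E_\<Omega>, where A = "\<lambda>_. ?\<Omega>"])
    fix X assume "X \<in> ?E"
    then obtain n E where "X = {p \<in> ?\<Omega>. counts n p \<in> E}"
      by auto
    then show "emeasure P X = emeasure Q X"
      using eq[of n E] by (simp add: P.emeasure_eq_measure Q.emeasure_eq_measure spaces)
  next
    have "?\<Omega> = {p \<in> ?\<Omega>. counts 0 p \<in> UNIV}"
      by simp
    then show "range (\<lambda>_::nat. ?\<Omega>) \<subseteq> ?E"
      by blast
  qed (simp_all add: P Q sets)
qed

section \<open>Poisson laws\<close>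

text \<open>Independence enters through the joint law of the cells of one grid, which feeds the
  discrete queue; the one-set formula serves the drift estimate, which needs counts on long
  intervals.\<close>

definition poisson_law :: "config measure \<Rightarrow> real \<Rightarrow> bool" where
  "poisson_law P r \<longleftrightarrow> prob_space P \<and> sets P = sets config_space \<and>
    (\<forall>B k. B \<in> sets borel \<longrightarrow> bounded B \<longrightarrow> measure P {x \<in> space P. num_points x B = k} =
      (r * measure lborel B) ^ k / fact k * exp (- (r * measure lborel B))) \<and>
    (\<forall>n zs. measure P {x \<in> space P. \<forall>k<ncells n. num_points x (cell n k) = zs k} =
      (\<Prod>k<ncells n. (r / 2 ^ n) ^ zs k / fact (zs k) * exp (- (r / 2 ^ n))))"

lemma measure_cell: "measure lborel (cell n k) = 1 / 2 ^ n"
  unfolding cell_def using pt_Suc[of n k] by (simp add: pt_mono)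

lemma disjoint_cells: "disjoint_family_on (cell n) I"
proof -
  have "cell n i \<inter> cell n j = {}" if "i < j" for i j
    using pt_mono[of "Suc i" j n] that by (auto simp: cell_def)
  then show ?thesis
    unfolding disjoint_family_on_def by (metis inf_commute linorder_neqE_nat)
qed

lemma poisson_law_distr:
  assumes "prob_space M" and X: "poisson_process M r X"
  shows "poisson_law (distr M config_space X) r"
proof -
  interpret prob_space M by fact
  have X_meas: "X \<in> M \<rightarrow>\<^sub>M config_space"
    and single: "\<And>B k. B \<in> sets borel \<Longrightarrow> bounded B \<Longrightarrow> measure M {\<omega> \<in> space M. num_points (X \<omega>) B = k} =
      (r * measure lborel B) ^ k / fact k * exp (- (r * measure lborel B))"
    and indep: "\<And>(I :: nat set) B. finite I \<Longrightarrow> (\<forall>i\<in>I. B i \<in> sets borel \<and> bounded (B i)) \<Longrightarrow>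
        disjoint_family_on B I \<Longrightarrow> indep_vars (\<lambda>_. count_space UNIV) (\<lambda>i \<omega>. num_points (X \<omega>) (B i)) I"
    using X unfolding poisson_process_def by auto
  let ?P = "distr M config_space X"
  have transfer: "measure ?P {x \<in> space ?P. Q x} = measure M {\<omega> \<in> space M. Q (X \<omega>)}"
    if "Measurable.pred config_space Q" for Q
  proof -
    have "{x \<in> space config_space. Q x} \<in> sets config_space"
      using that by (simp add: pred_def)
    then have "measure ?P {x \<in> space config_space. Q x} =
        measure M (X -` {x \<in> space config_space. Q x} \<inter> space M)"
      by (intro measure_distr X_meas)
    also have "X -` {x \<in> space config_space. Q x} \<inter> space M = {\<omega> \<in> space M. Q (X \<omega>)}"
      using measurable_space[OF X_meas] by auto
    finally show ?thesis
      by simp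
  qed
  have 1: "measure ?P {x \<in> space ?P. num_points x B = k} =
      (r * measure lborel B) ^ k / fact k * exp (- (r * measure lborel B))"
    if B: "B \<in> sets borel" "bounded B" for B k
  proof -
    have "Measurable.pred config_space (\<lambda>x. num_points x B = k)"
      by (intro pred_count_space_const1 measurable_num_points B)
    then show ?thesis
      using single[OF B] by (subst transfer) auto
  qed
  have 2: "measure ?P {x \<in> space ?P. \<forall>k<ncells n. num_points x (cell n k) = zs k} =
      (\<Prod>k<ncells n. (r / 2 ^ n) ^ zs k / fact (zs k) * exp (- (r / 2 ^ n)))" for n zs
  \<comment> \<open>Level 0 has no cells. The event is then the whole space and the product is
    empty, but an intersection over no cells would not describe that event.\<close>
  proof (cases "ncells n = 0")
    case True
    then show ?thesis
      using X_meas by (simp add: prob_space.prob_space[OF prob_space_distr] del: space_distr)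
  next
    case False
    have "Measurable.pred config_space (\<lambda>x. \<forall>k\<in>{..<ncells n}. num_points x (cell n k) = zs k)"
      by (intro pred_intros_finite pred_count_space_const1 measurable_num_points) auto
    then have "measure ?P {x \<in> space ?P. \<forall>k<ncells n. num_points x (cell n k) = zs k} =
        prob {\<omega> \<in> space M. \<forall>k<ncells n. num_points (X \<omega>) (cell n k) = zs k}"
      by (intro transfer) (simp add: Ball_def)
    also have "{\<omega> \<in> space M. \<forall>k<ncells n. num_points (X \<omega>) (cell n k) = zs k} =
        (\<Inter>k\<in>{..<ncells n}. (\<lambda>\<omega>. num_points (X \<omega>) (cell n k)) -` {zs k} \<inter> space M)"
      using False by auto
    also have "prob \<dots> = (\<Prod>k<ncells n. prob ((\<lambda>\<omega>. num_points (X \<omega>) (cell n k)) -` {zs k} \<inter> space M))"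
      using False by (intro indep_varsD[OF indep[of "{..<ncells n}" "cell n"]] disjoint_cells) auto
    also have "\<dots> = (\<Prod>k<ncells n. (r / 2 ^ n) ^ zs k / fact (zs k) * exp (- (r / 2 ^ n)))"
    proof (rule prod.cong[OF refl])
      fix k
      have "(\<lambda>\<omega>. num_points (X \<omega>) (cell n k)) -` {zs k} \<inter> space M =
          {\<omega> \<in> space M. num_points (X \<omega>) (cell n k) = zs k}"
        by auto
      then show "prob ((\<lambda>\<omega>. num_points (X \<omega>) (cell n k)) -` {zs k} \<inter> space M) =
          (r / 2 ^ n) ^ zs k / fact (zs k) * exp (- (r / 2 ^ n))"
        using single[of "cell n k" "zs k"] by (simp add: measure_cell)
    qed
    finally show ?thesis .
  qed
  show ?thesis
    unfolding poisson_law_def using 1 2 prob_space_distr[OF X_meas] by simp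
qed

lemma pmf_replicate_pmf:
  "pmf (replicate_pmf N p) xs = (if length xs = N then (\<Prod>k<N. pmf p (xs ! k)) else 0)"
proof (induction N arbitrary: xs)
  case 0
  then show ?case
    by (auto simp: indicator_def)
next
  case (Suc N)
  have *: "replicate_pmf (Suc N) p = map_pmf (\<lambda>(x, xs). x # xs) (pair_pmf p (replicate_pmf N p))"
    by (simp add: pair_pmf_def map_pmf_def bind_assoc_pmf bind_return_pmf)
  show ?case
  proof (cases xs)
    case Nil
    have "pmf (replicate_pmf (Suc N) p) [] = 0"
      unfolding pmf_eq_0_set_pmf by (auto simp: set_replicate_pmf)
    then show ?thesis
      using Nil by simp
  next
    case (Cons y ys)
    have "inj (\<lambda>(x, xs). x # xs :: 'a list)"
      by (auto simp: inj_on_def)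
    from pmf_map_inj'[OF this, of "pair_pmf p (replicate_pmf N p)" "(y, ys)"]
    have "pmf (replicate_pmf (Suc N) p) (y # ys) = pmf p y * pmf (replicate_pmf N p) ys"
      unfolding * by (simp add: pmf_pair)
    then show ?thesis
      unfolding Cons Suc.IH by (simp add: prod.lessThan_Suc_shift del: replicate_pmf.simps prod.lessThan_Suc)
  qed
qed

lemma map_replicate_pmf: "map_pmf (map f) (replicate_pmf N p) = replicate_pmf N (map_pmf f p)"
proof (induction N)
  case (Suc N)
  then show ?case
    by (simp add: map_bind_pmf bind_map_pmf flip: Suc)
qed simp

lemma counts_law:
  assumes P: "poisson_law P \<alpha>" and Q: "poisson_law Q \<beta>" and pos: "\<alpha> > 0" "\<beta> > 0"
  shows "distr (P \<Otimes>\<^sub>M Q) (count_space UNIV) (counts n) =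
    measure_pmf (replicate_pmf (ncells n) (pair_pmf (poisson_pmf (\<alpha> / 2 ^ n)) (poisson_pmf (\<beta> / 2 ^ n))))"
    (is "?L = measure_pmf ?R")
proof -
  interpret P: prob_space P using P by (simp add: poisson_law_def)
  interpret Q: prob_space Q using Q by (simp add: poisson_law_def)
  interpret PQ: pair_prob_space P Q ..
  have sets_PQ: "sets P = sets config_space" "sets Q = sets config_space"
    using P Q by (simp_all add: poisson_law_def)
  have [measurable]: "counts n \<in> P \<Otimes>\<^sub>M Q \<rightarrow>\<^sub>M count_space UNIV"
    by (subst measurable_cong_sets[OF sets_pair_measure_cong[OF sets_PQ] refl]) (rule measurable_counts)
  show ?thesis
  proof (rule measure_eqI_countable[where A = UNIV])
    fix zs :: "(nat \<times> nat) list"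
    have "emeasure ?L {zs} = emeasure (P \<Otimes>\<^sub>M Q) (counts n -` {zs} \<inter> space (P \<Otimes>\<^sub>M Q))"
      by (intro emeasure_distr) auto
    also have "\<dots> = ennreal (pmf ?R zs)"
    proof (cases "length zs = ncells n")
      case False
      then have "counts n -` {zs} = {}"
        by (auto simp: counts_eq_iff)
      then show ?thesis
        using False by (simp add: pmf_replicate_pmf)
    next
      case True
      let ?A = "{x \<in> space P. \<forall>k<ncells n. num_points x (cell n k) = fst (zs ! k)}"
      let ?B = "{x \<in> space Q. \<forall>k<ncells n. num_points x (cell n k) = snd (zs ! k)}"
      have cells: "{x \<in> space M. \<forall>k<ncells n. num_points x (cell n k) = f k} \<in> sets M"
        if "sets M = sets config_space" for M f
      proof -
        have "Measurable.pred config_space (\<lambda>x. \<forall>k\<in>{..<ncells n}. num_points x (cell n k) = f k)"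
          by (intro pred_intros_finite pred_count_space_const1 measurable_num_points) auto
        then show ?thesis
          using that sets_eq_imp_space_eq[OF that] by (simp add: pred_def Ball_def)
      qed
      have "counts n -` {zs} \<inter> space (P \<Otimes>\<^sub>M Q) = {p \<in> space (P \<Otimes>\<^sub>M Q). counts n p = zs}"
        by auto
      also have "\<dots> = ?A \<times> ?B"
        unfolding counts_eq_iff using True by (auto simp: space_pair_measure)
      finally have "emeasure (P \<Otimes>\<^sub>M Q) (counts n -` {zs} \<inter> space (P \<Otimes>\<^sub>M Q)) =
          emeasure P ?A * emeasure Q ?B"
        using Q.emeasure_pair_measure_Times[OF cells[OF sets_PQ(1)] cells[OF sets_PQ(2)],
          of "\<lambda>k. fst (zs ! k)" "\<lambda>k. snd (zs ! k)"] by (simp only:)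
      also have "\<dots> = ennreal (measure P ?A * measure Q ?B)"
        unfolding P.emeasure_eq_measure Q.emeasure_eq_measure by (rule ennreal_mult''[symmetric]) simp
      also have "\<dots> = ennreal (pmf ?R zs)"
      proof -
        have "measure P ?A = (\<Prod>k<ncells n. pmf (poisson_pmf (\<alpha> / 2 ^ n)) (fst (zs ! k)))"
          using P pos unfolding poisson_law_def by simp
        moreover have "measure Q ?B = (\<Prod>k<ncells n. pmf (poisson_pmf (\<beta> / 2 ^ n)) (snd (zs ! k)))"
          using Q pos unfolding poisson_law_def by simp
        moreover have "pmf (pair_pmf p q) z = pmf p (fst z) * pmf q (snd z)" for p q :: "nat pmf" and z
          by (cases z) (simp add: pmf_pair)
        then have "pmf ?R zs = (\<Prod>k<ncells n. pmf (poisson_pmf (\<alpha> / 2 ^ n)) (fst (zs ! k)) *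
            pmf (poisson_pmf (\<beta> / 2 ^ n)) (snd (zs ! k)))"
          using True by (simp add: pmf_replicate_pmf)
        ultimately show ?thesis
          by (simp only: prod.distrib)
      qed
      finally show ?thesis .
    qed
    also have "\<dots> = emeasure ?R {zs}"
      by (simp add: emeasure_pmf_single)
    finally show "emeasure ?L {zs} = emeasure ?R {zs}" .
  qed auto
qed

definition mark_pmf :: "real \<Rightarrow> real \<Rightarrow> nat \<Rightarrow> (nat \<times> nat) pmf" where
  "mark_pmf \<alpha> \<beta> n = map_pmf mark (pair_pmf (poisson_pmf (\<alpha> / 2 ^ n)) (poisson_pmf (\<beta> / 2 ^ n)))"

lemma measure_marks:
  assumes P: "poisson_law P \<alpha>" and Q: "poisson_law Q \<beta>" and pos: "\<alpha> > 0" "\<beta> > 0"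
  shows "measure (P \<Otimes>\<^sub>M Q) {p \<in> space (P \<Otimes>\<^sub>M Q). map mark (counts n p) \<in> E} =
    measure_pmf.prob (replicate_pmf (ncells n) (mark_pmf \<alpha> \<beta> n)) E"
proof -
  have sets_PQ: "sets P = sets config_space" "sets Q = sets config_space"
    using P Q by (simp_all add: poisson_law_def)
  have "counts n \<in> P \<Otimes>\<^sub>M Q \<rightarrow>\<^sub>M count_space UNIV"
    by (subst measurable_cong_sets[OF sets_pair_measure_cong[OF sets_PQ] refl]) (rule measurable_counts)
  then have "measure (distr (P \<Otimes>\<^sub>M Q) (count_space UNIV) (counts n)) (map mark -` E) =
      measure (P \<Otimes>\<^sub>M Q) (counts n -` (map mark -` E) \<inter> space (P \<Otimes>\<^sub>M Q))"
    by (intro measure_distr) auto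
  moreover have "counts n -` (map mark -` E) \<inter> space (P \<Otimes>\<^sub>M Q) =
      {p \<in> space (P \<Otimes>\<^sub>M Q). map mark (counts n p) \<in> E}"
    by auto
  ultimately show ?thesis
    by (simp add: counts_law[OF assms] mark_pmf_def flip: map_replicate_pmf)
qed

text \<open>The truncation to at most one point per cell keeps the ratio of arrival and service
  probabilities exactly equal to \<open>\<alpha> / \<beta>\<close>.\<close>

lemma mark_pmf_balance:
  assumes "\<alpha> > 0" "\<beta> > 0"
  shows "pmf (mark_pmf \<alpha> \<beta> n) (1, 0) = \<alpha> / \<beta> * pmf (mark_pmf \<alpha> \<beta> n) (0, 1)"
proof -
  have "mark -` {(1, 0)} = {(1, 0)}" "mark -` {(0, 1)} = {(0, 1)}"
    by (auto simp: mark_def split: if_splits)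
  then have eqs: "pmf (mark_pmf \<alpha> \<beta> n) (1, 0) = pmf (pair_pmf (poisson_pmf (\<alpha> / 2 ^ n)) (poisson_pmf (\<beta> / 2 ^ n))) (1, 0)"
    "pmf (mark_pmf \<alpha> \<beta> n) (0, 1) = pmf (pair_pmf (poisson_pmf (\<alpha> / 2 ^ n)) (poisson_pmf (\<beta> / 2 ^ n))) (0, 1)"
    unfolding mark_pmf_def pmf_map by (simp_all add: pmf.rep_eq)
  show ?thesis
    unfolding eqs using assms by (simp add: pmf_pair field_simps)
qed

section \<open>Almost sure properties of two independent Poisson processes\<close>

definition sparse_cells :: "nat \<Rightarrow> config \<times> config \<Rightarrow> bool" where
  "sparse_cells m p \<longleftrightarrow>
    (\<forall>k<ncells m. num_points (fst p) (cell m k) + num_points (snd p) (cell m k) \<le> 1)"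

text \<open>One property for two purposes: it makes the queue finite, and with \<open>c\<close> an
  initial queue length it tells how far back a chain must start in order to have forgotten that
  length by time \<open>-n\<close>.\<close>

definition drains :: "config \<Rightarrow> config \<Rightarrow> bool" where
  "drains A S \<longleftrightarrow> (\<forall>n c. \<exists>m. \<forall>r\<le>- real m.
    int (num_points A {r<..- real n}) - int (num_points S {r<..- real n}) \<le> - int c)"

lemma drains_bounded_queue:
  assumes lf: "locally_finite A" "locally_finite S" and "drains A S"
  shows "bounded_queue A S"
proof -
  obtain a s where counted_by: "counted_by A a" "counted_by S s"
    using counted_by_exists lf by metis
  obtain m where m: "\<And>r. r \<le> - real m \<Longrightarrow> int (num_points A {r<..0}) - int (num_points S {r<..0}) \<le> 0"
    using assms(3)[unfolded drains_def, rule_format, of 0 0] by auto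
  have "minorized (\<lambda>r. a r - s r)"
  proof (rule minorizedI)
    fix x
    \<comment> \<open>Far in the past the drift bounds \<open>a - s\<close> below by its value at 0;
      on the remaining bounded stretch the monotonicity of both counts does.\<close>
    have "min (a 0 - s 0) (a (- real m) - s x) \<le> a r - s r" if "r \<le> x" for r
    proof (cases "r \<le> - real m")
      case True
      then have "a 0 - s 0 \<le> a r - s r"
        using m[OF True] counted_byD[OF counted_by(1), of r 0] counted_byD[OF counted_by(2), of r 0] by simp
      then show ?thesis
        by simp
    next
      case False
      then have "a (- real m) - s x \<le> a r - s r"
        using counted_byD[OF counted_by(1), of "- real m" r] counted_byD[OF counted_by(2) that] by simp
      then show ?thesis
        by simp
    qed
    then show "\<exists>c. \<forall>r\<le>x. c \<le> a r - s r"
      by blast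
  qed
  then show ?thesis
    using minorized_iff_bounded_queue[OF counted_by] by simp
qed

lemma cell_cover: "t \<in> {pt m 0<..pt m j} \<Longrightarrow> \<exists>k<j. t \<in> cell m k"
proof (induction j)
  case (Suc j)
  then show ?case
    by (cases "t \<le> pt m j") (auto simp: cell_def less_Suc_eq)
qed simp

lemma sparse_cells_simple:
  assumes lf: "locally_finite A" "locally_finite S"
    and ev: "\<forall>\<^sub>F m in sequentially. sparse_cells m (A, S)"
  shows "A t \<le> 1" "S t \<le> 1"
proof -
  have "\<forall>\<^sub>F m in sequentially. \<bar>t\<bar> < real m"
    by real_asymp
  then obtain m where m: "sparse_cells m (A, S)" "\<bar>t\<bar> < real m"
    using eventually_happens[OF eventually_conj[OF ev]] by auto
  then have "t \<in> {pt m 0<..pt m (ncells m)}"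
    by (auto simp: pt_0 pt_ncells)
  then obtain k where k: "k < ncells m" "t \<in> cell m k"
    using cell_cover by blast
  then have "num_points A (cell m k) + num_points S (cell m k) \<le> 1"
    using m by (simp add: sparse_cells_def)
  then show "A t \<le> 1" "S t \<le> 1"
    using le_num_points[OF lf(1) cell_bounded k(2)] le_num_points[OF lf(2) cell_bounded k(2)] by auto
qed

lemma nn_integral_nat:
  fixes N :: "'a \<Rightarrow> nat"
  assumes N: "N \<in> M \<rightarrow>\<^sub>M count_space UNIV"
  shows "(\<integral>\<^sup>+x. f (N x) \<partial>M) = (\<Sum>k. f k * emeasure M {x \<in> space M. N x = k})"
proof -
  have sets: "{x \<in> space M. N x = k} \<in> sets M" for k
    using pred_count_space_const1[OF N, of k] by (simp add: pred_def)
  have "(\<integral>\<^sup>+x. f (N x) \<partial>M) = (\<integral>\<^sup>+x. (\<Sum>k. f k * indicator {x \<in> space M. N x = k} x) \<partial>M)"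
  proof (rule nn_integral_cong)
    fix x assume "x \<in> space M"
    have "(\<Sum>k. f k * indicator {x \<in> space M. N x = k} x) =
        (\<Sum>k\<in>{N x}. f k * indicator {x \<in> space M. N x = k} x)"
      by (rule suminf_finite) (auto simp: indicator_def)
    then show "f (N x) = (\<Sum>k. f k * indicator {x \<in> space M. N x = k} x)"
      using \<open>x \<in> space M\<close> by simp
  qed
  also have "\<dots> = (\<Sum>k. \<integral>\<^sup>+x. f k * indicator {x \<in> space M. N x = k} x \<partial>M)"
    using sets by (intro nn_integral_suminf) auto
  also have "\<dots> = (\<Sum>k. f k * emeasure M {x \<in> space M. N x = k})"
    using sets by (simp add: nn_integral_cmult_indicator)
  finally show ?thesis .
qed

lemma measurable_num_points_law:
  assumes "sets P = sets config_space" and "B \<in> sets borel" and "bounded B"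
  shows "(\<lambda>x. num_points x B) \<in> P \<rightarrow>\<^sub>M count_space UNIV"
  by (subst measurable_cong_sets[OF assms(1) refl]) (rule measurable_num_points[OF assms(2,3)])

lemma poisson_generating_function:
  assumes P: "poisson_law P r" and "r > 0" and B: "B \<in> sets borel" "bounded B" and "z \<ge> 0"
  shows "(\<integral>\<^sup>+x. ennreal (z ^ num_points x B) \<partial>P) = ennreal (exp (r * measure lborel B * (z - 1)))"
proof -
  interpret P: prob_space P using P by (simp add: poisson_law_def)
  let ?m = "r * measure lborel B"
  have "(\<integral>\<^sup>+x. ennreal (z ^ num_points x B) \<partial>P) =
      (\<Sum>k. ennreal (z ^ k) * emeasure P {x \<in> space P. num_points x B = k})"
    using P by (intro nn_integral_nat[where f = "\<lambda>k. ennreal (z ^ k)"] measurable_num_points_law B)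
      (simp add: poisson_law_def)
  also have "\<dots> = (\<Sum>k. ennreal ((z * ?m) ^ k /\<^sub>R fact k * exp (- ?m)))"
  proof (rule suminf_cong)
    fix k
    have "emeasure P {x \<in> space P. num_points x B = k} = ennreal (?m ^ k / fact k * exp (- ?m))"
      using P B by (simp add: P.emeasure_eq_measure poisson_law_def)
    then have "ennreal (z ^ k) * emeasure P {x \<in> space P. num_points x B = k} =
        ennreal (z ^ k * (?m ^ k / fact k * exp (- ?m)))"
      using \<open>z \<ge> 0\<close> by (simp only: ennreal_mult' zero_le_power)
    also have "z ^ k * (?m ^ k / fact k * exp (- ?m)) = (z * ?m) ^ k /\<^sub>R fact k * exp (- ?m)"
      by (simp add: power_mult_distrib field_simps)
    finally show "ennreal (z ^ k) * emeasure P {x \<in> space P. num_points x B = k} =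
        ennreal ((z * ?m) ^ k /\<^sub>R fact k * exp (- ?m))" .
  qed
  also have "\<dots> = ennreal (exp (z * ?m) * exp (- ?m))"
    using \<open>r > 0\<close> \<open>z \<ge> 0\<close>
    by (intro suminf_ennreal_eq sums_mult2 exp_converges) (simp add: measure_nonneg)
  also have "exp (z * ?m) * exp (- ?m) = exp (?m * (z - 1))"
    by (simp add: exp_add[symmetric] algebra_simps)
  finally show ?thesis .
qed

section \<open>Crowded cells and negative drift for two independent Poisson laws\<close>

locale queue_laws =
  fixes P Q :: "config measure" and \<alpha> \<beta> :: real
  assumes P: "poisson_law P \<alpha>" and Q: "poisson_law Q \<beta>" and \<alpha>: "0 < \<alpha>" and \<alpha>_less: "\<alpha> < \<beta>"
begin

sublocale P: prob_space P
  using P by (simp add: poisson_law_def)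

sublocale Q: prob_space Q
  using Q by (simp add: poisson_law_def)

sublocale PQ: pair_prob_space P Q ..

lemma \<beta>: "0 < \<beta>"
  using \<alpha> \<alpha>_less by simp

lemma sets_P: "sets P = sets config_space" and sets_Q: "sets Q = sets config_space"
  using P Q by (simp_all add: poisson_law_def)

lemma sets_PQ: "sets (P \<Otimes>\<^sub>M Q) = sets config_pair_space"
  by (intro sets_pair_measure_cong sets_P sets_Q)

lemma space_PQ: "space (P \<Otimes>\<^sub>M Q) = space config_pair_space"
  by (rule sets_eq_imp_space_eq[OF sets_PQ])

lemma measurable_PQ: "f \<in> config_pair_space \<rightarrow>\<^sub>M N \<Longrightarrow> f \<in> P \<Otimes>\<^sub>M Q \<rightarrow>\<^sub>M N"
  by (subst measurable_cong_sets[OF sets_PQ refl])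

lemma counts_event: "{p \<in> space (P \<Otimes>\<^sub>M Q). counts n p \<in> E} \<in> PQ.events"
  using measurable_sets[OF measurable_PQ[OF measurable_counts[of n]], of E]
  by (simp add: vimage_def Int_def conj_commute)

lemma measurable_num_fst:
  "B \<in> sets borel \<Longrightarrow> bounded B \<Longrightarrow> (\<lambda>p. num_points (fst p) B) \<in> P \<Otimes>\<^sub>M Q \<rightarrow>\<^sub>M count_space UNIV"
  by (intro measurable_compose[OF measurable_fst] measurable_num_points_law sets_P)

lemma measurable_num_snd:
  "B \<in> sets borel \<Longrightarrow> bounded B \<Longrightarrow> (\<lambda>p. num_points (snd p) B) \<in> P \<Otimes>\<^sub>M Q \<rightarrow>\<^sub>M count_space UNIV"
  by (intro measurable_compose[OF measurable_snd] measurable_num_points_law sets_Q)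

text \<open>With \<open>h\<close> the mean number of points in the cell, the probability is
  \<open>1 - exp (- h) * (1 + h)\<close>, and \<open>1 - h \<le> exp (- h)\<close> bounds this by
  the square of \<open>h\<close>.\<close>

lemma prob_crowded_cell:
  "PQ.prob {p \<in> space (P \<Otimes>\<^sub>M Q). 1 < num_points (fst p) (cell n k) + num_points (snd p) (cell n k)}
    \<le> ((\<alpha> + \<beta>) / 2 ^ n)\<^sup>2" (is "PQ.prob ?bad \<le> _")
proof -
  define A where "A i = {x \<in> space P. num_points x (cell n k) = i}" for i
  define B where "B i = {x \<in> space Q. num_points x (cell n k) = i}" for i
  have A: "A i \<in> P.events" and B: "B i \<in> Q.events" for i
    using pred_count_space_const1[OF measurable_num_points_law[OF sets_P, of "cell n k"], of i]
      pred_count_space_const1[OF measurable_num_points_law[OF sets_Q, of "cell n k"], of i]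
    by (simp_all add: A_def B_def pred_def)
  have rect: "PQ.prob (A i \<times> B j) = P.prob (A i) * Q.prob (B j)" for i j
    using Q.emeasure_pair_measure_Times[OF A[of i] B[of j]]
    unfolding PQ.emeasure_eq_measure P.emeasure_eq_measure Q.emeasure_eq_measure
      ennreal_mult''[OF measure_nonneg, symmetric] by simp
  define x y where "x = \<alpha> / 2 ^ n" and "y = \<beta> / 2 ^ n"
  have pA: "P.prob (A i) = x ^ i / fact i * exp (- x)" and pB: "Q.prob (B i) = y ^ i / fact i * exp (- y)" for i
    using P Q unfolding poisson_law_def A_def B_def x_def y_def by (simp_all add: measure_cell)
  let ?good = "A 0 \<times> B 0 \<union> A 1 \<times> B 0 \<union> A 0 \<times> B 1"
  have good: "?good \<in> PQ.events"
    using A B by auto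
  have "PQ.prob ?good = PQ.prob (A 0 \<times> B 0) + PQ.prob (A 1 \<times> B 0) + PQ.prob (A 0 \<times> B 1)"
  proof -
    have AB: "A i \<times> B j \<in> PQ.events" for i j
      using A B by (intro pair_measureI)
    have "(A 0 \<times> B 0) \<inter> (A 1 \<times> B 0) = {}" "(A 0 \<times> B 0 \<union> A 1 \<times> B 0) \<inter> (A 0 \<times> B 1) = {}"
      by (auto simp: A_def B_def)
    then show ?thesis
      by (simp only: PQ.finite_measure_Union AB sets.Un)
  qed
  also have "\<dots> = exp (- (x + y)) * (1 + (x + y))"
    unfolding rect pA pB minus_add_distrib exp_add by (simp add: algebra_simps)
  also have "\<dots> \<ge> (1 - (x + y)) * (1 + (x + y))"
  proof (rule mult_right_mono)
    show "1 - (x + y) \<le> exp (- (x + y))"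
      using exp_ge_add_one_self[of "- (x + y)"] by linarith
    show "0 \<le> 1 + (x + y)"
      using \<alpha> \<beta> by (simp add: x_def y_def)
  qed
  finally have "PQ.prob ?good \<ge> 1 - (x + y)\<^sup>2"
    by (simp add: power2_eq_square algebra_simps)
  moreover have "?bad \<subseteq> space (P \<Otimes>\<^sub>M Q) - ?good"
    by (auto simp: A_def B_def)
  then have "PQ.prob ?bad \<le> PQ.prob (space (P \<Otimes>\<^sub>M Q) - ?good)"
    using good by (intro PQ.finite_measure_mono) auto
  ultimately show ?thesis
    using PQ.prob_compl[OF good] by (simp add: x_def y_def add_divide_distrib)
qed

text \<open>There are \<open>2 * m * 2 ^ m\<close> cells with failure probability of order
  \<open>1 / 4 ^ m\<close> each, so the union bound is of order \<open>m / 2 ^ m\<close> and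
  Borel-Cantelli applies.\<close>

lemma AE_sparse_cells: "AE p in P \<Otimes>\<^sub>M Q. \<forall>\<^sub>F m in sequentially. sparse_cells m p"
proof -
  define C where "C m k = {p \<in> space (P \<Otimes>\<^sub>M Q).
    1 < num_points (fst p) (cell m k) + num_points (snd p) (cell m k)}" for m k
  have C: "C m k \<in> PQ.events" for m k
  proof -
    note [measurable] = measurable_num_fst[OF cell_sets[of m k] cell_bounded]
      measurable_num_snd[OF cell_sets[of m k] cell_bounded]
    have "(\<lambda>p. num_points (fst p) (cell m k) + num_points (snd p) (cell m k)) \<in> P \<Otimes>\<^sub>M Q \<rightarrow>\<^sub>M count_space UNIV"
      by measurable
    then have "Measurable.pred (P \<Otimes>\<^sub>M Q) (\<lambda>p. 1 < num_points (fst p) (cell m k) + num_points (snd p) (cell m k))"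
      by (intro pred_less_nat) auto
    then show ?thesis
      by (simp add: C_def pred_def)
  qed
  have bad: "(\<Union>k<ncells m. C m k) \<in> PQ.events" for m
    using C by auto
  have "PQ.prob (\<Union>k<ncells m. C m k) \<le> 2 * (\<alpha> + \<beta>)\<^sup>2 * ((1 / 2) ^ m * real m)" for m
  proof -
    have "PQ.prob (\<Union>k<ncells m. C m k) \<le> (\<Sum>k<ncells m. PQ.prob (C m k))"
      using C by (intro PQ.finite_measure_subadditive_finite) auto
    also have "\<dots> \<le> (\<Sum>k<ncells m. ((\<alpha> + \<beta>) / 2 ^ m)\<^sup>2)"
      unfolding C_def by (intro sum_mono prob_crowded_cell)
    also have "\<dots> = 2 * (\<alpha> + \<beta>)\<^sup>2 * ((1 / 2) ^ m * real m)"
      by (simp add: ncells_def power2_eq_square field_simps)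
    finally show ?thesis .
  qed
  moreover have "summable (\<lambda>m. 2 * (\<alpha> + \<beta>)\<^sup>2 * ((1 / 2) ^ m * real m))"
    using geometric_sums_times_n[of "1 / 2 :: real"] by (intro summable_mult) (auto simp: sums_iff)
  ultimately have "summable (\<lambda>m. PQ.prob (\<Union>k<ncells m. C m k))"
    by (elim summable_comparison_test'[where N = 0]) simp
  then have "AE p in P \<Otimes>\<^sub>M Q. \<forall>\<^sub>F m in sequentially. p \<in> space (P \<Otimes>\<^sub>M Q) - (\<Union>k<ncells m. C m k)"
    using bad by (intro borel_cantelli_AE1) (auto simp: less_top[symmetric])
  then show ?thesis
    by eventually_elim (auto elim!: eventually_mono simp: C_def sparse_cells_def not_less)
qed

lemma nn_integral_product:
  assumes f: "f \<in> borel_measurable P" and g: "g \<in> borel_measurable Q"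
  shows "(\<integral>\<^sup>+p. f (fst p) * g (snd p) \<partial>(P \<Otimes>\<^sub>M Q)) = (\<integral>\<^sup>+x. f x \<partial>P) * (\<integral>\<^sup>+y. g y \<partial>Q)"
proof -
  have [measurable]: "f \<in> borel_measurable P" "g \<in> borel_measurable Q"
    by fact+
  have "(\<integral>\<^sup>+p. f (fst p) * g (snd p) \<partial>(P \<Otimes>\<^sub>M Q)) = (\<integral>\<^sup>+x. \<integral>\<^sup>+y. f x * g y \<partial>Q \<partial>P)"
    by (subst Q.nn_integral_fst[symmetric]) simp_all
  also have "\<dots> = (\<integral>\<^sup>+x. f x * (\<integral>\<^sup>+y. g y \<partial>Q) \<partial>P)"
    by (simp add: nn_integral_cmult)
  also have "\<dots> = (\<integral>\<^sup>+x. f x \<partial>P) * (\<integral>\<^sup>+y. g y \<partial>Q)"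
    by (simp add: nn_integral_multc)
  finally show ?thesis .
qed

text \<open>A Chernoff bound, with any base \<open>z\<close> such that \<open>1 < z < \<beta> / \<alpha>\<close>.\<close>

lemma AE_drift:
  "AE p in P \<Otimes>\<^sub>M Q. \<forall>\<^sub>F j in sequentially.
    int (num_points (fst p) {- real n - real j - 1<..- real n}) -
    int (num_points (snd p) {- real n - real j<..- real n}) \<le> - int c"
proof -
  have "1 < \<beta> / \<alpha>"
    using \<alpha> \<alpha>_less by simp
  then obtain z where z: "1 < z" "z < \<beta> / \<alpha>"
    using dense by blast
  \<comment> \<open>The exponential rate per unit of time:
    \<open>\<alpha> * (z - 1) + \<beta> * (1 / z - 1) = - \<delta>\<close>.\<close>
  define \<delta> where "\<delta> = (z - 1) * (\<beta> / z - \<alpha>)"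
  have "\<delta> > 0"
    unfolding \<delta>_def
  proof (rule mult_pos_pos)
    show "0 < \<beta> / z - \<alpha>"
      using z \<alpha> by (simp add: field_simps)
  qed (use z in simp)
  \<comment> \<open>Arrivals are counted over one more time unit than services, so that the integer
    \<open>j\<close> controls all real starts between \<open>-n - j - 1\<close> and
    \<open>-n - j\<close>. This costs only a constant factor.\<close>
  define I J where "I j = {- real n - real j - 1<..- real n}" and "J j = {- real n - real j<..- real n}" for j
  define bad where "bad j = {p \<in> space (P \<Otimes>\<^sub>M Q). num_points (snd p) (J j) < num_points (fst p) (I j) + c}" for j
  have IJ: "I j \<in> sets borel" "bounded (I j)" "J j \<in> sets borel" "bounded (J j)" for j
    by (auto simp: I_def J_def)
  have meas: "Measurable.pred (P \<Otimes>\<^sub>M Q) (\<lambda>p. num_points (snd p) (J j) < num_points (fst p) (I j) + c)" for j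
    by (intro pred_less_nat measurable_num_snd measurable_compose[OF measurable_num_fst] IJ) auto
  then have bad: "bad j \<in> PQ.events" for j
    by (simp add: bad_def pred_def)
  have "PQ.prob (bad j) \<le> z ^ c * exp (\<alpha> * (z - 1)) * exp (- \<delta>) ^ j" for j
  proof -
    define f where "f x = ennreal (z ^ num_points x (I j))" for x
    define g where "g x = ennreal ((1 / z) ^ num_points x (J j))" for x
    have f: "f \<in> borel_measurable P" and g: "g \<in> borel_measurable Q"
      unfolding f_def g_def
      by (intro measurable_compose[OF measurable_num_points_law[OF _ IJ(1,2)[of j]]]
          measurable_compose[OF measurable_num_points_law[OF _ IJ(3,4)[of j]]] sets_P sets_Q; simp)+
    have fg: "(\<lambda>p. f (fst p) * g (snd p)) \<in> borel_measurable (P \<Otimes>\<^sub>M Q)"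
      using f g by measurable
    \<comment> \<open>On the bad event the power of \<open>z\<close> with exponent \<open>c\<close>
      plus arrivals minus services is at least 1; Markov's inequality and independence then give a
      product of two generating functions.\<close>
    have "emeasure (P \<Otimes>\<^sub>M Q) (bad j) \<le>
        emeasure (P \<Otimes>\<^sub>M Q) {p \<in> space (P \<Otimes>\<^sub>M Q). 1 \<le> ennreal (z ^ c) * (f (fst p) * g (snd p))}"
    proof (rule emeasure_mono)
      show "bad j \<subseteq> {p \<in> space (P \<Otimes>\<^sub>M Q). 1 \<le> ennreal (z ^ c) * (f (fst p) * g (snd p))}"
      proof safe
        fix A S assume "(A, S) \<in> bad j"
        then have less: "num_points S (J j) < num_points A (I j) + c" "(A, S) \<in> space (P \<Otimes>\<^sub>M Q)"
          by (auto simp: bad_def)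
        then show "(A, S) \<in> space (P \<Otimes>\<^sub>M Q)"
          by simp
        have "z ^ num_points S (J j) \<le> z ^ (num_points A (I j) + c)"
          using less z by (intro power_increasing) auto
        then have "1 \<le> z ^ c * (z ^ num_points A (I j) * (1 / z) ^ num_points S (J j))"
          using z by (simp add: power_add field_simps)
        then have "ennreal 1 \<le> ennreal (z ^ c * (z ^ num_points A (I j) * (1 / z) ^ num_points S (J j)))"
          by (rule ennreal_leI)
        then show "1 \<le> ennreal (z ^ c) * (f (fst (A, S)) * g (snd (A, S)))"
          using z by (simp add: f_def g_def ennreal_mult)
      qed
      have "(\<lambda>p. ennreal (z ^ c) * (f (fst p) * g (snd p))) \<in> borel_measurable (P \<Otimes>\<^sub>M Q)"
        using fg by measurable
      then show "{p \<in> space (P \<Otimes>\<^sub>M Q). 1 \<le> ennreal (z ^ c) * (f (fst p) * g (snd p))} \<in> PQ.events"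
        by measurable
    qed
    also have "\<dots> \<le> ennreal (z ^ c) * (\<integral>\<^sup>+p. f (fst p) * g (snd p) * indicator (space (P \<Otimes>\<^sub>M Q)) p \<partial>(P \<Otimes>\<^sub>M Q))"
      using fg by (intro nn_integral_Markov_inequality) auto
    also have "(\<integral>\<^sup>+p. f (fst p) * g (snd p) * indicator (space (P \<Otimes>\<^sub>M Q)) p \<partial>(P \<Otimes>\<^sub>M Q)) =
        (\<integral>\<^sup>+p. f (fst p) * g (snd p) \<partial>(P \<Otimes>\<^sub>M Q))"
      by (intro nn_integral_cong) simp
    also have "\<dots> = ennreal (exp (\<alpha> * (real j + 1) * (z - 1))) * ennreal (exp (\<beta> * real j * (1 / z - 1)))"
      unfolding nn_integral_product[OF f g] unfolding f_def g_def
      using z by (subst poisson_generating_function[OF P \<alpha> IJ(1,2)], simp,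
        subst poisson_generating_function[OF Q \<beta> IJ(3,4)], simp, simp add: I_def J_def)
    also have "\<dots> = ennreal (exp (\<alpha> * (z - 1)) * exp (- \<delta>) ^ j)"
    proof -
      have "\<alpha> * (real j + 1) * (z - 1) + \<beta> * real j * (1 / z - 1) = \<alpha> * (z - 1) + real j * - \<delta>"
        using z unfolding \<delta>_def by (simp add: field_simps)
      then have "exp (\<alpha> * (real j + 1) * (z - 1)) * exp (\<beta> * real j * (1 / z - 1)) =
          exp (\<alpha> * (z - 1)) * exp (- \<delta>) ^ j"
        by (simp only: exp_add[symmetric] exp_of_nat_mult[symmetric])
      then show ?thesis
        by (simp only: ennreal_mult'[symmetric] exp_ge_zero)
    qed
    finally have "ennreal (PQ.prob (bad j)) \<le> ennreal (z ^ c * (exp (\<alpha> * (z - 1)) * exp (- \<delta>) ^ j))"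
      using z by (simp add: PQ.emeasure_eq_measure ennreal_mult')
    then show ?thesis
      using z by (subst (asm) ennreal_le_iff) (auto simp: mult.assoc)
  qed
  moreover have "summable (\<lambda>j. z ^ c * exp (\<alpha> * (z - 1)) * exp (- \<delta>) ^ j)"
    using \<open>\<delta> > 0\<close> by (intro summable_mult summable_geometric) auto
  ultimately have "summable (\<lambda>j. PQ.prob (bad j))"
    by (elim summable_comparison_test'[where N = 0]) simp
  then have "AE p in P \<Otimes>\<^sub>M Q. \<forall>\<^sub>F j in sequentially. p \<in> space (P \<Otimes>\<^sub>M Q) - bad j"
    using bad by (intro borel_cantelli_AE1) (auto simp: less_top[symmetric])
  then show ?thesis
    unfolding bad_def I_def J_def
    by eventually_elim (auto elim!: eventually_mono simp: not_less)
qed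

lemma AE_drains: "AE p in P \<Otimes>\<^sub>M Q. drains (fst p) (snd p)"
proof -
  have "AE p in P \<Otimes>\<^sub>M Q. \<forall>n c. \<forall>\<^sub>F j in sequentially.
    int (num_points (fst p) {- real n - real j - 1<..- real n}) -
    int (num_points (snd p) {- real n - real j<..- real n}) \<le> - int c"
    unfolding AE_all_countable by (intro allI AE_drift)
  then show ?thesis
    using AE_space
  proof eventually_elim
    case (elim p)
    have lf: "locally_finite (fst p)" "locally_finite (snd p)"
      using elim(2) by (simp_all add: space_PQ space_config_pair)
    show ?case
      unfolding drains_def
    proof (intro allI)
      fix n c
      obtain j0 where j0: "\<And>j. j \<ge> j0 \<Longrightarrow> int (num_points (fst p) {- real n - real j - 1<..- real n}) -
          int (num_points (snd p) {- real n - real j<..- real n}) \<le> - int c"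
        using elim(1) unfolding eventually_sequentially by blast
      have "int (num_points (fst p) {r<..- real n}) - int (num_points (snd p) {r<..- real n}) \<le> - int c"
        if r: "r \<le> - real (n + j0)" for r
      proof -
        define j where "j = nat \<lfloor>- real n - r\<rfloor>"
        have j: "real j \<le> - real n - r" "- real n - r < real j + 1" "j \<ge> j0"
          using r unfolding j_def by (auto simp: le_nat_iff le_floor_iff)
        have "num_points (fst p) {r<..- real n} \<le> num_points (fst p) {- real n - real j - 1<..- real n}"
          using num_points_Ioc[OF lf(1), of "- real n - real j - 1" r "- real n"] j by simp
        moreover have "num_points (snd p) {- real n - real j<..- real n} \<le> num_points (snd p) {r<..- real n}"
          using num_points_Ioc[OF lf(2), of r "- real n - real j" "- real n"] j by simp
        ultimately show ?thesis
          using j0[OF j(3)] by linarith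
      qed
      then show "\<exists>m. \<forall>r\<le>- real m. int (num_points (fst p) {r<..- real n}) -
          int (num_points (snd p) {r<..- real n}) \<le> - int c"
        by blast
    qed
  qed
qed

end

section \<open>Burke's theorem\<close>

definition queue_output :: "config \<times> config \<Rightarrow> config \<times> config" where
  "queue_output p = (departures (fst p) (snd p), dual_services (fst p) (snd p))"

lemma measurable_queue_output: "queue_output \<in> config_pair_space \<rightarrow>\<^sub>M config_pair_space"
  unfolding queue_output_def dual_services_def
  by (intro measurable_Pair measurable_departures measurable_config_add measurable_unused_services
      measurable_fst measurable_snd)

lemma (in prob_space) prob_tendsto_AE:
  assumes X: "\<And>m. X m \<in> events" and Y: "Y \<in> events"
    and AE: "AE x in M. \<forall>\<^sub>F m in sequentially. x \<in> X m \<longleftrightarrow> x \<in> Y"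
  shows "(\<lambda>m. prob (X m)) \<longlonglongrightarrow> prob Y"
proof -
  have "(\<lambda>m. \<integral>x. indicator (X m) x \<partial>M) \<longlonglongrightarrow> (\<integral>x. indicator Y x \<partial>M :: real)"
  proof (rule integral_dominated_convergence[where w = "\<lambda>_. 1"])
    show "AE x in M. (\<lambda>m. indicator (X m) x :: real) \<longlonglongrightarrow> indicator Y x"
      using AE
    proof eventually_elim
      case (elim x)
      then show ?case
        by (intro tendsto_eventually) (auto elim!: eventually_mono simp: indicator_def)
    qed
  qed (use X Y in \<open>auto simp: indicator_def\<close>)
  then show ?thesis
    using X Y by simp
qed

context queue_laws
begin

text \<open>For every mesh, stationarity makes the average of \<open>a q m\<close> over
  \<open>q\<close> exactly \<open>b m\<close>, with a geometric law \<open>G\<close> that does not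
  depend on \<open>m\<close>. As \<open>m\<close> grows, \<open>a q m\<close> tends for each
  \<open>q\<close> to the probability for the true output and \<open>b m\<close> to that for the
  input; dominated convergence carries the first limit through the average.\<close>

lemma output_counts_law:
  "PQ.prob {p \<in> space (P \<Otimes>\<^sub>M Q). counts n (queue_output p) \<in> E} =
    PQ.prob {p \<in> space (P \<Otimes>\<^sub>M Q). counts n p \<in> E}"
proof -
  let ?W = "space (P \<Otimes>\<^sub>M Q)"
  define G where "G = geometric_pmf (1 - \<alpha> / \<beta>)"
  define R where "R m = replicate_pmf (ncells m) (mark_pmf \<alpha> \<beta> m)" for m
  define a where "a q m = PQ.prob {p \<in> ?W. coarse n m (snd (run q (map mark (counts m p)))) \<in> E}" for q m
  define b where "b m = PQ.prob {p \<in> ?W. coarse n m (map mark (counts m p)) \<in> E}" for m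
  have stationary: "map_pmf qstep (pair_pmf G (mark_pmf \<alpha> \<beta> m)) = pair_pmf G (mark_pmf \<alpha> \<beta> m)" for m
    unfolding G_def using \<alpha> \<beta> \<alpha>_less by (intro qstep_pmf mark_pmf_balance) auto
  have a: "a q m = measure_pmf.prob (R m) {ms. coarse n m (snd (run q ms)) \<in> E}" for q m
    using measure_marks[OF P Q \<alpha> \<beta>, of m "{ms. coarse n m (snd (run q ms)) \<in> E}"]
    by (simp add: a_def R_def)
  have b: "b m = measure_pmf.prob (R m) {ms. coarse n m ms \<in> E}" for m
    using measure_marks[OF P Q \<alpha> \<beta>, of m "{ms. coarse n m ms \<in> E}"]
    by (simp add: b_def R_def)
  have ab: "measure_pmf.expectation G (\<lambda>q. a q m) = b m" for m
    using expectation_run[OF stationary[of m], where N = "ncells m" and E = "{ms. coarse n m ms \<in> E}"]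
    by (simp add: a b R_def)
  have event: "{p \<in> ?W. f (counts m p) \<in> E} \<in> PQ.events" for f m
    using counts_event[of m "f -` E"] by simp
  have output_event: "{p \<in> ?W. counts n (queue_output p) \<in> E} \<in> PQ.events"
    using measurable_sets[OF measurable_PQ[OF measurable_compose[OF measurable_queue_output measurable_counts[of n]]], of E]
    by (simp add: vimage_def Int_def conj_commute)
  have lim_a: "(\<lambda>m. a q m) \<longlonglongrightarrow> PQ.prob {p \<in> ?W. counts n (queue_output p) \<in> E}" for q
    unfolding a_def
  proof (rule PQ.prob_tendsto_AE)
    show "AE p in P \<Otimes>\<^sub>M Q. \<forall>\<^sub>F m in sequentially.
        p \<in> {p \<in> ?W. coarse n m (snd (run q (map mark (counts m p)))) \<in> E} \<longleftrightarrow>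
        p \<in> {p \<in> ?W. counts n (queue_output p) \<in> E}"
      using AE_drains AE_sparse_cells AE_space
    proof eventually_elim
      case (elim p)
      define A S where "A = fst p" and "S = snd p"
      have p: "p = (A, S)"
        by (simp add: A_def S_def)
      have lf: "locally_finite A" "locally_finite S"
        using elim(3) by (simp_all add: p space_PQ space_config_pair)
      have dr: "drains A S"
        using elim(1) by (simp add: p)
      have simple: "S t \<le> 1" for t
        using sparse_cells_simple[OF lf] elim(2) by (simp add: p)
      \<comment> \<open>How far back the start must lie depends on the configuration and on
        \<open>q\<close>, so the convergence is obtained for one \<open>q\<close> at a time.\<close>
      obtain m0 where m0: "\<And>r. r \<le> - real m0 \<Longrightarrow>
          int (num_points A {r<..- real n}) - int (num_points S {r<..- real n}) \<le> - int q"
        using dr unfolding drains_def by blast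
      have "\<forall>\<^sub>F m in sequentially. m0 \<le> m" "\<forall>\<^sub>F m in sequentially. n \<le> m"
        by (rule eventually_ge_at_top)+
      with elim(2) show ?case
      proof eventually_elim
        case (elim m)
        have "coarse n m (snd (run q (map mark (counts m (A, S))))) =
            counts n (departures A S, dual_services A S)"
          using elim m0
          by (intro coupled_run lf simple drains_bounded_queue dr) (auto simp: sparse_cells_def p)
        then show ?case
          by (simp add: p queue_output_def)
      qed
    qed
  qed (intro event[of "\<lambda>xs. coarse n m (snd (run q (map mark xs)))" for m] output_event)+
  have lim_b: "b \<longlonglongrightarrow> PQ.prob {p \<in> ?W. counts n p \<in> E}"
    unfolding b_def
  proof (rule PQ.prob_tendsto_AE)
    show "AE p in P \<Otimes>\<^sub>M Q. \<forall>\<^sub>F m in sequentially.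
        p \<in> {p \<in> ?W. coarse n m (map mark (counts m p)) \<in> E} \<longleftrightarrow> p \<in> {p \<in> ?W. counts n p \<in> E}"
      using AE_sparse_cells AE_space
    proof eventually_elim
      case (elim p)
      have lf: "locally_finite (fst p)" "locally_finite (snd p)"
        using elim(2) by (simp_all add: space_PQ space_config_pair)
      have "\<forall>\<^sub>F m in sequentially. n \<le> m"
        by (rule eventually_ge_at_top)
      with elim(1) show ?case
      proof eventually_elim
        case (elim m)
        have "map mark (counts m p) = counts m p"
          using elim(1) by (auto simp: counts_def mark_def sparse_cells_def)
        then show ?case
          using coarse_counts[OF elim(2) lf] by simp
      qed
    qed
  qed (intro event[of "\<lambda>xs. coarse n m (map mark xs)" for m] counts_event)+
  have "(\<lambda>m. measure_pmf.expectation G (\<lambda>q. a q m)) \<longlonglongrightarrow>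
      measure_pmf.expectation G (\<lambda>q. PQ.prob {p \<in> ?W. counts n (queue_output p) \<in> E})"
  proof (rule integral_dominated_convergence[where w = "\<lambda>_. 1"])
    show "AE q in G. (\<lambda>m. a q m) \<longlonglongrightarrow> PQ.prob {p \<in> ?W. counts n (queue_output p) \<in> E}"
      using lim_a by simp
    show "AE q in G. norm (a q m) \<le> 1" for m
      by (simp add: a_def)
  qed auto
  then have "b \<longlonglongrightarrow> PQ.prob {p \<in> ?W. counts n (queue_output p) \<in> E}"
    by (simp add: ab)
  with lim_b show ?thesis
    by (rule LIMSEQ_unique[symmetric])
qed

theorem burke: "distr (P \<Otimes>\<^sub>M Q) config_pair_space queue_output = P \<Otimes>\<^sub>M Q"
proof (rule law_eqI)
  have queue_output: "queue_output \<in> P \<Otimes>\<^sub>M Q \<rightarrow>\<^sub>M config_pair_space"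
    by (rule measurable_PQ[OF measurable_queue_output])
  show "prob_space (distr (P \<Otimes>\<^sub>M Q) config_pair_space queue_output)"
    by (rule PQ.prob_space_distr[OF queue_output])
  fix n E
  let ?D = "distr (P \<Otimes>\<^sub>M Q) config_pair_space queue_output"
  have "{p \<in> space config_pair_space. counts n p \<in> E} \<in> sets config_pair_space"
    using counts_event[of n E] by (simp only: space_PQ sets_PQ)
  then have "measure ?D {p \<in> space ?D. counts n p \<in> E} =
      PQ.prob (queue_output -` {p \<in> space config_pair_space. counts n p \<in> E} \<inter> space (P \<Otimes>\<^sub>M Q))"
    by (simp add: measure_distr[OF queue_output])
  also have "queue_output -` {p \<in> space config_pair_space. counts n p \<in> E} \<inter> space (P \<Otimes>\<^sub>M Q) =
      {p \<in> space (P \<Otimes>\<^sub>M Q). counts n (queue_output p) \<in> E}"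
    using measurable_space[OF queue_output] by auto
  finally show "measure ?D {p \<in> space ?D. counts n p \<in> E} =
      PQ.prob {p \<in> space (P \<Otimes>\<^sub>M Q). counts n p \<in> E}"
    by (simp only: output_counts_law)
qed (simp_all add: sets_PQ PQ.prob_space_axioms)

end

section \<open>The fixed point\<close>

definition queue_map :: "config \<times> config \<Rightarrow> config \<times> config" where
  "queue_map p = (departures (fst p) (snd p), unused_services (fst p) (snd p))"

lemma measurable_queue_map: "queue_map \<in> config_pair_space \<rightarrow>\<^sub>M config_pair_space"
  unfolding queue_map_def
  by (intro measurable_Pair measurable_departures measurable_unused_services measurable_fst measurable_snd)

lemma measurable_two_type_departures:
  "(\<lambda>w. two_type_departures (fst w) (snd w)) \<in>
    config_pair_space \<Otimes>\<^sub>M config_space \<rightarrow>\<^sub>M config_pair_space"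
proof -
  let ?W = "config_pair_space \<Otimes>\<^sub>M config_space"
  have A1: "(\<lambda>w. fst (fst w)) \<in> ?W \<rightarrow>\<^sub>M config_space" and A2: "(\<lambda>w. snd (fst w)) \<in> ?W \<rightarrow>\<^sub>M config_space"
    by simp_all
  show ?thesis
    unfolding two_type_departures_def
  proof (intro measurable_Pair measurable_departures A1 A2 measurable_snd measurable_config_diff
      measurable_config_add)
    fix w t assume w: "w \<in> space ?W"
    have "locally_finite (\<lambda>t. fst (fst w) t + snd (fst w) t)"
      using measurable_space[OF A1 w] measurable_space[OF A2 w] by (intro locally_finite_add) simp_all
    then show "departures (fst (fst w)) (snd w) t \<le>
        departures (\<lambda>t. fst (fst w) t + snd (fst w) t) (snd w) t"
      by (intro departures_mono) auto
  qed
qed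

text \<open>With \<open>T' = departures S T\<close>, the right-hand side
  is the two-type process built from the arrivals \<open>departures A (dual_services S T)\<close> and the
  services \<open>T'\<close>.\<close>

lemma two_type_departures_interchange:
  assumes lf: "locally_finite A" "locally_finite S" "locally_finite T"
    and simple: "\<And>t. S t \<le> 1" "\<And>t. T t \<le> 1"
    and queue: "bounded_queue A S" "bounded_queue S T"
  shows "two_type_departures (queue_map (A, S)) T =
    queue_map (departures A (dual_services S T), departures S T)"
proof -
  have "(\<lambda>t. departures A S t + unused_services A S t) = S"
    by (simp add: unused_services_def departures_le)
  then show ?thesis
    using departures_interchange[OF assms]
    by (simp add: two_type_departures_def queue_map_def unused_services_def[of _ "departures S T"])
qed

section \<open>Products of three laws and their marginals\<close>

lemma nn_integral_triple:
  assumes "prob_space P" "prob_space Q" "prob_space R"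
    and f: "f \<in> borel_measurable (P \<Otimes>\<^sub>M Q)" and g: "g \<in> borel_measurable R"
  shows "(\<integral>\<^sup>+w. f (fst w, fst (snd w)) * g (snd (snd w)) \<partial>(P \<Otimes>\<^sub>M (Q \<Otimes>\<^sub>M R))) =
    (\<integral>\<^sup>+p. f p \<partial>(P \<Otimes>\<^sub>M Q)) * (\<integral>\<^sup>+z. g z \<partial>R)"
proof -
  interpret P: prob_space P by fact
  interpret Q: prob_space Q by fact
  interpret R: prob_space R by fact
  interpret QR: pair_prob_space Q R ..
  note [measurable] = f g
  have "(\<integral>\<^sup>+w. f (fst w, fst (snd w)) * g (snd (snd w)) \<partial>(P \<Otimes>\<^sub>M (Q \<Otimes>\<^sub>M R))) =
      (\<integral>\<^sup>+x. \<integral>\<^sup>+v. f (x, fst v) * g (snd v) \<partial>(Q \<Otimes>\<^sub>M R) \<partial>P)"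
    by (subst QR.nn_integral_fst[symmetric]) simp_all
  also have "\<dots> = (\<integral>\<^sup>+x. \<integral>\<^sup>+y. \<integral>\<^sup>+z. f (x, y) * g z \<partial>R \<partial>Q \<partial>P)"
    by (intro nn_integral_cong, subst R.nn_integral_fst[symmetric]) simp_all
  also have "\<dots> = (\<integral>\<^sup>+x. \<integral>\<^sup>+y. f (x, y) * (\<integral>\<^sup>+z. g z \<partial>R) \<partial>Q \<partial>P)"
    by (intro nn_integral_cong nn_integral_cmult g)
  also have "\<dots> = (\<integral>\<^sup>+x. (\<integral>\<^sup>+y. f (x, y) \<partial>Q) * (\<integral>\<^sup>+z. g z \<partial>R) \<partial>P)"
    by (intro nn_integral_cong nn_integral_multc measurable_compose[OF _ f] measurable_Pair1') auto
  also have "\<dots> = (\<integral>\<^sup>+x. \<integral>\<^sup>+y. f (x, y) \<partial>Q \<partial>P) * (\<integral>\<^sup>+z. g z \<partial>R)"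
    by (intro nn_integral_multc Q.borel_measurable_nn_integral_fst f)
  also have "\<dots> = (\<integral>\<^sup>+p. f p \<partial>(P \<Otimes>\<^sub>M Q)) * (\<integral>\<^sup>+z. g z \<partial>R)"
    by (subst Q.nn_integral_fst[OF f]) simp
  finally show ?thesis .
qed

lemma distr_triple:
  assumes "prob_space P" "prob_space Q" "prob_space R"
    and f: "f \<in> P \<Otimes>\<^sub>M Q \<rightarrow>\<^sub>M X"
  shows "distr (P \<Otimes>\<^sub>M (Q \<Otimes>\<^sub>M R)) (X \<Otimes>\<^sub>M R) (\<lambda>w. (f (fst w, fst (snd w)), snd (snd w))) =
    distr (P \<Otimes>\<^sub>M Q) X f \<Otimes>\<^sub>M R"
proof (rule sym, rule pair_measure_eqI)
  interpret P: prob_space P by fact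
  interpret Q: prob_space Q by fact
  interpret R: prob_space R by fact
  interpret PQ: pair_prob_space P Q ..
  show "sigma_finite_measure (distr (P \<Otimes>\<^sub>M Q) X f)"
    using PQ.prob_space_distr[OF f] by (rule prob_space_imp_sigma_finite)
  show "sigma_finite_measure R" ..
  note [measurable] = f
  have h: "(\<lambda>w. (f (fst w, fst (snd w)), snd (snd w))) \<in> P \<Otimes>\<^sub>M (Q \<Otimes>\<^sub>M R) \<rightarrow>\<^sub>M X \<Otimes>\<^sub>M R"
    by measurable
  fix A B assume "A \<in> sets (distr (P \<Otimes>\<^sub>M Q) X f)" and B: "B \<in> sets R"
  then have A: "A \<in> sets X"
    by simp
  let ?W = "P \<Otimes>\<^sub>M (Q \<Otimes>\<^sub>M R)"
  have f': "(\<lambda>p. indicator A (f p) :: ennreal) \<in> borel_measurable (P \<Otimes>\<^sub>M Q)"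
    using A by measurable
  have g': "(indicator B :: _ \<Rightarrow> ennreal) \<in> borel_measurable R"
    using B by measurable
  have "emeasure (distr ?W (X \<Otimes>\<^sub>M R) (\<lambda>w. (f (fst w, fst (snd w)), snd (snd w)))) (A \<times> B) =
      (\<integral>\<^sup>+w. indicator (A \<times> B) (f (fst w, fst (snd w)), snd (snd w)) \<partial>?W)"
    using A B by (subst nn_integral_indicator[symmetric], simp, subst nn_integral_distr[OF h]) auto
  also have "\<dots> = (\<integral>\<^sup>+w. indicator A (f (fst w, fst (snd w))) * indicator B (snd (snd w)) \<partial>?W)"
    by (intro nn_integral_cong) (simp add: indicator_times)
  also have "\<dots> = (\<integral>\<^sup>+p. indicator A (f p) \<partial>(P \<Otimes>\<^sub>M Q)) * (\<integral>\<^sup>+z. indicator B z \<partial>R)"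
    by (rule nn_integral_triple[OF assms(1-3) f' g'])
  also have "(\<integral>\<^sup>+p. indicator A (f p) \<partial>(P \<Otimes>\<^sub>M Q)) = emeasure (distr (P \<Otimes>\<^sub>M Q) X f) A"
    using A by (subst nn_integral_distr[OF f, symmetric]) auto
  also have "(\<integral>\<^sup>+z. indicator B z \<partial>R) = emeasure R B"
    using B by simp
  finally show "emeasure (distr (P \<Otimes>\<^sub>M Q) X f) A * emeasure R B =
      emeasure (distr ?W (X \<Otimes>\<^sub>M R) (\<lambda>w. (f (fst w, fst (snd w)), snd (snd w)))) (A \<times> B)" ..
qed simp

lemma distr_pair_snd:
  assumes "prob_space P" "sigma_finite_measure Q"
  shows "distr (P \<Otimes>\<^sub>M Q) Q snd = Q"
proof (rule measure_eqI)
  interpret P: prob_space P by fact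
  interpret Q: sigma_finite_measure Q by fact
  fix A assume "A \<in> sets (distr (P \<Otimes>\<^sub>M Q) Q snd)"
  then have A: "A \<in> sets Q"
    by simp
  have "snd -` A \<inter> space (P \<Otimes>\<^sub>M Q) = space P \<times> A"
    using sets.sets_into_space[OF A] by (auto simp: space_pair_measure)
  then show "emeasure (distr (P \<Otimes>\<^sub>M Q) Q snd) A = emeasure Q A"
    using A by (simp add: emeasure_distr Q.emeasure_pair_measure_Times P.emeasure_space_1)
qed simp

context queue_laws
begin

lemma AE_bounded_queue_simple:
  "AE p in P \<Otimes>\<^sub>M Q. bounded_queue (fst p) (snd p) \<and> (\<forall>t. snd p t \<le> 1)"
  using AE_drains AE_sparse_cells AE_space
proof eventually_elim
  case (elim p)
  have lf: "locally_finite (fst p)" "locally_finite (snd p)"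
    using elim(3) by (simp_all add: space_PQ space_config_pair)
  then show ?case
    using drains_bounded_queue[OF lf elim(1)] sparse_cells_simple[OF lf] elim(2) by simp
qed

lemma departures_law: "distr (P \<Otimes>\<^sub>M Q) config_space (\<lambda>p. departures (fst p) (snd p)) = P"
proof -
  have out: "queue_output \<in> P \<Otimes>\<^sub>M Q \<rightarrow>\<^sub>M config_pair_space"
    by (rule measurable_PQ[OF measurable_queue_output])
  have "distr (P \<Otimes>\<^sub>M Q) config_space (\<lambda>p. departures (fst p) (snd p)) =
      distr (distr (P \<Otimes>\<^sub>M Q) config_pair_space queue_output) config_space fst"
    by (subst distr_distr[OF measurable_fst out]) (simp add: comp_def queue_output_def)
  also have "\<dots> = distr (P \<Otimes>\<^sub>M Q) P fst"
    unfolding burke by (intro distr_cong refl) (simp add: sets_P)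
  also have "\<dots> = P"
    by (rule Q.distr_pair_fst)
  finally show ?thesis .
qed

end

text \<open>By Burke's theorem for the queue \<open>(S, T)\<close>, the pair \<open>(departures S T, dual_services S T)\<close> is
  distributed as \<open>(S, T)\<close>; Burke's theorem for the queue with services \<open>dual_services S T\<close>
  then shows that \<open>departures A (dual_services S T)\<close> is distributed as \<open>A\<close>.\<close>

lemma interchanged_law:
  assumes PR: "queue_laws P R \<alpha> \<gamma>" and QR: "queue_laws Q R \<beta> \<gamma>"
  shows "distr (P \<Otimes>\<^sub>M (Q \<Otimes>\<^sub>M R)) config_pair_space
    (\<lambda>w. (departures (fst w) (dual_services (fst (snd w)) (snd (snd w))),
      departures (fst (snd w)) (snd (snd w)))) = P \<Otimes>\<^sub>M Q"
proof -
  interpret PR: queue_laws P R \<alpha> \<gamma> by fact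
  interpret QR: queue_laws Q R \<beta> \<gamma> by fact
  interpret RQ: pair_prob_space R Q ..
  let ?C = config_space and ?CC = config_pair_space
  have sets: "sets P = sets ?C" "sets Q = sets ?C" "sets R = sets ?C"
    by (simp_all add: PR.sets_P QR.sets_P QR.sets_Q)
  have PR_dep: "(\<lambda>p. departures (fst p) (snd p)) \<in> P \<Otimes>\<^sub>M R \<rightarrow>\<^sub>M ?C"
    by (intro PR.measurable_PQ measurable_departures measurable_fst measurable_snd)
  \<comment> \<open>Burke's theorem gives the dual services the law \<open>R\<close> and the
    departures the law \<open>Q\<close>. The swap brings the dual services next to the arrivals,
    whose services they become.\<close>
  define swapped where "swapped = (\<lambda>v. (snd (queue_output v), fst (queue_output v)))"
  have out: "queue_output \<in> Q \<Otimes>\<^sub>M R \<rightarrow>\<^sub>M ?CC"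
    by (rule QR.measurable_PQ[OF measurable_queue_output])
  have swapped: "swapped \<in> Q \<Otimes>\<^sub>M R \<rightarrow>\<^sub>M R \<Otimes>\<^sub>M Q"
  proof -
    have "swapped \<in> Q \<Otimes>\<^sub>M R \<rightarrow>\<^sub>M ?CC"
      unfolding swapped_def
      by (intro measurable_Pair measurable_compose[OF out] measurable_fst measurable_snd)
    then show ?thesis
      by (subst measurable_cong_sets[OF refl sets_pair_measure_cong[OF sets(3,2)]])
  qed
  have law: "distr (Q \<Otimes>\<^sub>M R) (R \<Otimes>\<^sub>M Q) swapped = R \<Otimes>\<^sub>M Q"
  proof -
    have "distr (Q \<Otimes>\<^sub>M R) (R \<Otimes>\<^sub>M Q) swapped =
        distr (distr (Q \<Otimes>\<^sub>M R) ?CC queue_output) (R \<Otimes>\<^sub>M Q) (\<lambda>(x, y). (y, x))"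
    proof (subst distr_distr[OF _ out])
      show "(\<lambda>(x, y). (y, x)) \<in> ?CC \<rightarrow>\<^sub>M R \<Otimes>\<^sub>M Q"
        by (subst measurable_cong_sets[OF refl sets_pair_measure_cong[OF sets(3,2)]])
          (rule measurable_pair_swap')
    qed (simp add: comp_def case_prod_beta swapped_def)
    also have "\<dots> = R \<Otimes>\<^sub>M Q"
      unfolding QR.burke by (rule RQ.distr_pair_swap[symmetric])
    finally show ?thesis .
  qed
  let ?h = "\<lambda>w. (departures (fst w) (fst (snd w)), snd (snd w))"
  have h: "?h \<in> P \<Otimes>\<^sub>M (R \<Otimes>\<^sub>M Q) \<rightarrow>\<^sub>M ?CC"
    by (subst measurable_cong_sets[OF sets_pair_measure_cong[OF sets(1)
        sets_pair_measure_cong[OF sets(3,2)]] refl])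
      (intro measurable_Pair measurable_departures measurable_fst measurable_snd
        measurable_compose[OF measurable_snd])
  have "distr (P \<Otimes>\<^sub>M (Q \<Otimes>\<^sub>M R)) ?CC
      (\<lambda>w. (departures (fst w) (dual_services (fst (snd w)) (snd (snd w))),
        departures (fst (snd w)) (snd (snd w)))) =
      distr (distr (P \<Otimes>\<^sub>M (Q \<Otimes>\<^sub>M R)) (P \<Otimes>\<^sub>M (R \<Otimes>\<^sub>M Q)) (\<lambda>(x, y). (x, swapped y))) ?CC ?h"
  proof (subst distr_distr[OF h])
    show "(\<lambda>(x, y). (x, swapped y)) \<in> P \<Otimes>\<^sub>M (Q \<Otimes>\<^sub>M R) \<rightarrow>\<^sub>M P \<Otimes>\<^sub>M (R \<Otimes>\<^sub>M Q)"
      unfolding case_prod_beta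
      by (intro measurable_Pair measurable_fst measurable_compose[OF measurable_snd swapped])
  qed (simp add: comp_def case_prod_beta swapped_def queue_output_def)
  \<comment> \<open>Dual services and departures are functions of the last two coordinates alone, so
    the first coordinate remains independent of them.\<close>
  also have "distr (P \<Otimes>\<^sub>M (Q \<Otimes>\<^sub>M R)) (P \<Otimes>\<^sub>M (R \<Otimes>\<^sub>M Q)) (\<lambda>(x, y). (x, swapped y)) =
      distr P P (\<lambda>x. x) \<Otimes>\<^sub>M distr (Q \<Otimes>\<^sub>M R) (R \<Otimes>\<^sub>M Q) swapped"
    by (rule pair_measure_distr[symmetric, OF measurable_ident_sets[OF refl] swapped])
      (simp add: law RQ.sigma_finite_measure_axioms)
  also have "\<dots> = P \<Otimes>\<^sub>M (R \<Otimes>\<^sub>M Q)"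
    by (simp add: law)
  also have "distr (P \<Otimes>\<^sub>M (R \<Otimes>\<^sub>M Q)) ?CC ?h = distr (P \<Otimes>\<^sub>M (R \<Otimes>\<^sub>M Q)) (?C \<Otimes>\<^sub>M Q) ?h"
    by (intro distr_cong refl sets_pair_measure_cong) (simp add: sets)
  also have "\<dots> = distr (P \<Otimes>\<^sub>M R) ?C (\<lambda>p. departures (fst p) (snd p)) \<Otimes>\<^sub>M Q"
    using distr_triple[OF PR.P.prob_space_axioms PR.Q.prob_space_axioms QR.P.prob_space_axioms PR_dep]
    by simp
  also have "\<dots> = P \<Otimes>\<^sub>M Q"
    by (simp add: PR.departures_law)
  finally show ?thesis .
qed

lemma fixed_point_law:
  assumes P: "poisson_law P \<alpha>" and Q: "poisson_law Q \<beta>" and R: "poisson_law R \<gamma>"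
    and rates: "0 < \<alpha>" "\<alpha> < \<beta>" "\<beta> < \<gamma>"
  defines "F \<equiv> distr (P \<Otimes>\<^sub>M Q) config_pair_space queue_map"
  shows "distr (F \<Otimes>\<^sub>M R) config_pair_space (\<lambda>w. two_type_departures (fst w) (snd w)) = F"
proof -
  interpret PQ: queue_laws P Q \<alpha> \<beta>
    using assms by unfold_locales auto
  interpret QR: queue_laws Q R \<beta> \<gamma>
    using assms by unfold_locales auto
  have PR: "queue_laws P R \<alpha> \<gamma>"
    using assms by unfold_locales auto
  let ?C = config_space and ?CC = config_pair_space and ?W = "P \<Otimes>\<^sub>M (Q \<Otimes>\<^sub>M R)"
  have sets: "sets P = sets ?C" "sets Q = sets ?C" "sets R = sets ?C"
    by (simp_all add: PQ.sets_P QR.sets_P QR.sets_Q)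
  have sets_W: "sets ?W = sets (?C \<Otimes>\<^sub>M ?CC)"
    by (intro sets_pair_measure_cong sets)
  have W: "f \<in> ?W \<rightarrow>\<^sub>M N" if "f \<in> ?C \<Otimes>\<^sub>M ?CC \<rightarrow>\<^sub>M N" for f :: "config \<times> config \<times> config \<Rightarrow> 'x" and N
    using that by (subst measurable_cong_sets[OF sets_W refl])
  have queue_map: "queue_map \<in> P \<Otimes>\<^sub>M Q \<rightarrow>\<^sub>M ?CC"
    by (rule PQ.measurable_PQ[OF measurable_queue_map])
  let ?f = "\<lambda>w. (queue_map (fst w, fst (snd w)), snd (snd w))"
  let ?g = "\<lambda>w. (departures (fst w) (dual_services (fst (snd w)) (snd (snd w))),
    departures (fst (snd w)) (snd (snd w)))"
  have f: "?f \<in> ?W \<rightarrow>\<^sub>M ?CC \<Otimes>\<^sub>M ?C"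
    by (intro W measurable_Pair measurable_compose[OF _ measurable_queue_map] measurable_fst
        measurable_compose[OF measurable_snd] measurable_snd)
  have g: "?g \<in> ?W \<rightarrow>\<^sub>M ?CC"
    unfolding dual_services_def
    by (intro W measurable_Pair measurable_departures measurable_config_add measurable_unused_services
        measurable_fst measurable_compose[OF measurable_snd] measurable_snd)
  have "F \<Otimes>\<^sub>M R = distr ?W (?CC \<Otimes>\<^sub>M R) ?f"
    unfolding F_def
    by (rule distr_triple[symmetric, OF PQ.P.prob_space_axioms PQ.Q.prob_space_axioms
        QR.Q.prob_space_axioms queue_map])
  also have "\<dots> = distr ?W (?CC \<Otimes>\<^sub>M ?C) ?f"
    by (intro distr_cong refl sets_pair_measure_cong sets)
  finally have "distr (F \<Otimes>\<^sub>M R) ?CC (\<lambda>w. two_type_departures (fst w) (snd w)) =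
      distr ?W ?CC (\<lambda>w. two_type_departures (queue_map (fst w, fst (snd w))) (snd (snd w)))"
    by (simp add: distr_distr[OF measurable_two_type_departures f] comp_def)
  \<comment> \<open>The pathwise interchange is available for finite queues with simple services,
    which is an almost sure event.\<close>
  also have "\<dots> = distr ?W ?CC (\<lambda>w. queue_map (?g w))"
  proof (rule distr_cong_AE[OF refl refl])
    \<comment> \<open>The almost sure properties are known for each consecutive pair of processes;
      they are pulled back along the projections, whose image laws are the two-fold
      products.\<close>
    have m: "(\<lambda>w. (fst w, fst (snd w))) \<in> ?W \<rightarrow>\<^sub>M P \<Otimes>\<^sub>M Q"
      by (intro measurable_Pair measurable_fst measurable_compose[OF measurable_snd])
    have marginal: "distr ?W (P \<Otimes>\<^sub>M Q) (\<lambda>w. (fst w, fst (snd w))) = P \<Otimes>\<^sub>M Q"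
    proof -
      have "distr P P (\<lambda>x. x) \<Otimes>\<^sub>M distr (Q \<Otimes>\<^sub>M R) Q fst =
          distr ?W (P \<Otimes>\<^sub>M Q) (\<lambda>(x, y). (x, fst y))"
        by (intro pair_measure_distr measurable_ident_sets measurable_fst refl)
          (simp add: QR.Q.distr_pair_fst prob_space_imp_sigma_finite PQ.Q.prob_space_axioms)
      then show ?thesis
        unfolding QR.Q.distr_pair_fst distr_id case_prod_beta by (rule sym)
    qed
    have "AE p in distr ?W (P \<Otimes>\<^sub>M Q) (\<lambda>w. (fst w, fst (snd w))).
        bounded_queue (fst p) (snd p) \<and> (\<forall>t. snd p t \<le> 1)"
      unfolding marginal by (rule PQ.AE_bounded_queue_simple)
    then have AE1: "AE w in ?W. bounded_queue (fst w) (fst (snd w)) \<and> (\<forall>t. fst (snd w) t \<le> 1)"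
      by (auto dest: AE_distrD[OF m])
    have marginal: "distr ?W (Q \<Otimes>\<^sub>M R) snd = Q \<Otimes>\<^sub>M R"
      by (intro distr_pair_snd PQ.P.prob_space_axioms prob_space_imp_sigma_finite QR.PQ.prob_space_axioms)
    have "AE p in distr ?W (Q \<Otimes>\<^sub>M R) snd. bounded_queue (fst p) (snd p) \<and> (\<forall>t. snd p t \<le> 1)"
      unfolding marginal by (rule QR.AE_bounded_queue_simple)
    then have AE2: "AE w in ?W. bounded_queue (fst (snd w)) (snd (snd w)) \<and> (\<forall>t. snd (snd w) t \<le> 1)"
      by (auto dest: AE_distrD[OF measurable_snd])
    show "AE w in ?W. two_type_departures (queue_map (fst w, fst (snd w))) (snd (snd w)) = queue_map (?g w)"
      using AE1 AE2 AE_space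
    proof eventually_elim
      case (elim w)
      have "w \<in> space (?C \<Otimes>\<^sub>M ?CC)"
        using elim(3) sets_eq_imp_space_eq[OF sets_W] by simp
      then have "locally_finite (fst w)" "locally_finite (fst (snd w))" "locally_finite (snd (snd w))"
        by (auto simp: space_pair_measure)
      then show ?case
        using elim by (intro two_type_departures_interchange) auto
    qed
    show "(\<lambda>w. two_type_departures (queue_map (fst w, fst (snd w))) (snd (snd w))) \<in> ?W \<rightarrow>\<^sub>M ?CC"
      using measurable_compose[OF f measurable_two_type_departures] by simp
    show "(\<lambda>w. queue_map (?g w)) \<in> ?W \<rightarrow>\<^sub>M ?CC"
      by (rule measurable_compose[OF g measurable_queue_map])
  qed
  also have "\<dots> = distr (distr ?W ?CC ?g) ?CC queue_map"
    by (simp add: distr_distr[OF measurable_queue_map g] comp_def)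
  also have "\<dots> = F"
    unfolding F_def interchanged_law[OF PR QR.queue_laws_axioms] ..
  finally show ?thesis .
qed

lemma indep_rvs_distr:
  assumes "prob_space M" and "indep_rvs M MX X MY Y"
  shows "distr M (MX \<Otimes>\<^sub>M MY) (\<lambda>\<omega>. (X \<omega>, Y \<omega>)) = distr M MX X \<Otimes>\<^sub>M distr M MY Y"
proof (rule sym, rule pair_measure_eqI)
  interpret prob_space M by fact
  have X: "X \<in> M \<rightarrow>\<^sub>M MX" and Y: "Y \<in> M \<rightarrow>\<^sub>M MY"
    and indep: "indep_set {X -` B \<inter> space M |B. B \<in> sets MX} {Y -` B \<inter> space M |B. B \<in> sets MY}"
    using assms(2) by (simp_all add: indep_rvs_def)
  show "sigma_finite_measure (distr M MX X)" "sigma_finite_measure (distr M MY Y)"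
    using prob_space_distr[OF X] prob_space_distr[OF Y] by (auto intro: prob_space_imp_sigma_finite)
  fix A B assume "A \<in> sets (distr M MX X)" "B \<in> sets (distr M MY Y)"
  then have A: "A \<in> sets MX" and B: "B \<in> sets MY"
    by auto
  have "emeasure (distr M (MX \<Otimes>\<^sub>M MY) (\<lambda>\<omega>. (X \<omega>, Y \<omega>))) (A \<times> B) =
      emeasure M ((\<lambda>\<omega>. (X \<omega>, Y \<omega>)) -` (A \<times> B) \<inter> space M)"
    using A B by (intro emeasure_distr measurable_Pair X Y) auto
  also have "(\<lambda>\<omega>. (X \<omega>, Y \<omega>)) -` (A \<times> B) \<inter> space M = (X -` A \<inter> space M) \<inter> (Y -` B \<inter> space M)"
    by auto
  also have "emeasure M \<dots> = ennreal (prob (X -` A \<inter> space M) * prob (Y -` B \<inter> space M))"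
    using indep_setD[OF indep, of "X -` A \<inter> space M" "Y -` B \<inter> space M"] A B
    by (auto simp: emeasure_eq_measure)
  also have "\<dots> = emeasure (distr M MX X) A * emeasure (distr M MY Y) B"
    using A B by (simp add: emeasure_distr[OF X] emeasure_distr[OF Y] emeasure_eq_measure ennreal_mult)
  finally show "emeasure (distr M MX X) A * emeasure (distr M MY Y) B =
      emeasure (distr M (MX \<Otimes>\<^sub>M MY) (\<lambda>\<omega>. (X \<omega>, Y \<omega>))) (A \<times> B)" ..
qed simp

theorem theorem2p1:
  fixes lam\<^sub>1 lam\<^sub>2 \<mu> :: real
    and M :: "'a measure" and A S :: "'a \<Rightarrow> config"
    and N :: "'b measure" and A' :: "'b \<Rightarrow> config \<times> config" and S\<^sub>\<mu> :: "'b \<Rightarrow> config"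
    and F :: "(config \<times> config) measure"
  assumes rates: "lam\<^sub>1 > 0" "lam\<^sub>2 > 0" "\<mu> > lam\<^sub>1 + lam\<^sub>2"
    and M: "prob_space M"
    and A: "poisson_process M lam\<^sub>1 A"
    and S: "poisson_process M (lam\<^sub>1 + lam\<^sub>2) S"
    and indep_A_S: "prob_space.indep_var M config_space A config_space S"
    and F: "F = distr M (config_space \<Otimes>\<^sub>M config_space)
                  (\<lambda>\<omega>. (departures (A \<omega>) (S \<omega>), unused_services (A \<omega>) (S \<omega>)))"
    and N: "prob_space N"
    and A': "A' \<in> N \<rightarrow>\<^sub>M config_space \<Otimes>\<^sub>M config_space"
    and A'_law: "distr N (config_space \<Otimes>\<^sub>M config_space) A' = F"
    and S\<^sub>\<mu>: "poisson_process N \<mu> S\<^sub>\<mu>"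
    and indep_A'_S\<^sub>\<mu>:
      "indep_rvs N (config_space \<Otimes>\<^sub>M config_space) A' config_space S\<^sub>\<mu>"
  shows "(\<lambda>\<omega>. two_type_departures (A' \<omega>) (S\<^sub>\<mu> \<omega>)) \<in> N \<rightarrow>\<^sub>M config_space \<Otimes>\<^sub>M config_space \<and>
         distr N (config_space \<Otimes>\<^sub>M config_space)
           (\<lambda>\<omega>. two_type_departures (A' \<omega>) (S\<^sub>\<mu> \<omega>)) = F"
proof -
  let ?P = "distr M config_space A" and ?Q = "distr M config_space S" and ?R = "distr N config_space S\<^sub>\<mu>"
  have AS: "(\<lambda>\<omega>. (A \<omega>, S \<omega>)) \<in> M \<rightarrow>\<^sub>M config_pair_space"
    and A'S: "(\<lambda>\<omega>. (A' \<omega>, S\<^sub>\<mu> \<omega>)) \<in> N \<rightarrow>\<^sub>M config_pair_space \<Otimes>\<^sub>M config_space"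
    using A S A' S\<^sub>\<mu> by (auto simp: poisson_process_def)
  have law_AS: "distr M config_pair_space (\<lambda>\<omega>. (A \<omega>, S \<omega>)) = ?P \<Otimes>\<^sub>M ?Q"
    by (rule indep_rvs_distr[OF M iffD2[OF indep_rvs_iff_indep_var[OF M] indep_A_S]])
  have F': "F = distr (?P \<Otimes>\<^sub>M ?Q) config_pair_space queue_map"
    unfolding F law_AS[symmetric] distr_distr[OF measurable_queue_map AS]
    by (simp add: comp_def queue_map_def)
  have "distr N config_pair_space (\<lambda>\<omega>. two_type_departures (A' \<omega>) (S\<^sub>\<mu> \<omega>)) =
      distr (distr N (config_pair_space \<Otimes>\<^sub>M config_space) (\<lambda>\<omega>. (A' \<omega>, S\<^sub>\<mu> \<omega>))) config_pair_space
        (\<lambda>w. two_type_departures (fst w) (snd w))"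
    by (simp add: distr_distr[OF measurable_two_type_departures A'S] comp_def)
  also have "distr N (config_pair_space \<Otimes>\<^sub>M config_space) (\<lambda>\<omega>. (A' \<omega>, S\<^sub>\<mu> \<omega>)) = F \<Otimes>\<^sub>M ?R"
    unfolding indep_rvs_distr[OF N indep_A'_S\<^sub>\<mu>] A'_law ..
  also have "distr (F \<Otimes>\<^sub>M ?R) config_pair_space (\<lambda>w. two_type_departures (fst w) (snd w)) = F"
    unfolding F' using rates
    by (intro fixed_point_law[where \<alpha> = lam\<^sub>1 and \<beta> = "lam\<^sub>1 + lam\<^sub>2" and \<gamma> = \<mu>]
        poisson_law_distr M N A S S\<^sub>\<mu>) auto
  finally show ?thesis
    using measurable_compose[OF A'S measurable_two_type_departures] by simp
qed

end
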